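(* An equilibrated radiation bath cannot on its own (that is, with surroundings absent) induce apparent CP bias in the system, but it can be CP-conductive, passing CP bias from CP-unbalanced surroundings to the system. If, however, the bath-coupling operators $V_j$ are all diagonal in the CP-diagonalised basis of the bath, the CP imbalance of the environment becomes entirely invisible to the system, which remains apparently CP-invariant.
   Context: Setting. A quantum system $S$ interacts with an environment consisting of a bath $B$ and surroundings $G$, in the chain $S\leftrightarrow B\leftrightarrow G$. The total Hilbert space is $\mathcal H_S\otimes\mathcal H_B\otimes\mathcal H_G$ and the total Hamiltonian is $H=H_S+H_B+H_G+h_{SB}+h_{BG}$ (each term extended by identities), where $h_{SB}$ acts on $\mathcal H_S\otimes\mathcal H_B$ and $h_{BG}$ on $\mathcal H_B\otimes\mathcal H_G$; there is no direct system--surroundings interaction. Put $H_{BG}=H_B\otimes I_G+I_B\otimes H_G+h_{BG}$. All Hamiltonians are Hermitian. CP. CP acts by a unitary operator $U_{CP}$ on each space (and correspondingly on tensor products); $\mathcal U_{CP}(X)=U_{CP}XU_{CP}^\dagger$. An operator $X$ is CP-even (CP-invariant) if $\mathcal U_{CP}(X)=X$ and CP-odd if $\mathcal U_{CP}(X)=-X$. For a density matrix, $\bar\rho=\mathcal U_{CP}(\rho)$; a state is CP-balanced if $\bar\rho=\rho$ and CP-unbalanced otherwise. All Hamiltonians are assumed CP-invariant and CPT-invariant (invariant under the antiunitary $\Theta_{CPT}=U_{CP}\Theta_T$, with $\Theta_T$ time reversal), so no fundamental CP violation is present; the state of the surroundings may be CP-unbalanced, e.g. matter-dominated. Coupling.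 The system--bath interaction is written in CP-adapted form $h_{SB}=\sum_jL_j\otimes V_j$ with $L_j=L_j^\dagger$ on $\mathcal H_S$, $V_j=V_j^\dagger$ on $\mathcal H_B$ (the bath-coupling operators), and $\mathcal U_{CP}(L_j)=\zeta_jL_j$, $\mathcal U_{CP}(V_j)=\zeta_jV_j$, $\zeta_j=\pm1$. Pure dephasing is assumed: $[H_S,L_j]=0$, with $L_j=\sum_n\lambda_{jn}|n\rangle\langle n|$ in the energy eigenbasis $|n\rangle$ of $H_S$. Reduced dynamics. The system density matrix $\rho_S$ evolves by the Redfield equation $d\rho_S/dt=\mathcal R(\rho_S;\rho_{BG})$ (second order in the interaction, Born approximation $\rho\approx\rho_S\otimes\rho_{BG}$, stationary environment state $[H_{BG},\rho_{BG}]=0$), where $$\mathcal R(\rho_S;\rho_{BG})=-\tfrac{i}{\hbar}[H_S,\rho_S]-\tfrac{i}{\hbar}\sum_j\mu_j[L_j,\rho_S]-\tfrac1{\hbar^2}\sum_{j,\ell}\Big(A'_{j\ell}(t)[L_j,L_\ell\rho_S]+A'_{j\ell}(t)^*[\rho_SL_\ell,L_j]\Big).$$ Here $W_j=V_j\otimes I_G$, $W_j^{(0)}(-\tau)=e^{-iH_{BG}\tau/\hbar}W_je^{iH_{BG}\tau/\hbar}$, $\rho_B=\operatorname{Tr}_G\rho_{BG}$, $\mu_j=\operatorname{Tr}_B(V_j\rho_B)$, $C'_{j\ell}(\tau)=\operatorname{Tr}_{BG}(W_jW_\ell^{(0)}(-\tau)\rho_{BG})-\mu_j\mu_\ell$,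 and $A'_{j\ell}(t)=\int_0^tC'_{j\ell}(\tau)\,d\tau$. Apparent CP invariance. The system is apparently CP-invariant if its reduced evolution is covariant when CP is applied to the system but not to the environment: $d\bar\rho_S/dt=\mathcal U_{CP}\big(\mathcal R(\rho_S;\rho_{BG})\big)=\mathcal R(\bar\rho_S;\rho_{BG})$. An apparent CP bias is a failure of this property in the reduced dynamics (although all Hamiltonians are CP-invariant). The bath is CP-conductive if it transmits the CP imbalance of the surroundings to the system, and CP-screening if the CP-unbalanced influence of the surroundings does not affect the system, whose evolution remains apparently CP-invariant. Equilibrated radiation bath. The bath is electromagnetic radiation, with CP-invariant Hamiltonian $H_B$, in thermal equilibrium at temperature $T$: it is presumed to remain in the Gibbs state $\rho_B^{\mathrm{eq}}=e^{-H_B/(k_{\mathrm B}T)}/\operatorname{Tr}\big(e^{-H_B/(k_{\mathrm B}T)}\big)$, where $k_{\mathrm B}$ is the Boltzmann constant. (Radiation is not CP-neutral, i.e. not every one of its states is mapped onto itself by CP, since the magnetic field changes sign under CP.) "On its own" refers to the case in which surroundings are absent, so that $\rho_{BG}=\rho_B=\rho_B^{\mathrm{eq}}$. CP-diagonalised basis. This is a basis of energy eigenstates $|k\rangle$ of the bath, $H_B|k\rangle=E_k|k\rangle$, with $U_{CP}|k\rangle=\xi_k|k\rangle$, $\xi_k=\pm1$. That $V_j$ is diagonal in it means $V_j=\sum_kv_{jk}|k\rangle\langle k|$. *)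

theory Defs
  imports "HOL-Analysis.Analysis" "HOL-Library.Multiset"
begin

section \<open>Hilbert spaces\<close>

text \<open>Every complex Hilbert space is isomorphic to \<open>\<ell>\<^sup>2(I)\<close> for an index set \<open>I\<close>; its dimension is
  arbitrary, and the tensor product of \<open>\<ell>\<^sup>2(I)\<close> and \<open>\<ell>\<^sup>2(J)\<close> is \<open>\<ell>\<^sup>2(I \<times> J)\<close>.\<close>

typedef 'a ell2 = "{f :: 'a \<Rightarrow> complex. (\<lambda>i. (cmod (f i))\<^sup>2) summable_on UNIV}"
  morphisms amp Abs_ell2
proof
  show "(\<lambda>_. 0) \<in> {f :: 'a \<Rightarrow> complex. (\<lambda>i. (cmod (f i))\<^sup>2) summable_on UNIV}"
    by simp
qed

lemma summable_amp: "(\<lambda>i. (cmod (amp x i))\<^sup>2) summable_on UNIV"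
  using amp[of x] by simp

lemma amp_Abs: "(\<lambda>i. (cmod (f i))\<^sup>2) summable_on UNIV \<Longrightarrow> amp (Abs_ell2 f) = f"
  by (simp add: Abs_ell2_inverse)

lemma ell2_eqI: "(\<And>i. amp x i = amp y i) \<Longrightarrow> x = y"
  using amp_inject by blast

lemma summable_sq_add:
  assumes "(\<lambda>i. (cmod (f i))\<^sup>2) summable_on UNIV" "(\<lambda>i. (cmod (g i))\<^sup>2) summable_on UNIV"
  shows "(\<lambda>i. (cmod (f i + g i))\<^sup>2) summable_on UNIV"
proof (rule summable_on_comparison_test)
  show "(\<lambda>i. 2 * (cmod (f i))\<^sup>2 + 2 * (cmod (g i))\<^sup>2) summable_on UNIV"
    using assms by (intro summable_on_add summable_on_cmult_right)
next
  fix i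
  have "(cmod (f i + g i))\<^sup>2 \<le> (cmod (f i) + cmod (g i))\<^sup>2"
    by (intro power_mono norm_triangle_ineq) simp
  also have "\<dots> \<le> 2 * (cmod (f i))\<^sup>2 + 2 * (cmod (g i))\<^sup>2"
    using sum_squares_bound[of "cmod (f i)" "cmod (g i)"] by (simp add: power2_sum)
  finally show "(cmod (f i + g i))\<^sup>2 \<le> 2 * (cmod (f i))\<^sup>2 + 2 * (cmod (g i))\<^sup>2" .
qed simp

lemma summable_sq_mult:
  "(\<lambda>i. (cmod (f i))\<^sup>2) summable_on UNIV \<Longrightarrow> (\<lambda>i. (cmod (c * f i))\<^sup>2) summable_on UNIV"
  by (auto simp: norm_mult power_mult_distrib intro!: summable_on_cmult_right)

lemma abs_summable_amp_mult:
  "(\<lambda>i. cmod (cnj (amp x i) * amp y i)) summable_on UNIV"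
proof (rule summable_on_comparison_test)
  show "(\<lambda>i. (cmod (amp x i))\<^sup>2 + (cmod (amp y i))\<^sup>2) summable_on UNIV"
    by (intro summable_on_add summable_amp)
next
  fix i
  show "cmod (cnj (amp x i) * amp y i) \<le> (cmod (amp x i))\<^sup>2 + (cmod (amp y i))\<^sup>2"
    using sum_squares_bound[of "cmod (amp x i)" "cmod (amp y i)"]
      mult_nonneg_nonneg[OF norm_ge_zero[of "amp x i"] norm_ge_zero[of "amp y i"]]
    unfolding norm_mult complex_mod_cnj by linarith
qed simp

definition scaleC :: "complex \<Rightarrow> 'a ell2 \<Rightarrow> 'a ell2" (infixr "*\<^sub>C" 75) where
  "c *\<^sub>C x = Abs_ell2 (\<lambda>i. c * amp x i)"

definition cinner :: "'a ell2 \<Rightarrow> 'a ell2 \<Rightarrow> complex" where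
  "cinner x y = (\<Sum>\<^sub>\<infinity>i. cnj (amp x i) * amp y i)"

definition ket :: "'a \<Rightarrow> 'a ell2" where
  "ket i = Abs_ell2 (\<lambda>j. if j = i then 1 else 0)"

lemma amp_scaleC [simp]: "amp (c *\<^sub>C x) i = c * amp x i"
  unfolding scaleC_def by (subst amp_Abs) (auto intro: summable_sq_mult summable_amp)

instantiation ell2 :: (type) real_inner
begin

definition zero_ell2 :: "'a ell2" where "zero_ell2 = Abs_ell2 (\<lambda>_. 0)"
definition plus_ell2 :: "'a ell2 \<Rightarrow> 'a ell2 \<Rightarrow> 'a ell2" where
  "plus_ell2 x y = Abs_ell2 (\<lambda>i. amp x i + amp y i)"
definition uminus_ell2 :: "'a ell2 \<Rightarrow> 'a ell2" where "uminus_ell2 x = (-1) *\<^sub>C x"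
definition minus_ell2 :: "'a ell2 \<Rightarrow> 'a ell2 \<Rightarrow> 'a ell2" where "minus_ell2 x y = x + - y"
definition scaleR_ell2 :: "real \<Rightarrow> 'a ell2 \<Rightarrow> 'a ell2" where
  "scaleR_ell2 r x = complex_of_real r *\<^sub>C x"
definition inner_ell2 :: "'a ell2 \<Rightarrow> 'a ell2 \<Rightarrow> real" where
  "inner_ell2 x y = Re (cinner x y)"
definition norm_ell2 :: "'a ell2 \<Rightarrow> real" where "norm_ell2 x = sqrt (inner x x)"
definition dist_ell2 :: "'a ell2 \<Rightarrow> 'a ell2 \<Rightarrow> real" where "dist_ell2 x y = norm (x - y)"
definition sgn_ell2 :: "'a ell2 \<Rightarrow> 'a ell2" where "sgn_ell2 x = inverse (norm x) *\<^sub>R x"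
definition uniformity_ell2 :: "('a ell2 \<times> 'a ell2) filter" where
  "uniformity_ell2 = (INF e\<in>{0 <..}. principal {(x, y). dist x y < e})"
definition open_ell2 :: "'a ell2 set \<Rightarrow> bool" where
  "open_ell2 U = (\<forall>x\<in>U. \<forall>\<^sub>F (x', y) in uniformity. x' = x \<longrightarrow> y \<in> U)"

lemma amp_zero: "amp (0 :: 'a ell2) i = 0"
  unfolding zero_ell2_def by (subst amp_Abs) auto

lemma amp_plus: "amp (x + y :: 'a ell2) i = amp x i + amp y i"
  unfolding plus_ell2_def by (subst amp_Abs) (auto intro: summable_sq_add summable_amp)

lemma amp_uminus: "amp (- x :: 'a ell2) i = - amp x i"
  by (simp add: uminus_ell2_def)

lemma amp_minus: "amp (x - y :: 'a ell2) i = amp x i - amp y i"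
  by (simp add: minus_ell2_def amp_plus amp_uminus)

lemma amp_scaleR: "amp (r *\<^sub>R x :: 'a ell2) i = of_real r * amp x i"
  by (simp add: scaleR_ell2_def)

lemmas amp_ops = amp_zero amp_plus amp_uminus amp_minus amp_scaleR

lemma summable_cinner: "(\<lambda>i. cnj (amp x i) * amp y i) summable_on UNIV"
  using abs_summable_amp_mult by (rule abs_summable_summable)

lemma cinner_add_left: "cinner (x + y :: 'a ell2) z = cinner x z + cinner y z"
  unfolding cinner_def
  by (subst infsum_add[symmetric])
     (auto simp: amp_ops distrib_right intro!: summable_cinner)

lemma cinner_scaleC_left: "cinner (c *\<^sub>C x :: 'a ell2) z = cnj c * cinner x z"
  unfolding cinner_def by (subst infsum_cmult_right'[symmetric]) (simp add: mult.assoc)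

lemma cinner_commute: "cinner (x :: 'a ell2) y = cnj (cinner y x)"
  unfolding cinner_def by (subst infsum_cnj[symmetric]) (simp add: mult.commute)

lemma cinner_self: "cinner (x :: 'a ell2) x = of_real (\<Sum>\<^sub>\<infinity>i. (cmod (amp x i))\<^sup>2)"
proof -
  have "((\<lambda>i. complex_of_real ((cmod (amp x i))\<^sup>2)) has_sum of_real (\<Sum>\<^sub>\<infinity>i. (cmod (amp x i))\<^sup>2)) UNIV"
    by (intro has_sum_of_real has_sum_infsum summable_amp)
  then show ?thesis
    unfolding cinner_def
    by (intro infsumI) (simp only: complex_norm_square mult.commute)
qed

instance
proof
  fix x y z :: "'a ell2" and r s :: real
  show "x + y + z = x + (y + z)" "x + y = y + x" "0 + x = x" "- x + x = 0" "x - y = x + - y"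
    "r *\<^sub>R (x + y) = r *\<^sub>R x + r *\<^sub>R y" "(r + s) *\<^sub>R x = r *\<^sub>R x + s *\<^sub>R x"
    "r *\<^sub>R s *\<^sub>R x = (r * s) *\<^sub>R x" "1 *\<^sub>R x = x"
    by (auto intro!: ell2_eqI simp: amp_ops algebra_simps)
  show "dist x y = norm (x - y)" by (rule dist_ell2_def)
  show "sgn x = inverse (norm x) *\<^sub>R x" by (rule sgn_ell2_def)
  show "(uniformity :: ('a ell2 \<times> 'a ell2) filter) = (INF e\<in>{0 <..}. principal {(x, y). dist x y < e})"
    by (rule uniformity_ell2_def)
  show "open U = (\<forall>x\<in>U. \<forall>\<^sub>F (x', y) in uniformity. x' = x \<longrightarrow> y \<in> U)" for U :: "'a ell2 set"
    by (rule open_ell2_def)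
  show "inner x y = inner y x"
    unfolding inner_ell2_def by (subst cinner_commute) simp
  show "inner (x + y) z = inner x z + inner y z"
    by (simp add: inner_ell2_def cinner_add_left)
  show "inner (r *\<^sub>R x) y = r * inner x y"
    by (simp add: inner_ell2_def scaleR_ell2_def cinner_scaleC_left)
  show "0 \<le> inner x x"
    by (simp add: inner_ell2_def cinner_self infsum_nonneg)
  show "(inner x x = 0) = (x = 0)"
  proof
    assume "inner x x = 0"
    then have "(\<Sum>\<^sub>\<infinity>i. (cmod (amp x i))\<^sup>2) = 0"
      by (simp add: inner_ell2_def cinner_self)
    then have "(cmod (amp x i))\<^sup>2 = 0" for i
      using nonneg_infsum_le_0D[of "\<lambda>i. (cmod (amp x i))\<^sup>2" UNIV i] summable_amp[of x] by simp
    then show "x = 0" by (intro ell2_eqI) (simp add: amp_ops)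
  qed (simp add: inner_ell2_def cinner_def amp_ops)
  show "norm x = sqrt (inner x x)" by (rule norm_ell2_def)
qed

end

lemma norm_sq_ell2: "(norm (x :: 'a ell2))\<^sup>2 = (\<Sum>\<^sub>\<infinity>i. (cmod (amp x i))\<^sup>2)"
  by (simp add: norm_ell2_def inner_ell2_def cinner_self infsum_nonneg)

lemma sum_amp_le: "finite F \<Longrightarrow> (\<Sum>i\<in>F. (cmod (amp x i))\<^sup>2) \<le> (norm x)\<^sup>2"
  unfolding norm_sq_ell2 by (rule finite_sum_le_infsum) (auto intro: summable_amp)

lemma amp_le_norm: "cmod (amp x i) \<le> norm x"
  using sum_amp_le[of "{i}" x] by (simp add: power2_le_iff_abs_le)

instance ell2 :: (type) banach
proof
  fix X :: "nat \<Rightarrow> 'a ell2"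
  assume X: "Cauchy X"
  have cau: "Cauchy (\<lambda>n. amp (X n) i)" for i
  proof (rule CauchyI)
    fix e :: real assume "0 < e"
    then obtain M where "\<forall>m\<ge>M. \<forall>n\<ge>M. norm (X m - X n) < e" using CauchyD[OF X] by blast
    then show "\<exists>M. \<forall>m\<ge>M. \<forall>n\<ge>M. norm (amp (X m) i - amp (X n) i) < e"
      by (metis amp_le_norm amp_minus order_le_less_trans)
  qed
  have f: "(\<lambda>n. amp (X n) i) \<longlonglongrightarrow> lim (\<lambda>n. amp (X n) i)" for i
    using Cauchy_convergent[OF cau[of i]] unfolding convergent_LIMSEQ_iff .
  define f where "f i = lim (\<lambda>n. amp (X n) i)" for i
  note f = f[folded f_def]
  have tail: "\<exists>M. \<forall>n\<ge>M. \<forall>F. finite F \<longrightarrow> (\<Sum>i\<in>F. (cmod (amp (X n) i - f i))\<^sup>2) \<le> e\<^sup>2"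
    if "0 < e" for e :: real
  proof -
    obtain M where M: "\<And>m n. m \<ge> M \<Longrightarrow> n \<ge> M \<Longrightarrow> norm (X m - X n) < e"
      using CauchyD[OF X \<open>0 < e\<close>] by blast
    have "(\<Sum>i\<in>F. (cmod (amp (X n) i - f i))\<^sup>2) \<le> e\<^sup>2" if "n \<ge> M" "finite F" for n F
    proof (rule LIMSEQ_le_const2)
      show "(\<lambda>m. \<Sum>i\<in>F. (cmod (amp (X n) i - amp (X m) i))\<^sup>2)
          \<longlonglongrightarrow> (\<Sum>i\<in>F. (cmod (amp (X n) i - f i))\<^sup>2)"
        by (intro tendsto_intros f)
      have "(\<Sum>i\<in>F. (cmod (amp (X n) i - amp (X m) i))\<^sup>2) \<le> e\<^sup>2" if "m \<ge> M" for m
        using sum_amp_le[OF \<open>finite F\<close>, of "X n - X m"] M[OF \<open>n \<ge> M\<close> that]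
          power_mono[of "norm (X n - X m)" e 2] by (simp add: amp_ops)
      then show "\<exists>N. \<forall>m\<ge>N. (\<Sum>i\<in>F. (cmod (amp (X n) i - amp (X m) i))\<^sup>2) \<le> e\<^sup>2" by blast
    qed
    then show ?thesis by blast
  qed
  have sq: "(\<lambda>i. (cmod (f i))\<^sup>2) summable_on UNIV"
  proof -
    obtain M where M: "\<And>F. finite F \<Longrightarrow> (\<Sum>i\<in>F. (cmod (amp (X M) i - f i))\<^sup>2) \<le> 1"
      using tail[of 1] by auto
    have "(\<lambda>i. (cmod (amp (X M) i - f i))\<^sup>2) summable_on UNIV"
      by (rule nonneg_bdd_above_summable_on) (auto intro!: bdd_aboveI[of _ 1] M)
    then have "(\<lambda>i. (cmod (- 1 * (amp (X M) i - f i)))\<^sup>2) summable_on UNIV"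
      by (rule summable_sq_mult)
    from summable_sq_add[OF summable_amp[of "X M"] this] show ?thesis by simp
  qed
  have "X \<longlonglongrightarrow> Abs_ell2 f"
  proof (rule LIMSEQ_I)
    fix e :: real assume "0 < e"
    then obtain M where M: "\<And>n F. n \<ge> M \<Longrightarrow> finite F \<Longrightarrow>
        (\<Sum>i\<in>F. (cmod (amp (X n) i - f i))\<^sup>2) \<le> (e / 2)\<^sup>2"
      using tail[of "e / 2"] by (metis half_gt_zero)
    have "norm (X n - Abs_ell2 f) < e" if "n \<ge> M" for n
    proof -
      have "(norm (X n - Abs_ell2 f))\<^sup>2 \<le> (e / 2)\<^sup>2"
        unfolding norm_sq_ell2
        by (rule infsum_le_finite_sums[OF summable_amp]) (auto simp: amp_ops amp_Abs sq M that)
      then have "norm (X n - Abs_ell2 f) \<le> e / 2"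
        using \<open>0 < e\<close> by (simp add: power2_le_iff_abs_le)
      then show ?thesis using \<open>0 < e\<close> by simp
    qed
    then show "\<exists>N. \<forall>n\<ge>N. norm (X n - Abs_ell2 f) < e" by blast
  qed
  then show "convergent X" by (auto simp: convergent_def)
qed

definition orthonormal_basis :: "('i \<Rightarrow> 'a ell2) \<Rightarrow> bool" where
  "orthonormal_basis b \<longleftrightarrow>
     (\<forall>i j. cinner (b i) (b j) = (if i = j then 1 else 0)) \<and>
     (\<forall>x. (\<forall>i. cinner (b i) x = 0) \<longrightarrow> x = 0)"

definition unitary :: "('a ell2 \<Rightarrow> 'a ell2) \<Rightarrow> bool" where
  "unitary U \<longleftrightarrow> (\<forall>x y. U (x + y) = U x + U y) \<and> (\<forall>c x. U (c *\<^sub>C x) = c *\<^sub>C U x) \<and>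
     (\<forall>x. norm (U x) = norm x) \<and> surj U"

definition antiunitary :: "('a ell2 \<Rightarrow> 'a ell2) \<Rightarrow> bool" where
  "antiunitary T \<longleftrightarrow> (\<forall>x y. T (x + y) = T x + T y) \<and> (\<forall>c x. T (c *\<^sub>C x) = cnj c *\<^sub>C T x) \<and>
     (\<forall>x. norm (T x) = norm x) \<and> surj T"


section \<open>Operators\<close>

text \<open>Possibly unbounded, partially defined operators are represented by their graphs. Sums and
  products have their natural domains. (Anti)unitary operators are functions.\<close>

type_synonym 'a op = "('a ell2 \<times> 'a ell2) set"

definition app :: "'a op \<Rightarrow> 'a ell2 \<Rightarrow> 'a ell2" where
  "app A x = (THE y. (x, y) \<in> A)"

definition op_plus :: "'a op \<Rightarrow> 'a op \<Rightarrow> 'a op" (infixl "\<oplus>" 65) where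
  "A \<oplus> B = {(x, y + z) | x y z. (x, y) \<in> A \<and> (x, z) \<in> B}"

definition op_scale :: "complex \<Rightarrow> 'a op \<Rightarrow> 'a op" (infixr "\<odot>" 70) where
  "c \<odot> A = {(x, c *\<^sub>C y) | x y. (x, y) \<in> A}"

definition op_times :: "'a op \<Rightarrow> 'a op \<Rightarrow> 'a op" (infixl "\<cdot>" 75) where
  "A \<cdot> B = {(x, z) | x y z. (x, y) \<in> B \<and> (y, z) \<in> A}"

definition op_sum :: "'j set \<Rightarrow> ('j \<Rightarrow> 'a op) \<Rightarrow> 'a op" where
  "op_sum J A = {(x, \<Sum>j\<in>J. f j) | x f. \<forall>j\<in>J. (x, f j) \<in> A j}"

definition commutator :: "'a op \<Rightarrow> 'a op \<Rightarrow> 'a op" where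
  "commutator A B = A \<cdot> B \<oplus> (-1) \<odot> (B \<cdot> A)"

text \<open>\<open>U A U\<^sup>-\<^sup>1\<close> for a bijection \<open>U\<close>, in particular for a unitary or an antiunitary one.\<close>

definition conj_op :: "('a ell2 \<Rightarrow> 'a ell2) \<Rightarrow> 'a op \<Rightarrow> 'a op" where
  "conj_op U A = {(U x, U y) | x y. (x, y) \<in> A}"

definition adj_op :: "'a op \<Rightarrow> 'a op" where
  "adj_op A = {(x, y). \<forall>(u, v)\<in>A. cinner x v = cinner y u}"

definition hermitian :: "'a op \<Rightarrow> bool" where
  "hermitian A \<longleftrightarrow> closure (Domain A) = UNIV \<and> A \<subseteq> adj_op A"

definition self_adjoint :: "'a op \<Rightarrow> bool" where
  "self_adjoint A \<longleftrightarrow> closure (Domain A) = UNIV \<and> adj_op A = A"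

text \<open>\<open>\<Sum>\<^sub>k v\<^sub>k |b\<^sub>k\<rangle>\<langle>b\<^sub>k|\<close> with its maximal domain, for an orthonormal basis \<open>b\<close>.\<close>

definition diag_op :: "('i \<Rightarrow> 'a ell2) \<Rightarrow> ('i \<Rightarrow> real) \<Rightarrow> 'a op" where
  "diag_op b v = {(x, y). \<forall>k. cinner (b k) y = of_real (v k) * cinner (b k) x}"

text \<open>\<open>[A, H] = 0\<close> for an everywhere defined \<open>A\<close> and an unbounded \<open>H\<close>.\<close>

definition commutes_with :: "'a op \<Rightarrow> 'a op \<Rightarrow> bool" where
  "commutes_with A H \<longleftrightarrow> A \<cdot> H \<subseteq> H \<cdot> A"

text \<open>Trace class operators are the nuclear ones, \<open>A = \<Sum>\<^sub>n |\<alpha>\<^sub>n\<rangle>\<langle>\<beta>\<^sub>n|\<close> with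
  \<open>\<Sum>\<^sub>n \<parallel>\<alpha>\<^sub>n\<parallel> \<parallel>\<beta>\<^sub>n\<parallel> < \<infinity>\<close>; they are everywhere defined.\<close>

definition trace_class :: "'a op \<Rightarrow> bool" where
  "trace_class A \<longleftrightarrow> (\<exists>\<alpha> \<beta> :: nat \<Rightarrow> 'a ell2. summable (\<lambda>n. norm (\<alpha> n) * norm (\<beta> n)) \<and>
     A = {(x, y). (\<lambda>n. cinner (\<beta> n) x *\<^sub>C \<alpha> n) sums y})"

definition op_trace :: "'a op \<Rightarrow> complex" where
  "op_trace A = (if trace_class A then \<Sum>\<^sub>\<infinity>i. cinner (ket i) (app A (ket i)) else 0)"

definition density_op :: "'a op \<Rightarrow> bool" where
  "density_op \<rho> \<longleftrightarrow> trace_class \<rho> \<and> op_trace \<rho> = 1 \<and>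
     (\<forall>(x, y)\<in>\<rho>. Im (cinner x y) = 0 \<and> 0 \<le> Re (cinner x y))"

text \<open>The propagator \<open>exp (-i H t / hbar)\<close> is the strongly continuous unitary group whose generator
  is \<open>H\<close>. By Stone's theorem it exists for every self-adjoint \<open>H\<close>; the last branch
  of \<open>propagator\<close> is a default value for other graphs.\<close>

definition generates :: "real \<Rightarrow> 'a op \<Rightarrow> (real \<Rightarrow> 'a ell2 \<Rightarrow> 'a ell2) \<Rightarrow> bool" where
  "generates hbar H P \<longleftrightarrow>
     P 0 = id \<and> (\<forall>s t. P (s + t) = P s \<circ> P t) \<and> (\<forall>t. unitary (P t)) \<and>
     (\<forall>x. continuous_on UNIV (\<lambda>t. P t x)) \<and>
     H = {(x, y). ((\<lambda>t. P t x) has_vector_derivative (- \<i> / of_real hbar) *\<^sub>C y) (at 0)}"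

definition propagator :: "real \<Rightarrow> 'a op \<Rightarrow> real \<Rightarrow> 'a ell2 \<Rightarrow> 'a ell2" where
  "propagator hbar H = (if \<exists>P. generates hbar H P then THE P. generates hbar H P else (\<lambda>_. id))"


section \<open>Tensor products\<close>

definition tensor :: "'a ell2 \<Rightarrow> 'b ell2 \<Rightarrow> ('a \<times> 'b) ell2" (infixr "\<otimes>" 72) where
  "x \<otimes> y = Abs_ell2 (\<lambda>(i, j). amp x i * amp y j)"

definition slice1 :: "('a \<times> 'b) ell2 \<Rightarrow> 'b \<Rightarrow> 'a ell2" where
  "slice1 z j = Abs_ell2 (\<lambda>i. amp z (i, j))"

definition slice2 :: "('a \<times> 'b) ell2 \<Rightarrow> 'a \<Rightarrow> 'b ell2" where
  "slice2 z i = Abs_ell2 (\<lambda>j. amp z (i, j))"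

text \<open>\<open>A \<otimes> I\<close> and \<open>I \<otimes> A\<close>: \<open>\<ell>\<^sup>2(I \<times> J)\<close> is the direct sum of \<open>J\<close> copies of \<open>\<ell>\<^sup>2(I)\<close>,
  on each of which \<open>A \<otimes> I\<close> acts as \<open>A\<close>. For a self-adjoint (hence closed) \<open>A\<close> these are again
  self-adjoint.\<close>

definition ext1 :: "'a op \<Rightarrow> ('a \<times> 'b) op" where
  "ext1 A = {(x, y). \<forall>j. (slice1 x j, slice1 y j) \<in> A}"

definition ext2 :: "'b op \<Rightarrow> ('a \<times> 'b) op" where
  "ext2 A = {(x, y). \<forall>i. (slice2 x i, slice2 y i) \<in> A}"

definition map1 :: "('a ell2 \<Rightarrow> 'a ell2) \<Rightarrow> ('a \<times> 'b) ell2 \<Rightarrow> ('a \<times> 'b) ell2" where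
  "map1 f z = Abs_ell2 (\<lambda>(i, j). amp (f (slice1 z j)) i)"

definition map2 :: "('b ell2 \<Rightarrow> 'b ell2) \<Rightarrow> ('a \<times> 'b) ell2 \<Rightarrow> ('a \<times> 'b) ell2" where
  "map2 f z = Abs_ell2 (\<lambda>(i, j). amp (f (slice2 z i)) j)"

definition cnj_vec :: "'a ell2 \<Rightarrow> 'a ell2" where
  "cnj_vec x = Abs_ell2 (\<lambda>i. cnj (amp x i))"

definition tensor_unitary ::
  "('a ell2 \<Rightarrow> 'a ell2) \<Rightarrow> ('b ell2 \<Rightarrow> 'b ell2) \<Rightarrow> ('a \<times> 'b) ell2 \<Rightarrow> ('a \<times> 'b) ell2" where
  "tensor_unitary U V = map1 U \<circ> map2 V"

text \<open>For antilinear maps, \<open>map2 T'\<close> sends \<open>c (e\<^sub>i \<otimes> e\<^sub>j)\<close> to \<open>cnj c (e\<^sub>i \<otimes> T' e\<^sub>j)\<close> and \<open>map1 T\<close>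
  conjugates the coefficients once more; the intermediate conjugation makes
  the product antilinear with \<open>x \<otimes> y \<mapsto> T x \<otimes> T' y\<close>.\<close>

definition tensor_antiunitary ::
  "('a ell2 \<Rightarrow> 'a ell2) \<Rightarrow> ('b ell2 \<Rightarrow> 'b ell2) \<Rightarrow> ('a \<times> 'b) ell2 \<Rightarrow> ('a \<times> 'b) ell2" where
  "tensor_antiunitary T T' = map1 T \<circ> cnj_vec \<circ> map2 T'"

text \<open>\<open>ptrace1\<close> traces out the first factor, \<open>ptrace2\<close> the second.\<close>

definition ptrace1 :: "('a \<times> 'b) op \<Rightarrow> 'b op" where
  "ptrace1 \<rho> = {(x, y). \<forall>j. ((\<lambda>i. amp (app \<rho> (ket i \<otimes> x)) (i, j)) has_sum amp y j) UNIV}"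

definition ptrace2 :: "('a \<times> 'b) op \<Rightarrow> 'a op" where
  "ptrace2 \<rho> = {(x, y). \<forall>i. ((\<lambda>j. amp (app \<rho> (x \<otimes> ket j)) (i, j)) has_sum amp y i) UNIV}"


section \<open>CP and the physical setting\<close>

definition cp_cpt_invariant :: "('a ell2 \<Rightarrow> 'a ell2) \<Rightarrow> ('a ell2 \<Rightarrow> 'a ell2) \<Rightarrow> 'a op \<Rightarrow> bool" where
  "cp_cpt_invariant U T H \<longleftrightarrow> conj_op U H = H \<and> conj_op (U \<circ> T) H = H"

definition cp_balanced :: "('a ell2 \<Rightarrow> 'a ell2) \<Rightarrow> 'a op \<Rightarrow> bool" where
  "cp_balanced U \<rho> \<longleftrightarrow> conj_op U \<rho> = \<rho>"

text \<open>A subsystem (system, bath or surroundings): its Hamiltonian, the unitary \<open>U\<^sub>C\<^sub>P\<close> and the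
  antiunitary time reversal \<open>\<Theta>\<^sub>T\<close>.\<close>

record 'a sector =
  ham :: "'a op"
  cp :: "'a ell2 \<Rightarrow> 'a ell2"
  trev :: "'a ell2 \<Rightarrow> 'a ell2"

definition sector_ok :: "'a sector \<Rightarrow> bool" where
  "sector_ok S \<longleftrightarrow> self_adjoint (ham S) \<and> unitary (cp S) \<and> antiunitary (trev S) \<and>
     cp_cpt_invariant (cp S) (trev S) (ham S)"

text \<open>\<open>h\<^sub>S\<^sub>B = \<Sum>\<^sub>j L\<^sub>j \<otimes> V\<^sub>j\<close> for \<open>j < num K\<close>, with \<open>L\<^sub>j = sys_op K j\<close>,
  \<open>V\<^sub>j = bath_op K j\<close> and \<open>\<zeta>\<^sub>j = parity K j\<close>.\<close>

record ('s, 'b) coupling =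
  num :: nat
  sys_op :: "nat \<Rightarrow> 's op"
  bath_op :: "nat \<Rightarrow> 'b op"
  parity :: "nat \<Rightarrow> real"

definition interaction :: "('s, 'b) coupling \<Rightarrow> ('s \<times> 'b) op" where
  "interaction K = op_sum {..<num K} (\<lambda>j. ext1 (sys_op K j) \<cdot> ext2 (bath_op K j))"

text \<open>The last conjunct is pure dephasing: \<open>H\<^sub>S\<close> and all \<open>L\<^sub>j\<close> are diagonal in one basis, which
  for unbounded operators is the meaning of \<open>[H\<^sub>S, L\<^sub>j] = 0\<close>.\<close>

definition coupling_ok :: "'s sector \<Rightarrow> 'b sector \<Rightarrow> ('s, 'b) coupling \<Rightarrow> bool" where
  "coupling_ok S B K \<longleftrightarrow>
     (\<forall>j<num K. self_adjoint (sys_op K j) \<and> self_adjoint (bath_op K j) \<and>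
        parity K j \<in> {1, -1} \<and>
        conj_op (cp S) (sys_op K j) = of_real (parity K j) \<odot> sys_op K j \<and>
        conj_op (cp B) (bath_op K j) = of_real (parity K j) \<odot> bath_op K j) \<and>
     hermitian (interaction K) \<and>
     cp_cpt_invariant (tensor_unitary (cp S) (cp B)) (tensor_antiunitary (trev S) (trev B))
       (interaction K) \<and>
     (\<exists>(b :: 's \<Rightarrow> 's ell2) E. orthonormal_basis b \<and> ham S = diag_op b E \<and>
        (\<forall>j<num K. \<exists>v. sys_op K j = diag_op b v))"

text \<open>\<open>H\<^sub>B\<^sub>G\<close>; the closure makes the sum of unbounded operators self-adjoint when it is
  essentially self-adjoint on the common domain.\<close>

definition env_ham :: "'b sector \<Rightarrow> 'g sector \<Rightarrow> ('b \<times> 'g) op \<Rightarrow> ('b \<times> 'g) op" where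
  "env_ham B G h = closure (ext1 (ham B) \<oplus> ext2 (ham G) \<oplus> h)"

definition environment_ok ::
  "'b sector \<Rightarrow> 'g sector \<Rightarrow> ('b \<times> 'g) op \<Rightarrow> ('b \<times> 'g) op \<Rightarrow> bool" where
  "environment_ok B G h \<rho> \<longleftrightarrow> sector_ok B \<and> sector_ok G \<and> hermitian h \<and>
     cp_cpt_invariant (tensor_unitary (cp B) (cp G)) (tensor_antiunitary (trev B) (trev G)) h \<and>
     self_adjoint (env_ham B G h) \<and> density_op \<rho> \<and> commutes_with \<rho> (env_ham B G h)"


section \<open>Redfield equation\<close>

text \<open>\<open>corr hbar H W \<mu> \<rho> j l \<tau>\<close> is \<open>C'\<^sub>j\<^sub>l(\<tau>)\<close> for the environment Hamiltonian \<open>H\<close>, with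
  \<open>exp (-i H \<tau> / hbar) W\<^sub>l exp (i H \<tau> / hbar)\<close> written as a conjugation.\<close>

definition corr ::
  "real \<Rightarrow> 'e op \<Rightarrow> (nat \<Rightarrow> 'e op) \<Rightarrow> (nat \<Rightarrow> complex) \<Rightarrow> 'e op \<Rightarrow> nat \<Rightarrow> nat \<Rightarrow> real \<Rightarrow> complex"
  where "corr hbar H W \<mu> \<rho> j l \<tau> =
    op_trace (W j \<cdot> conj_op (propagator hbar H \<tau>) (W l) \<cdot> \<rho>) - \<mu> j * \<mu> l"

definition redfield ::
  "real \<Rightarrow> 's op \<Rightarrow> nat \<Rightarrow> (nat \<Rightarrow> 's op) \<Rightarrow> (nat \<Rightarrow> complex) \<Rightarrow> (nat \<Rightarrow> nat \<Rightarrow> real \<Rightarrow> complex) \<Rightarrow>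
   real \<Rightarrow> 's op \<Rightarrow> 's op" where
  "redfield hbar H m L \<mu> C t \<rho> =
     (let A = (\<lambda>j l. integral {0..t} (C j l)) in
       (- \<i> / of_real hbar) \<odot> commutator H \<rho>
       \<oplus> (- \<i> / of_real hbar) \<odot> op_sum {..<m} (\<lambda>j. \<mu> j \<odot> commutator (L j) \<rho>)
       \<oplus> (- 1 / of_real (hbar\<^sup>2)) \<odot> op_sum ({..<m} \<times> {..<m}) (\<lambda>(j, l).
            A j l \<odot> commutator (L j) (L l \<cdot> \<rho>) \<oplus> cnj (A j l) \<odot> commutator (\<rho> \<cdot> L l) (L j)))"

definition bath_mean :: "('s, 'b) coupling \<Rightarrow> 'b op \<Rightarrow> nat \<Rightarrow> complex" where
  "bath_mean K \<rho>\<^sub>B j = op_trace (bath_op K j \<cdot> \<rho>\<^sub>B)"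

definition env_corr ::
  "real \<Rightarrow> 'b sector \<Rightarrow> 'g sector \<Rightarrow> ('b \<times> 'g) op \<Rightarrow> ('s, 'b) coupling \<Rightarrow> ('b \<times> 'g) op \<Rightarrow>
   nat \<Rightarrow> nat \<Rightarrow> real \<Rightarrow> complex" where
  "env_corr hbar B G h K \<rho> =
     corr hbar (env_ham B G h) (\<lambda>j. ext1 (bath_op K j)) (bath_mean K (ptrace2 \<rho>)) \<rho>"

definition redfield_env ::
  "real \<Rightarrow> 's sector \<Rightarrow> 'b sector \<Rightarrow> 'g sector \<Rightarrow> ('b \<times> 'g) op \<Rightarrow> ('s, 'b) coupling \<Rightarrow>
   ('b \<times> 'g) op \<Rightarrow> real \<Rightarrow> 's op \<Rightarrow> 's op" where
  "redfield_env hbar S B G h K \<rho> =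
     redfield hbar (ham S) (num K) (sys_op K) (bath_mean K (ptrace2 \<rho>)) (env_corr hbar B G h K \<rho>)"

text \<open>The case without surroundings, \<open>\<rho>\<^sub>B\<^sub>G = \<rho>\<^sub>B\<close>, \<open>H\<^sub>B\<^sub>G = H\<^sub>B\<close>, \<open>W\<^sub>j = V\<^sub>j\<close>.\<close>

definition redfield_bath ::
  "real \<Rightarrow> 's sector \<Rightarrow> 'b sector \<Rightarrow> ('s, 'b) coupling \<Rightarrow> 'b op \<Rightarrow> real \<Rightarrow> 's op \<Rightarrow> 's op" where
  "redfield_bath hbar S B K \<rho> =
     redfield hbar (ham S) (num K) (sys_op K) (bath_mean K \<rho>)
       (corr hbar (ham B) (bath_op K) (bath_mean K \<rho>) \<rho>)"

text \<open>All traces and integrals entering \<open>redfield_env\<close> exist, so that none takes a default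
  value.\<close>

definition moments_exist ::
  "real \<Rightarrow> 'b sector \<Rightarrow> 'g sector \<Rightarrow> ('b \<times> 'g) op \<Rightarrow> ('s, 'b) coupling \<Rightarrow> ('b \<times> 'g) op \<Rightarrow> bool"
  where "moments_exist hbar B G h K \<rho> \<longleftrightarrow>
    (\<exists>P. generates hbar (env_ham B G h) P) \<and>
    (\<forall>j<num K. trace_class (bath_op K j \<cdot> ptrace2 \<rho>)) \<and>
    (\<forall>j<num K. \<forall>l<num K.
       (\<forall>\<tau>\<ge>0. trace_class (ext1 (bath_op K j) \<cdot>
          conj_op (propagator hbar (env_ham B G h) \<tau>) (ext1 (bath_op K l)) \<cdot> \<rho>)) \<and>
       (\<forall>t\<ge>0. env_corr hbar B G h K \<rho> j l integrable_on {0..t}))"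

definition apparently_cp_invariant ::
  "('s ell2 \<Rightarrow> 's ell2) \<Rightarrow> (real \<Rightarrow> 's op \<Rightarrow> 's op) \<Rightarrow> bool" where
  "apparently_cp_invariant U R \<longleftrightarrow>
     (\<forall>t\<ge>0. \<forall>\<rho>. density_op \<rho> \<longrightarrow> conj_op U (R t \<rho>) = R t (conj_op U \<rho>))"

abbreviation apparent_cp_bias ::
  "('s ell2 \<Rightarrow> 's ell2) \<Rightarrow> (real \<Rightarrow> 's op \<Rightarrow> 's op) \<Rightarrow> bool" where
  "apparent_cp_bias U R \<equiv> \<not> apparently_cp_invariant U R"


section \<open>Equilibrium and radiation\<close>

text \<open>\<open>exp (-H / (k\<^sub>B T))\<close> is trace class only if \<open>H\<close> has an orthonormal eigenbasis, so no
  other \<open>H\<close> needs to be considered.\<close>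

definition gibbs_state :: "real \<Rightarrow> real \<Rightarrow> 'a op \<Rightarrow> 'a op \<Rightarrow> bool" where
  "gibbs_state kB temp H \<rho> \<longleftrightarrow>
     (\<exists>(b :: 'a \<Rightarrow> 'a ell2) E X. orthonormal_basis b \<and> H = diag_op b E \<and>
        X = diag_op b (\<lambda>k. exp (- E k / (kB * temp))) \<and> trace_class X \<and>
        \<rho> = (1 / op_trace X) \<odot> X)"

definition cp_diagonal_coupling :: "'b sector \<Rightarrow> ('s, 'b) coupling \<Rightarrow> bool" where
  "cp_diagonal_coupling B K \<longleftrightarrow>
     (\<exists>(b :: 'b \<Rightarrow> 'b ell2) E \<xi>. orthonormal_basis b \<and> ham B = diag_op b E \<and>
        (\<forall>k. \<xi> k \<in> {1, -1 :: real} \<and> cp B (b k) = of_real (\<xi> k) *\<^sub>C b k) \<and>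
        (\<forall>j<num K. \<exists>v. bath_op K j = diag_op b v))"

text \<open>The free electromagnetic field with a discrete set of wave vectors, as in a cavity with
  periodic boundary conditions. A mode is a wave vector \<open>\<kappa> k\<close> with a helicity; a Fock basis state
  is a finite multiset of photons; the zero-point energy is dropped. The polarisation vectors are
  chosen with \<open>\<epsilon>(-\<kappa>,-s) = \<epsilon>(\<kappa>,s)\<close> and \<open>\<epsilon>(\<kappa>,-s) = cnj \<epsilon>(\<kappa>,s)\<close>. Then
  CP, \<open>A(x) \<mapsto> A(-x)\<close>, under which the magnetic field is odd and the electric field even, is
  \<open>a(\<kappa>,s) \<mapsto> a(-\<kappa>,-s)\<close>, and time reversal, \<open>A(x) \<mapsto> -A(x)\<close>, is \<open>a(\<kappa>,s) \<mapsto> -a(-\<kappa>,s)\<close>.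
  The Gibbs state exists iff \<open>\<Sum>\<^sub>k exp (-hbar c \<parallel>\<kappa> k\<parallel> / (k\<^sub>B T)) < \<infinity>\<close>, as in any cavity.\<close>

definition wave_vectors :: "('k \<Rightarrow> real ^ 3) \<Rightarrow> bool" where
  "wave_vectors \<kappa> \<longleftrightarrow> inj \<kappa> \<and> 0 \<notin> range \<kappa> \<and> uminus ` range \<kappa> = range \<kappa>"

definition opposite :: "('k \<Rightarrow> real ^ 3) \<Rightarrow> 'k \<Rightarrow> 'k" where
  "opposite \<kappa> k = inv \<kappa> (- \<kappa> k)"

definition photon_bath :: "real \<Rightarrow> real \<Rightarrow> ('k \<Rightarrow> real ^ 3) \<Rightarrow> ('k \<times> bool) multiset sector" where
  "photon_bath hbar c \<kappa> = \<lparr>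
     ham = diag_op ket (\<lambda>N. \<Sum>(k, s)\<in>#N. hbar * c * norm (\<kappa> k)),
     cp = (\<lambda>x. Abs_ell2 (\<lambda>N. amp x (image_mset (\<lambda>(k, s). (opposite \<kappa> k, \<not> s)) N))),
     trev = (\<lambda>x. Abs_ell2 (\<lambda>N. (-1) ^ size N *
       cnj (amp x (image_mset (\<lambda>(k, s). (opposite \<kappa> k, s)) N))))\<rparr>"

end

theory Submission
  imports Defs
begin

text \<open>CP on the system alone replaces \<open>L\<^sub>j\<close> by \<open>\<zeta>\<^sub>j L\<^sub>j\<close>, so the reduced dynamics are covariant as soon
  as \<open>\<zeta>\<^sub>j \<mu>\<^sub>j = \<mu>\<^sub>j\<close> and \<open>\<zeta>\<^sub>j \<zeta>\<^sub>l C'\<^sub>j\<^sub>l = C'\<^sub>j\<^sub>l\<close>. A Gibbs state is a function of the CP-invariant \<open>H\<^sub>B\<close>, and the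
  propagator commutes with CP because a self-adjoint operator generates at most one unitary group;
  invariance of the trace under CP then gives both identities. If \<open>V\<^sub>j\<close> is diagonal in a CP
  eigenbasis, it is CP-even, so \<open>V\<^sub>j = \<zeta>\<^sub>j V\<^sub>j\<close> whatever the state of the environment.

  Conduction is shown by an example in which all operators are weighted permutations of the Fock
  basis. Surroundings in the unbalanced state \<open>|0\<rangle>\<close> of a two-level system shift the one-photon levels
  by an amount odd under CP. The system couples through an even and an odd operator to the same
  transitions between one and three photons. The shift makes those of one helicity resonant, which
  leaves a positive mixed correlation integral that CP on the system reverses.\<close>

section \<open>Vectors\<close>

text \<open>Operators are graphs, so an identity between them includes equality of domains. This
  shapes the algebra: a scalar moves through a product only if it is nonzero and the left factor
  respects scaling. \<open>op_trace\<close> and \<open>propagator\<close> have default values, so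
  each invariance is also checked in the default case. \<open>ext1\<close> and the traces are
  defined through the basis \<open>ket\<close>, which a CP unitary need not preserve; contractions
  and nuclear series give them a basis-free form.

  In the example the means vanish, and parities cancel in the unmixed correlations, so bias can only
  come from an even operator correlated with an odd one. On a transition these have weights \<eta>^2
  and \<eta>, so a mixed product has weight \<eta>, which sums to zero over CP pairs as long as both
  members have the same frequency. A one-photon shift by twice the photon energy \<open>eps\<close>
  lifts one helicity onto its three-photon level and leaves the other with a gap of
  \<open>4 * eps\<close>; over one period of that gap only the resonant part survives.\<close>

lemma amp_sum: "amp (\<Sum>j\<in>J. f j) i = (\<Sum>j\<in>J. amp (f j) i)"
  by (induction J rule: infinite_finite_induct) (auto simp: amp_ops)

lemma amp_ket [simp]: "amp (ket i) j = (if j = i then 1 else 0)"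
proof -
  have "(\<lambda>j. (cmod (if j = i then 1 else 0))\<^sup>2) summable_on UNIV"
    by (rule finite_nonzero_values_imp_summable_on) simp
  then show ?thesis unfolding ket_def by (subst amp_Abs) auto
qed

lemma cinner_ket_left [simp]: "cinner (ket i) x = amp x i"
  unfolding cinner_def
  by (subst infsum_cong_neutral[where T="{i}" and g="\<lambda>_. amp x i"]) auto

lemma scaleC_right_distrib: "a *\<^sub>C (x + y) = a *\<^sub>C x + a *\<^sub>C y"
  and scaleC_diff: "a *\<^sub>C (x - y) = a *\<^sub>C x - a *\<^sub>C y"
  and scaleC_scaleC [simp]: "a *\<^sub>C b *\<^sub>C x = (a * b) *\<^sub>C x"
  and scaleC_one [simp]: "1 *\<^sub>C x = x"
  and scaleC_minus_one [simp]: "(-1) *\<^sub>C x = - x"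
  and scaleC_zero_left [simp]: "0 *\<^sub>C x = 0"
  and scaleC_zero_right [simp]: "a *\<^sub>C (0 :: 'a ell2) = 0"
  and scaleC_of_real: "of_real r *\<^sub>C x = r *\<^sub>R x"
  by (auto intro!: ell2_eqI simp: amp_ops algebra_simps)

lemma cinner_ket_right [simp]: "cinner x (ket i) = cnj (amp x i)"
  by (subst cinner_commute) simp

lemma cinner_add_right: "cinner x (y + z :: 'a ell2) = cinner x y + cinner x z"
  by (subst (1 2 3) cinner_commute) (simp add: cinner_add_left)

lemma cinner_scaleC_right: "cinner x (c *\<^sub>C y) = c * cinner x y"
  by (subst (1 2) cinner_commute) (simp add: cinner_scaleC_left)

lemma cinner_zero [simp]: "cinner x 0 = 0" "cinner 0 x = 0"
  using cinner_scaleC_right[of x 0 0] cinner_scaleC_left[of 0 0 x] by simp_all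

lemma cinner_minus_right: "cinner x (- y) = - cinner x y"
  using cinner_scaleC_right[of x "-1" y] by simp

lemma cinner_minus_left: "cinner (- x) y = - cinner x y"
  using cinner_scaleC_left[of "-1" x y] by simp

lemma cinner_diff_right: "cinner x (y - z) = cinner x y - cinner x z"
  using cinner_add_right[of x y "- z"] by (simp add: cinner_minus_right)

lemma cinner_diff_left: "cinner (x - y) z = cinner x z - cinner y z"
  using cinner_add_left[of x "- y" z] by (simp add: cinner_minus_left)

lemma cinner_sum_right: "cinner x (\<Sum>j\<in>J. f j) = (\<Sum>j\<in>J. cinner x (f j))"
  by (induction J rule: infinite_finite_induct) (auto simp: cinner_add_right)

lemma cinner_sum_left: "cinner (\<Sum>j\<in>J. f j) x = (\<Sum>j\<in>J. cinner (f j) x)"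
  by (induction J rule: infinite_finite_induct) (auto simp: cinner_add_left)

lemma cinner_norm_sq: "cinner x x = of_real ((norm x)\<^sup>2)"
  by (simp add: cinner_self norm_sq_ell2)

lemma norm_scaleC: "norm (c *\<^sub>C x) = cmod c * norm x"
proof -
  have "(norm (c *\<^sub>C x))\<^sup>2 = (cmod c * norm x)\<^sup>2"
    by (simp only: norm_sq_ell2 amp_scaleC norm_mult power_mult_distrib)
       (simp add: infsum_cmult_right')
  then show ?thesis by (simp add: power2_eq_iff_nonneg)
qed

text \<open>Multiplying \<open>x\<close> by the phase \<open>c\<close> of the inner product turns it
  into its modulus, a real number, so the real inequality for \<open>inner\<close> applies.\<close>

lemma cinner_Cauchy_Schwarz: "cmod (cinner x y) \<le> norm x * norm y"
proof (cases "cinner x y = 0")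
  case False
  define c where "c = cinner x y / cmod (cinner x y)"
  have "cnj c * cinner x y = of_real (cmod (cinner x y))"
    using False unfolding c_def
    by (simp add: complex_cnj_divide field_simps complex_norm_square[symmetric] power2_eq_square
        flip: of_real_mult)
  then have "cmod (cinner x y) = Re (cnj c * cinner x y)" by simp
  also have "\<dots> = inner (c *\<^sub>C x) y" by (simp add: inner_ell2_def cinner_scaleC_left)
  also have "\<dots> \<le> norm (c *\<^sub>C x) * norm y" by (rule norm_cauchy_schwarz)
  also have "\<dots> = norm x * norm y" using False by (simp add: norm_scaleC c_def norm_divide)
  finally show ?thesis .
qed simp

lemma bounded_bilinear_cinner: "bounded_bilinear (cinner :: 'a ell2 \<Rightarrow> _)"
proof
  show "\<exists>K. \<forall>a b :: 'a ell2. norm (cinner a b) \<le> norm a * norm b * K"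
    by (intro exI[of _ 1]) (simp add: cinner_Cauchy_Schwarz)
qed (simp_all add: cinner_add_left cinner_add_right scaleC_of_real[symmetric]
    cinner_scaleC_left cinner_scaleC_right scaleR_conv_of_real)

lemma bounded_bilinear_scaleC: "bounded_bilinear (scaleC :: _ \<Rightarrow> 'a ell2 \<Rightarrow> _)"
proof
  show "\<exists>K. \<forall>a. \<forall>b :: 'a ell2. norm (a *\<^sub>C b) \<le> norm a * norm b * K"
    by (intro exI[of _ 1]) (simp add: norm_scaleC)
qed (auto intro!: ell2_eqI simp: amp_ops algebra_simps scaleR_conv_of_real)

lemmas bounded_linear_cinner_right = bounded_bilinear.bounded_linear_right[OF bounded_bilinear_cinner]
lemmas bounded_linear_scaleC_right = bounded_bilinear.bounded_linear_right[OF bounded_bilinear_scaleC]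

lemma bounded_linear_amp: "bounded_linear (\<lambda>x. amp x i)"
  using bounded_linear_cinner_right[of "ket i"] by simp

lemma cinner_ext: "(\<And>x. cinner x y = cinner x z) \<Longrightarrow> y = z"
  by (metis cinner_ket_left ell2_eqI)

lemma norm_le_amp:
  assumes "\<And>i. cmod (amp x i) \<le> cmod (amp y i)"
  shows "norm x \<le> norm y"
proof -
  have "(norm x)\<^sup>2 \<le> (norm y)\<^sup>2"
    unfolding norm_sq_ell2 by (intro infsum_mono summable_amp power_mono assms) auto
  then show ?thesis by (simp add: power2_le_iff_abs_le)
qed

lemma summable_sq_bounded:
  assumes "\<And>i. cmod (w i) \<le> C"
  shows "(\<lambda>i. (cmod (w i * amp x i))\<^sup>2) summable_on UNIV"
proof (rule summable_on_comparison_test)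
  show "(\<lambda>i. (cmod (of_real C * amp x i))\<^sup>2) summable_on UNIV"
    by (intro summable_sq_mult summable_amp)
  show "(cmod (w i * amp x i))\<^sup>2 \<le> (cmod (of_real C * amp x i))\<^sup>2" for i
    using assms[of i] by (auto simp: norm_mult intro!: power_mono mult_right_mono)
qed simp

lemma summable_sq_bij:
  assumes "bij p"
  shows "(\<lambda>i. (cmod (amp x (p i)))\<^sup>2) summable_on UNIV"
  using summable_on_reindex_bij_betw[OF assms, of "\<lambda>i. (cmod (amp x i))\<^sup>2"] summable_amp by blast

section \<open>Orthonormal bases\<close>

lemma orthonormal_basisD:
  assumes "orthonormal_basis b"
  shows "cinner (b i) (b j) = (if i = j then 1 else 0)" "(\<And>i. cinner (b i) x = 0) \<Longrightarrow> x = 0"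
  using assms unfolding orthonormal_basis_def by blast+

lemma orthonormal_basis_ket: "orthonormal_basis ket"
  unfolding orthonormal_basis_def by (auto intro!: ell2_eqI simp: amp_ops)

lemma norm_sq_orthonormal_sum:
  assumes "orthonormal_basis b" "finite F"
  shows "(norm (\<Sum>l\<in>F. c l *\<^sub>C b l))\<^sup>2 = (\<Sum>l\<in>F. (cmod (c l))\<^sup>2)"
proof -
  have "cinner (\<Sum>l\<in>F. c l *\<^sub>C b l) (\<Sum>l\<in>F. c l *\<^sub>C b l) =
      (\<Sum>l\<in>F. \<Sum>k\<in>F. if k = l then of_real ((cmod (c l))\<^sup>2) else 0)"
    unfolding cinner_sum_left cinner_sum_right
    by (intro sum.cong refl) (auto simp: cinner_scaleC_left cinner_scaleC_right
        orthonormal_basisD[OF assms(1)] complex_norm_square mult.commute simp del: of_real_power)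
  also have "\<dots> = of_real (\<Sum>l\<in>F. (cmod (c l))\<^sup>2)"
    using assms(2) by simp
  finally show ?thesis by (simp only: cinner_norm_sq of_real_eq_iff)
qed

lemma Bessel_inequality:
  assumes b: "orthonormal_basis b" and F: "finite F"
  shows "(\<Sum>l\<in>F. (cmod (cinner (b l) x))\<^sup>2) \<le> (norm x)\<^sup>2"
proof -
  define y where "y = (\<Sum>l\<in>F. cinner (b l) x *\<^sub>C b l)"
  have yy: "(norm y)\<^sup>2 = (\<Sum>l\<in>F. (cmod (cinner (b l) x))\<^sup>2)"
    unfolding y_def by (rule norm_sq_orthonormal_sum[OF b F])
  have "cinner y x = of_real ((norm y)\<^sup>2)"
    unfolding yy by (simp add: y_def cinner_sum_left cinner_scaleC_left complex_norm_square mult.commute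
        del: of_real_power)
  then have "(norm y)\<^sup>2 \<le> norm y * norm x"
    using cinner_Cauchy_Schwarz[of y x] by (simp add: norm_power)
  then have "norm y \<le> norm x"
    by (cases "norm y = 0") (auto simp: power2_eq_square)
  then show ?thesis unfolding yy[symmetric] by (intro power_mono) auto
qed

text \<open>Bessel makes the squared coefficients summable, so by Pythagoras the finite partial sums
  are Cauchy. Their limit has the same coefficients as \<open>x\<close>, and totality of the basis
  makes the difference vanish. The index type is arbitrary, hence the filter of finite subsets
  instead of sequences.\<close>

lemma orthonormal_expansion:
  fixes b :: "'i \<Rightarrow> 'a ell2"
  assumes b: "orthonormal_basis b"
  shows "((\<lambda>l. cinner (b l) x *\<^sub>C b l) has_sum x) UNIV"
proof -
  define f where "f l = cinner (b l) x *\<^sub>C b l" for l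
  have sq: "(\<lambda>l. (cmod (cinner (b l) x))\<^sup>2) summable_on UNIV"
    by (rule nonneg_bdd_above_summable_on)
       (auto intro!: bdd_aboveI[of _ "(norm x)\<^sup>2"] Bessel_inequality[OF b])
  have "cauchy_filter (filtermap (sum f) (finite_subsets_at_top UNIV))"
    unfolding cauchy_filter_metric_filtermap
  proof (intro allI impI)
    fix e :: real assume e: "e > 0"
    have "eventually (\<lambda>F. dist (\<Sum>l\<in>F. (cmod (cinner (b l) x))\<^sup>2) (\<Sum>\<^sub>\<infinity>l. (cmod (cinner (b l) x))\<^sup>2) < (e / 2)\<^sup>2)
        (finite_subsets_at_top UNIV)"
      using has_sum_infsum[OF sq] e unfolding has_sum_def by (intro tendstoD) auto
    then obtain F0 where F0: "finite F0" "\<And>F. finite F \<Longrightarrow> F0 \<subseteq> F \<Longrightarrow>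
        dist (\<Sum>l\<in>F. (cmod (cinner (b l) x))\<^sup>2) (\<Sum>\<^sub>\<infinity>l. (cmod (cinner (b l) x))\<^sup>2) < (e / 2)\<^sup>2"
      unfolding eventually_finite_subsets_at_top by auto
    define P where "P F \<longleftrightarrow> finite F \<and> F0 \<subseteq> F" for F
    have small: "dist (sum f F) (sum f F0) < e / 2" if "P F" for F
    proof -
      have F: "finite F" "F0 \<subseteq> F" using that by (auto simp: P_def)
      have "sum f F - sum f F0 = sum f (F - F0)" using F by (simp add: sum_diff)
      then have "(dist (sum f F) (sum f F0))\<^sup>2 = (\<Sum>l\<in>F - F0. (cmod (cinner (b l) x))\<^sup>2)"
        unfolding dist_norm f_def using norm_sq_orthonormal_sum[OF b, of "F - F0"] F(1) by auto
      also have "\<dots> = (\<Sum>l\<in>F. (cmod (cinner (b l) x))\<^sup>2) - (\<Sum>l\<in>F0. (cmod (cinner (b l) x))\<^sup>2)"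
        using F by (simp add: sum_diff)
      also have "\<dots> \<le> (\<Sum>\<^sub>\<infinity>l. (cmod (cinner (b l) x))\<^sup>2) - (\<Sum>l\<in>F0. (cmod (cinner (b l) x))\<^sup>2)"
        using finite_sum_le_infsum[OF sq F(1)] by simp
      also have "\<dots> < (e / 2)\<^sup>2" using F0(2)[of F0] F0(1) by (simp add: dist_real_def)
      finally show ?thesis by (rule power2_less_imp_less) (use e in simp)
    qed
    have "eventually P (finite_subsets_at_top UNIV)"
      unfolding eventually_finite_subsets_at_top P_def using F0(1) by auto
    moreover have "dist (sum f F) (sum f F') < e" if "P F \<and> P F'" for F F'
      using small[of F] small[of F'] dist_triangle_half_l[of "sum f F" "sum f F0" e "sum f F'"] that
      by (simp add: dist_commute)
    ultimately show "\<exists>P. eventually P (finite_subsets_at_top UNIV) \<and>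
        (\<forall>F F'. P F \<and> P F' \<longrightarrow> dist (sum f F) (sum f F') < e)" by blast
  qed
  moreover have "complete (UNIV :: 'a ell2 set)"
    by (meson Cauchy_convergent UNIV_I complete_def convergent_def)
  moreover have "filtermap (sum f) (finite_subsets_at_top UNIV) \<noteq> bot"
    by (simp add: filtermap_bot_iff)
  ultimately obtain y where "filtermap (sum f) (finite_subsets_at_top UNIV) \<le> nhds y"
    unfolding complete_uniform by (metis UNIV_I principal_UNIV top_greatest)
  then have "(sum f \<longlongrightarrow> y) (finite_subsets_at_top UNIV)" by (simp add: filterlim_def)
  then have y: "(f has_sum y) UNIV" by (simp add: has_sum_def)
  have "x - y = 0"
  proof (rule orthonormal_basisD(2)[OF b])
    fix k
    have "((\<lambda>l. cinner (b k) (f l)) has_sum cinner (b k) y) UNIV"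
      using has_sum_bounded_linear[OF bounded_linear_cinner_right y] .
    moreover have "((\<lambda>l. cinner (b k) (f l)) has_sum cinner (b k) x) UNIV"
      by (rule has_sum_finite_neutralI[where B="{k}"])
         (auto simp: f_def cinner_scaleC_right orthonormal_basisD(1)[OF b])
    ultimately show "cinner (b k) (x - y) = 0"
      using has_sum_unique by (fastforce simp: cinner_diff_right)
  qed
  then show ?thesis using y unfolding f_def by simp
qed

lemma Parseval_identity:
  assumes "orthonormal_basis b"
  shows "((\<lambda>l. cinner x (b l) * cinner (b l) y) has_sum cinner x y) UNIV"
  using has_sum_bounded_linear[OF bounded_linear_cinner_right orthonormal_expansion[OF assms], of x y]
  by (simp add: cinner_scaleC_right mult.commute o_def)

section \<open>Operator algebra\<close>

text \<open>An arbitrary graph need not respect scaling. This weak form of linearity is what pulling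
  a scalar out of the right factor of a product requires of the left factor.\<close>

definition homogeneous :: "'a op \<Rightarrow> bool" where
  "homogeneous A \<longleftrightarrow> (\<forall>c x y. (x, y) \<in> A \<longrightarrow> (c *\<^sub>C x, c *\<^sub>C y) \<in> A)"

lemma homogeneousD: "homogeneous A \<Longrightarrow> (x, y) \<in> A \<Longrightarrow> (c *\<^sub>C x, c *\<^sub>C y) \<in> A"
  unfolding homogeneous_def by blast

lemma homogeneous_times: "homogeneous A \<Longrightarrow> homogeneous B \<Longrightarrow> homogeneous (A \<cdot> B)"
  unfolding homogeneous_def op_times_def by blast

lemma adj_op_iff: "(x, y) \<in> adj_op A \<longleftrightarrow> (\<forall>u v. (u, v) \<in> A \<longrightarrow> cinner x v = cinner y u)"
  unfolding adj_op_def by auto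

lemma homogeneous_adj_op: "homogeneous (adj_op A)"
  unfolding homogeneous_def adj_op_iff by (simp add: cinner_scaleC_left)

text \<open>Every adjoint graph is closed under scaling, whatever the original graph, and a
  self-adjoint one is its own adjoint.\<close>

lemma self_adjoint_homogeneous: "self_adjoint A \<Longrightarrow> homogeneous A"
  using homogeneous_adj_op[of A] by (simp add: self_adjoint_def)

lemma op_scale_scale: "a \<odot> b \<odot> A = (a * b) \<odot> A"
  unfolding op_scale_def by force

lemma op_scale_one [simp]: "1 \<odot> A = A"
  unfolding op_scale_def by simp

lemma op_scale_plus: "c \<odot> (A \<oplus> B) = c \<odot> A \<oplus> c \<odot> B"
proof (rule set_eqI, clarify)
  fix x y
  show "(x, y) \<in> c \<odot> (A \<oplus> B) \<longleftrightarrow> (x, y) \<in> c \<odot> A \<oplus> c \<odot> B"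
  proof
    assume "(x, y) \<in> c \<odot> (A \<oplus> B)"
    then obtain u v where "(x, u) \<in> A" "(x, v) \<in> B" "y = c *\<^sub>C u + c *\<^sub>C v"
      by (auto simp: op_scale_def op_plus_def scaleC_right_distrib)
    then show "(x, y) \<in> c \<odot> A \<oplus> c \<odot> B" unfolding op_scale_def op_plus_def by blast
  next
    assume "(x, y) \<in> c \<odot> A \<oplus> c \<odot> B"
    then obtain u v where "(x, u) \<in> A" "(x, v) \<in> B" "y = c *\<^sub>C (u + v)"
      by (auto simp: op_scale_def op_plus_def scaleC_right_distrib)
    then show "(x, y) \<in> c \<odot> (A \<oplus> B)" unfolding op_scale_def op_plus_def by blast
  qed
qed

lemma op_scale_times: "(c \<odot> A) \<cdot> B = c \<odot> (A \<cdot> B)"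
  unfolding op_scale_def op_times_def by blast

lemma op_scale_iff: "c \<noteq> 0 \<Longrightarrow> (x, y) \<in> c \<odot> A \<longleftrightarrow> (x, (1 / c) *\<^sub>C y) \<in> A"
  unfolding op_scale_def by (auto intro!: exI[of _ "(1 / c) *\<^sub>C y"])

text \<open>Scaling a pair of \<open>A\<close> by \<open>1 / c\<close> removes the factor from the
  intermediate vector. At \<open>c = 0\<close> the domains may differ: the left side evaluates
  \<open>A\<close> only at 0, the right side needs the image under \<open>B\<close> to lie in the
  domain of \<open>A\<close>.\<close>

lemma op_times_scale:
  assumes "homogeneous A" "c \<noteq> 0"
  shows "A \<cdot> (c \<odot> B) = c \<odot> (A \<cdot> B)"
proof (rule set_eqI, clarify)
  fix x z
  show "(x, z) \<in> A \<cdot> (c \<odot> B) \<longleftrightarrow> (x, z) \<in> c \<odot> (A \<cdot> B)"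
  proof
    assume "(x, z) \<in> A \<cdot> (c \<odot> B)"
    then obtain y where "(x, y) \<in> B" "(c *\<^sub>C y, z) \<in> A" by (auto simp: op_scale_def op_times_def)
    moreover from homogeneousD[OF assms(1) this(2), of "1 / c"] assms(2)
    have "(y, (1 / c) *\<^sub>C z) \<in> A" by simp
    ultimately show "(x, z) \<in> c \<odot> (A \<cdot> B)"
      unfolding op_scale_iff[OF assms(2)] op_times_def by blast
  next
    assume "(x, z) \<in> c \<odot> (A \<cdot> B)"
    then obtain y w where "(x, y) \<in> B" "(y, w) \<in> A" "z = c *\<^sub>C w" by (auto simp: op_scale_def op_times_def)
    then show "(x, z) \<in> A \<cdot> (c \<odot> B)"
      unfolding op_scale_def op_times_def using homogeneousD[OF assms(1), of y w c] by blast
  qed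
qed

lemma op_sum_cong: "(\<And>j. j \<in> J \<Longrightarrow> A j = B j) \<Longrightarrow> op_sum J A = op_sum J B"
proof -
  assume AB: "\<And>j. j \<in> J \<Longrightarrow> A j = B j"
  have "(\<forall>j\<in>J. (x, f j) \<in> A j) \<longleftrightarrow> (\<forall>j\<in>J. (x, f j) \<in> B j)" for x f
    by (intro ball_cong refl) (simp only: AB)
  then show ?thesis unfolding op_sum_def by presburger
qed

lemma commutator_scale_left:
  assumes "homogeneous B" "c \<noteq> 0"
  shows "commutator (c \<odot> A) B = c \<odot> commutator A B"
  unfolding commutator_def op_scale_times op_times_scale[OF assms] op_scale_plus op_scale_scale
  by (simp add: mult.commute)

lemma commutator_scale_right:
  assumes "homogeneous A" "c \<noteq> 0"
  shows "commutator A (c \<odot> B) = c \<odot> commutator A B"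
  unfolding commutator_def op_scale_times op_times_scale[OF assms] op_scale_plus op_scale_scale
  by (simp add: mult.commute)

section \<open>Unitary conjugation\<close>

lemma unitaryD:
  assumes "unitary U"
  shows unitary_add: "U (x + y) = U x + U y" and unitary_scaleC: "U (c *\<^sub>C x) = c *\<^sub>C U x"
    and norm_unitary: "norm (U x) = norm x" and surj_unitary: "surj U"
  using assms by (simp_all only: unitary_def)

lemma unitary_zero: "unitary U \<Longrightarrow> U 0 = 0"
  by (metis norm_unitary norm_eq_zero)

lemma unitary_minus: "unitary U \<Longrightarrow> U (- x) = - U x"
  using unitary_scaleC[of U "-1" x] by simp

lemma unitary_diff: "unitary U \<Longrightarrow> U (x - y) = U x - U y"
  using unitary_add[of U x "- y"] by (simp add: unitary_minus)

lemma unitary_sum: "unitary U \<Longrightarrow> U (\<Sum>j\<in>J. f j) = (\<Sum>j\<in>J. U (f j))"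
  by (induction J rule: infinite_finite_induct) (auto simp: unitary_zero unitary_add)

lemma inj_unitary: "unitary U \<Longrightarrow> inj U"
proof (rule injI)
  fix x y assume U: "unitary U" and "U x = U y"
  then have "norm (x - y) = 0" using norm_unitary[OF U, of "x - y"] by (simp add: unitary_diff)
  then show "x = y" by simp
qed

lemma bij_unitary: "unitary U \<Longrightarrow> bij U"
  by (simp add: bij_def inj_unitary surj_unitary)

lemma unitary_inv_apply [simp]: "unitary U \<Longrightarrow> U (inv U x) = x" "unitary U \<Longrightarrow> inv U (U x) = x"
  by (simp_all add: surj_unitary surj_f_inv_f inj_unitary)

lemma unitary_inv: "unitary U \<Longrightarrow> unitary (inv U)"
proof -
  assume U: "unitary U"
  note [simp] = unitary_inv_apply[OF U]
  have "inv U (x + y) = inv U x + inv U y" for x y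
    by (rule injD[OF inj_unitary[OF U]]) (simp add: unitary_add[OF U])
  moreover have "inv U (c *\<^sub>C x) = c *\<^sub>C inv U x" for c x
    by (rule injD[OF inj_unitary[OF U]]) (simp add: unitary_scaleC[OF U])
  moreover have "norm (inv U x) = norm x" for x
    using norm_unitary[OF U, of "inv U x"] by simp
  moreover have "surj (inv U)" by (simp add: bij_imp_bij_inv bij_is_surj bij_unitary[OF U])
  ultimately show ?thesis unfolding unitary_def by blast
qed

lemma bounded_linear_unitary: "unitary U \<Longrightarrow> bounded_linear U"
  by (rule bounded_linear_intro[where K=1])
     (auto simp: unitary_add norm_unitary unitary_scaleC simp flip: scaleC_of_real)

text \<open>Unitarity is given as norm preservation. Polarisation recovers the real part of the
  inner product, and replacing \<open>x\<close> by \<i> times \<open>x\<close> recovers the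
  imaginary part.\<close>

lemma cinner_unitary: assumes "unitary U" shows "cinner (U x) (U y) = cinner x y"
proof -
  have Re: "Re (cinner (U x) (U y)) = Re (cinner x y)" for x y
  proof -
    have "(norm (U x + U y))\<^sup>2 = (norm (x + y))\<^sup>2"
      by (simp add: norm_unitary[OF assms] flip: unitary_add[OF assms])
    then have "inner (U x) (U y) = inner x y"
      by (simp add: power2_norm_eq_inner inner_add_left inner_add_right inner_commute)
         (simp add: norm_unitary[OF assms] flip: power2_norm_eq_inner)
    then show ?thesis by (simp add: inner_ell2_def)
  qed
  have "Im (cinner (U x) (U y)) = Re (cinner (U (\<i> *\<^sub>C x)) (U y))"
    by (simp add: unitary_scaleC[OF assms] cinner_scaleC_left)
  then show ?thesis
    by (intro complex_eqI Re) (simp add: Re cinner_scaleC_left)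
qed

lemma cinner_unitary_inv: "unitary U \<Longrightarrow> cinner (U x) y = cinner x (inv U y)"
  using cinner_unitary[of U x "inv U y"] by simp

lemma conj_op_iff: "unitary U \<Longrightarrow> (U x, U y) \<in> conj_op U A \<longleftrightarrow> (x, y) \<in> A"
  unfolding conj_op_def by (auto dest: injD[OF inj_unitary])

lemma conj_op_inv_iff: "unitary U \<Longrightarrow> (x, y) \<in> conj_op U A \<longleftrightarrow> (inv U x, inv U y) \<in> A"
  using conj_op_iff[of U "inv U x" "inv U y"] by simp

lemma conj_op_comp: "conj_op (U \<circ> V) A = conj_op U (conj_op V A)"
  unfolding conj_op_def by auto

lemma conj_op_id [simp]: "conj_op id A = A" "conj_op (\<lambda>x. x) A = A"
  unfolding conj_op_def by auto

lemma conj_op_inv_cancel [simp]: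
  assumes "unitary U" shows "conj_op (inv U) (conj_op U A) = A" "conj_op U (conj_op (inv U) A) = A"
proof -
  have "inv U \<circ> U = id" "U \<circ> inv U = id" using assms by auto
  then show "conj_op (inv U) (conj_op U A) = A" "conj_op U (conj_op (inv U) A) = A"
    by (simp_all flip: conj_op_comp)
qed

lemma conj_op_scale:
  assumes U: "unitary U" shows "conj_op U (c \<odot> A) = c \<odot> conj_op U A"
proof (rule set_eqI, clarify)
  fix x y
  have "(\<exists>z. inv U y = c *\<^sub>C z \<and> (inv U x, z) \<in> A) \<longleftrightarrow>
      (\<exists>z. y = c *\<^sub>C z \<and> (inv U x, inv U z) \<in> A)"
    by (metis unitary_scaleC[OF U] unitary_scaleC[OF unitary_inv[OF U]] unitary_inv_apply[OF U])
  then show "(x, y) \<in> conj_op U (c \<odot> A) \<longleftrightarrow> (x, y) \<in> c \<odot> conj_op U A"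
    by (simp add: conj_op_inv_iff[OF U] op_scale_def)
qed

lemma conj_op_plus:
  assumes U: "unitary U" shows "conj_op U (A \<oplus> B) = conj_op U A \<oplus> conj_op U B"
proof (rule set_eqI, clarify)
  fix x y
  have "(\<exists>u v. inv U y = u + v \<and> (inv U x, u) \<in> A \<and> (inv U x, v) \<in> B) \<longleftrightarrow>
      (\<exists>u v. y = u + v \<and> (inv U x, inv U u) \<in> A \<and> (inv U x, inv U v) \<in> B)" (is "?L \<longleftrightarrow> ?R")
  proof
    assume ?L
    then obtain u v where "inv U y = u + v" "(inv U x, u) \<in> A" "(inv U x, v) \<in> B" by blast
    moreover from this(1) have "y = U u + U v" by (metis U unitary_add unitary_inv_apply(1))
    ultimately show ?R using U by - (rule exI[of _ "U u"], rule exI[of _ "U v"], simp)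
  next
    assume ?R
    then show ?L using unitary_add[OF unitary_inv[OF U]] by blast
  qed
  then show "(x, y) \<in> conj_op U (A \<oplus> B) \<longleftrightarrow> (x, y) \<in> conj_op U A \<oplus> conj_op U B"
    by (simp add: conj_op_inv_iff[OF U] op_plus_def)
qed

lemma conj_op_times:
  assumes U: "unitary U" shows "conj_op U (A \<cdot> B) = conj_op U A \<cdot> conj_op U B"
proof (rule set_eqI, clarify)
  fix x z
  have "(\<exists>y. (inv U x, y) \<in> B \<and> (y, inv U z) \<in> A) \<longleftrightarrow>
      (\<exists>y. (inv U x, inv U y) \<in> B \<and> (inv U y, inv U z) \<in> A)"
    by (metis unitary_inv_apply(2)[OF U])
  then show "(x, z) \<in> conj_op U (A \<cdot> B) \<longleftrightarrow> (x, z) \<in> conj_op U A \<cdot> conj_op U B"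
    by (simp add: conj_op_inv_iff[OF U] op_times_def)
qed

lemma conj_op_sum:
  assumes U: "unitary U" shows "conj_op U (op_sum J A) = op_sum J (\<lambda>j. conj_op U (A j))"
proof (rule set_eqI, clarify)
  fix x y
  have "(\<exists>f. inv U y = sum f J \<and> (\<forall>j\<in>J. (inv U x, f j) \<in> A j)) \<longleftrightarrow>
      (\<exists>f. y = sum f J \<and> (\<forall>j\<in>J. (inv U x, inv U (f j)) \<in> A j))" (is "?L \<longleftrightarrow> ?R")
  proof
    assume ?L
    then obtain f where f: "inv U y = sum f J" "\<forall>j\<in>J. (inv U x, f j) \<in> A j" by blast
    have "y = (\<Sum>j\<in>J. U (f j))"
      using arg_cong[OF f(1), of U] U by (simp add: unitary_sum)
    then show ?R using f(2) U by (intro exI[of _ "\<lambda>j. U (f j)"]) auto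
  next
    assume ?R
    then obtain f where f: "y = sum f J" "\<forall>j\<in>J. (inv U x, inv U (f j)) \<in> A j" by blast
    have "inv U y = (\<Sum>j\<in>J. inv U (f j))"
      using f(1) U by (simp add: unitary_sum unitary_inv)
    then show ?L using f(2) by blast
  qed
  then show "(x, y) \<in> conj_op U (op_sum J A) \<longleftrightarrow> (x, y) \<in> op_sum J (\<lambda>j. conj_op U (A j))"
    by (simp add: conj_op_inv_iff[OF U] op_sum_def)
qed

lemma conj_op_commutator:
  "unitary U \<Longrightarrow> conj_op U (commutator A B) = commutator (conj_op U A) (conj_op U B)"
  by (simp add: commutator_def conj_op_plus conj_op_times conj_op_scale)

lemma homogeneous_conj: "unitary U \<Longrightarrow> homogeneous A \<Longrightarrow> homogeneous (conj_op U A)"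
  unfolding homogeneous_def by (simp add: conj_op_inv_iff unitary_scaleC unitary_inv)

section \<open>Trace class operators\<close>

text \<open>The rank-one series from the definition of \<open>trace_class\<close>, named so that
  scalars and unitaries can be moved onto the vectors \<alpha> and \<beta>.\<close>

definition nuclear_op :: "(nat \<Rightarrow> 'a ell2) \<Rightarrow> (nat \<Rightarrow> 'a ell2) \<Rightarrow> 'a op" where
  "nuclear_op \<alpha> \<beta> = {(x, y). (\<lambda>n. cinner (\<beta> n) x *\<^sub>C \<alpha> n) sums y}"

lemma trace_classE:
  assumes "trace_class A"
  obtains \<alpha> \<beta> where "summable (\<lambda>n. norm (\<alpha> n) * norm (\<beta> n))" "A = nuclear_op \<alpha> \<beta>"
  using assms unfolding trace_class_def nuclear_op_def by blast

lemma trace_class_nuclear: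
  "summable (\<lambda>n. norm (\<alpha> n) * norm (\<beta> n)) \<Longrightarrow> trace_class (nuclear_op \<alpha> \<beta>)"
  unfolding trace_class_def nuclear_op_def by blast

lemma summable_nuclear:
  assumes "summable (\<lambda>n. norm (\<alpha> n) * norm (\<beta> n))"
  shows "summable (\<lambda>n. cinner (\<beta> n) x *\<^sub>C \<alpha> n)"
proof (rule summable_comparison_test[OF _ summable_mult[OF assms, of "norm x"]], intro exI allI impI)
  fix n
  show "norm (cinner (\<beta> n) x *\<^sub>C \<alpha> n) \<le> norm x * (norm (\<alpha> n) * norm (\<beta> n))"
    using mult_right_mono[OF cinner_Cauchy_Schwarz[of "\<beta> n" x] norm_ge_zero[of "\<alpha> n"]]
    by (simp add: norm_scaleC mult_ac)
qed

lemma nuclear_op_iff: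
  assumes "summable (\<lambda>n. norm (\<alpha> n) * norm (\<beta> n))"
  shows "(x, y) \<in> nuclear_op \<alpha> \<beta> \<longleftrightarrow> y = (\<Sum>n. cinner (\<beta> n) x *\<^sub>C \<alpha> n)"
  using sums_unique summable_sums[OF summable_nuclear[OF assms]] unfolding nuclear_op_def by blast

lemma app_nuclear:
  assumes "summable (\<lambda>n. norm (\<alpha> n) * norm (\<beta> n))"
  shows "app (nuclear_op \<alpha> \<beta>) x = (\<Sum>n. cinner (\<beta> n) x *\<^sub>C \<alpha> n)"
  unfolding app_def nuclear_op_iff[OF assms] by simp

lemma nuclear_op_scale:
  assumes "c \<noteq> 0" shows "c \<odot> nuclear_op \<alpha> \<beta> = nuclear_op (\<lambda>n. c *\<^sub>C \<alpha> n) \<beta>"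
proof (rule set_eqI, clarify)
  fix x y
  have "(x, y) \<in> c \<odot> nuclear_op \<alpha> \<beta> \<longleftrightarrow> (x, (1 / c) *\<^sub>C y) \<in> nuclear_op \<alpha> \<beta>"
    by (rule op_scale_iff[OF assms])
  also have "\<dots> \<longleftrightarrow> (x, y) \<in> nuclear_op (\<lambda>n. c *\<^sub>C \<alpha> n) \<beta>"
    unfolding nuclear_op_def mem_Collect_eq case_prod_conv
    using bounded_linear.sums[OF bounded_linear_scaleC_right[of c], of "\<lambda>n. cinner (\<beta> n) x *\<^sub>C \<alpha> n" "(1 / c) *\<^sub>C y"]
      bounded_linear.sums[OF bounded_linear_scaleC_right[of "1 / c"], of "\<lambda>n. cinner (\<beta> n) x *\<^sub>C c *\<^sub>C \<alpha> n" y] assms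
    by (auto simp: mult_ac)
  finally show "(x, y) \<in> c \<odot> nuclear_op \<alpha> \<beta> \<longleftrightarrow> (x, y) \<in> nuclear_op (\<lambda>n. c *\<^sub>C \<alpha> n) \<beta>" .
qed

lemma conj_nuclear_op:
  assumes U: "unitary U"
  shows "conj_op U (nuclear_op \<alpha> \<beta>) = nuclear_op (\<lambda>n. U (\<alpha> n)) (\<lambda>n. U (\<beta> n))"
proof (rule set_eqI, clarify)
  fix x y
  show "(x, y) \<in> conj_op U (nuclear_op \<alpha> \<beta>) \<longleftrightarrow> (x, y) \<in> nuclear_op (\<lambda>n. U (\<alpha> n)) (\<lambda>n. U (\<beta> n))"
    unfolding conj_op_inv_iff[OF U] nuclear_op_def mem_Collect_eq case_prod_conv cinner_unitary_inv[OF U]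
    using bounded_linear.sums[OF bounded_linear_unitary[OF U], of "\<lambda>n. cinner (\<beta> n) (inv U x) *\<^sub>C \<alpha> n" "inv U y"]
      bounded_linear.sums[OF bounded_linear_unitary[OF unitary_inv[OF U]],
        of "\<lambda>n. cinner (\<beta> n) (inv U x) *\<^sub>C U (\<alpha> n)" y] U
    by (auto simp: unitary_scaleC unitary_inv)
qed

lemma trace_class_homogeneous: "trace_class A \<Longrightarrow> homogeneous A"
  using bounded_linear.sums[OF bounded_linear_scaleC_right]
  by (fastforce simp: homogeneous_def nuclear_op_def cinner_scaleC_right mult_ac elim: trace_classE)

text \<open>Cauchy-Schwarz for the vectors of entrywise moduli. It supplies the absolute bound for
  exchanging sums below.\<close>

lemma infsum_amp_mult_le:
  "(\<Sum>\<^sub>\<infinity>i. cmod (cnj (amp x i) * amp y i)) \<le> norm x * norm y"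
proof -
  define absv :: "'a ell2 \<Rightarrow> 'a ell2" where "absv x = Abs_ell2 (\<lambda>i. of_real (cmod (amp x i)))" for x
  have amp: "amp (absv x) i = of_real (cmod (amp x i))" for x :: "'a ell2" and i
    unfolding absv_def by (subst amp_Abs) (auto intro: summable_amp)
  have norm: "norm (absv x) = norm x" for x :: "'a ell2"
    by (intro antisym norm_le_amp) (auto simp: amp)
  have "((\<lambda>i. complex_of_real (cmod (cnj (amp x i) * amp y i))) has_sum
      of_real (\<Sum>\<^sub>\<infinity>i. cmod (cnj (amp x i) * amp y i))) UNIV"
    by (intro has_sum_of_real has_sum_infsum abs_summable_amp_mult)
  then have "cinner (absv x) (absv y) = of_real (\<Sum>\<^sub>\<infinity>i. cmod (cnj (amp x i) * amp y i))"
    unfolding cinner_def by (intro infsumI) (simp add: amp norm_mult)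
  then have "cmod (of_real (\<Sum>\<^sub>\<infinity>i. cmod (cnj (amp x i) * amp y i))) \<le> norm x * norm y"
    using cinner_Cauchy_Schwarz[of "absv x" "absv y"] by (simp add: norm)
  then show ?thesis by simp
qed

text \<open>The double family over \<open>n\<close> and \<open>i\<close> is absolutely summable, row
  \<open>n\<close> contributing at most \<open>norm (u n) * norm (v n)\<close>, so the two sums can
  be exchanged. Trace and partial trace are both computed this way.\<close>

lemma has_sum_cinner_series:
  assumes "summable (\<lambda>n. norm (u n) * norm (v n))"
  shows "((\<lambda>i. \<Sum>n. cnj (amp (u n) i) * amp (v n) i) has_sum (\<Sum>n. cinner (u n) (v n))) UNIV"
proof -
  define f where "f = (\<lambda>(n, i). cnj (amp (u n) i) * amp (v n) i)"
  have bound: "(\<lambda>n. norm (u n) * norm (v n)) summable_on UNIV"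
    using assms by (simp add: summable_on_UNIV_nonneg_real_iff)
  have "(\<lambda>x. norm (f x)) summable_on UNIV \<times> UNIV"
    unfolding Infinite_Sum.abs_summable_on_Sigma_iff
  proof (intro conjI ballI)
    show "(\<lambda>i. norm (f (n, i))) summable_on UNIV" for n
      unfolding f_def using abs_summable_amp_mult by simp
    have le: "(\<Sum>\<^sub>\<infinity>i. norm (f (n, i))) \<le> norm (u n) * norm (v n)" for n
      unfolding f_def using infsum_amp_mult_le by simp
    then show "(\<lambda>n. norm (\<Sum>\<^sub>\<infinity>i. norm (f (n, i)))) summable_on UNIV"
      by (intro summable_on_comparison_test[OF bound]) (auto simp: abs_of_nonneg infsum_nonneg)
  qed
  then have sum: "f summable_on UNIV \<times> UNIV" by (rule abs_summable_summable)
  then have "(f has_sum infsum f (UNIV \<times> UNIV)) (UNIV \<times> UNIV)" by (rule has_sum_infsum)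
  moreover from this have "((\<lambda>n. cinner (u n) (v n)) has_sum infsum f (UNIV \<times> UNIV)) UNIV"
    by (rule has_sum_SigmaD)
       (auto simp: f_def cinner_def intro: has_sum_infsum summable_cinner)
  then have "infsum f (UNIV \<times> UNIV) = (\<Sum>n. cinner (u n) (v n))"
    by (intro sums_unique has_sum_imp_sums)
  ultimately have "((\<lambda>(i, n). f (n, i)) has_sum (\<Sum>n. cinner (u n) (v n))) (UNIV \<times> UNIV)"
    by (subst (asm) has_sum_swap) simp
  then show ?thesis
  proof (rule has_sum_SigmaD)
    fix i
    have "(\<lambda>(i, n). f (n, i)) summable_on UNIV \<times> UNIV" using sum by (subst (asm) summable_on_swap)
    then have "(\<lambda>n. f (n, i)) summable_on UNIV"
      using summable_on_SigmaD1[of "\<lambda>i n. f (n, i)" UNIV "\<lambda>_. UNIV" i] by simp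
    then have "((\<lambda>n. f (n, i)) has_sum (\<Sum>\<^sub>\<infinity>n. f (n, i))) UNIV" by (rule has_sum_infsum)
    moreover from this have "(\<Sum>\<^sub>\<infinity>n. f (n, i)) = (\<Sum>n. f (n, i))"
      by (intro sums_unique has_sum_imp_sums)
    ultimately show "((\<lambda>n. (\<lambda>(i, n). f (n, i)) (i, n)) has_sum (\<Sum>n. cnj (amp (u n) i) * amp (v n) i)) UNIV"
      by (simp add: f_def)
  qed
qed

text \<open>The right side refers to no basis, although \<open>op_trace\<close> sums over
  \<open>ket\<close>. Scaling and unitary invariance of the trace are read off from it.\<close>

lemma op_trace_nuclear:
  assumes "summable (\<lambda>n. norm (\<alpha> n) * norm (\<beta> n))"
  shows "op_trace (nuclear_op \<alpha> \<beta>) = (\<Sum>n. cinner (\<beta> n) (\<alpha> n))"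
proof -
  have "amp (app (nuclear_op \<alpha> \<beta>) (ket i)) i = (\<Sum>n. cnj (amp (\<beta> n) i) * amp (\<alpha> n) i)" for i
    unfolding app_nuclear[OF assms]
    using bounded_linear.suminf[OF bounded_linear_amp[of i] summable_nuclear[OF assms, of "ket i"]]
    by simp
  moreover have "summable (\<lambda>n. norm (\<beta> n) * norm (\<alpha> n))" using assms by (simp add: mult.commute)
  ultimately show ?thesis
    using trace_class_nuclear[OF assms] infsumI[OF has_sum_cinner_series, of \<beta> \<alpha>]
    by (simp add: op_trace_def)
qed

lemma trace_class_scale: "trace_class A \<Longrightarrow> c \<noteq> 0 \<Longrightarrow> trace_class (c \<odot> A)"
  by (auto elim!: trace_classE simp: nuclear_op_scale norm_scaleC mult.assoc
      intro!: trace_class_nuclear summable_mult)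

lemma op_trace_scale: assumes "c \<noteq> 0" shows "op_trace (c \<odot> A) = c * op_trace A"
proof (cases "trace_class A")
  case True
  then obtain \<alpha> \<beta> where s: "summable (\<lambda>n. norm (\<alpha> n) * norm (\<beta> n))" and A: "A = nuclear_op \<alpha> \<beta>"
    by (rule trace_classE)
  have s': "summable (\<lambda>n. norm (c *\<^sub>C \<alpha> n) * norm (\<beta> n))"
    using summable_mult[OF s, of "cmod c"] by (simp add: norm_scaleC mult_ac)
  have "summable (\<lambda>n. cinner (\<beta> n) (\<alpha> n))"
    by (rule summable_comparison_test[OF _ s])
       (metis cinner_Cauchy_Schwarz mult.commute)
  from suminf_mult[OF this, of c] show ?thesis
    unfolding A nuclear_op_scale[OF assms] op_trace_nuclear[OF s] op_trace_nuclear[OF s']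
    by (simp add: cinner_scaleC_right)
next
  \<comment> \<open>\<open>op_trace\<close> is 0 off the trace class, and a nonzero multiple of a
    graph is trace class only if the graph is.\<close>
  case False
  moreover have "\<not> trace_class (c \<odot> A)"
    using False trace_class_scale[of "c \<odot> A" "1 / c"] assms by (auto simp: op_scale_scale)
  ultimately show ?thesis by (simp add: op_trace_def)
qed

lemma trace_class_conj: "unitary U \<Longrightarrow> trace_class A \<Longrightarrow> trace_class (conj_op U A)"
  by (auto elim!: trace_classE simp: conj_nuclear_op norm_unitary intro!: trace_class_nuclear)

text \<open>A unitary preserves every inner product in the nuclear form of the trace. Off the trace
  class both sides are the default 0, as \<open>inv U\<close> would carry a trace class conjugate
  back.\<close>

lemma op_trace_conj: assumes U: "unitary U" shows "op_trace (conj_op U A) = op_trace A"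
proof (cases "trace_class A")
  case True
  then obtain \<alpha> \<beta> where s: "summable (\<lambda>n. norm (\<alpha> n) * norm (\<beta> n))" and A: "A = nuclear_op \<alpha> \<beta>"
    by (rule trace_classE)
  then show ?thesis
    by (simp add: conj_nuclear_op U op_trace_nuclear norm_unitary cinner_unitary)
next
  case False
  moreover have "\<not> trace_class (conj_op U A)"
    using False trace_class_conj[OF unitary_inv[OF U], of "conj_op U A"] U by auto
  ultimately show ?thesis by (simp add: op_trace_def)
qed

section \<open>Redfield generator under CP\<close>

lemma homogeneous_scale: "homogeneous A \<Longrightarrow> homogeneous (c \<odot> A)"
  unfolding homogeneous_def op_scale_def by clarsimp (metis mult.commute scaleC_scaleC)

lemma redfield_cong:
  assumes "\<And>j. j < m \<Longrightarrow> L j = L' j" "\<And>j. j < m \<Longrightarrow> \<mu> j = \<mu>' j"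
    and "\<And>j l \<tau>. j < m \<Longrightarrow> l < m \<Longrightarrow> 0 \<le> \<tau> \<Longrightarrow> C j l \<tau> = C' j l \<tau>"
  shows "redfield hbar H m L \<mu> C t \<rho> = redfield hbar H m L' \<mu>' C' t \<rho>"
proof -
  have "integral {0..t} (C j l) = integral {0..t} (C' j l)" if "j < m" "l < m" for j l
    by (rule integral_cong) (use assms(3)[OF that] in auto)
  then show ?thesis
    unfolding redfield_def Let_def
    using assms(1,2)
    by (intro arg_cong2[where f="(\<oplus>)"] arg_cong2[where f="(\<odot>)"] refl op_sum_cong) auto
qed

lemma conj_op_redfield:
  assumes U: "unitary U"
  shows "conj_op U (redfield hbar H m L \<mu> C t \<rho>) =
    redfield hbar (conj_op U H) m (\<lambda>j. conj_op U (L j)) \<mu> C t (conj_op U \<rho>)"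
  unfolding redfield_def Let_def
  by (simp add: conj_op_plus conj_op_scale conj_op_sum conj_op_commutator conj_op_times U case_prod_unfold)

text \<open>Each term is linear in every coupling operator it contains, so the signs can be moved
  onto the means and correlations. They are real, so they pass through \<open>cnj\<close>, and
  nonzero, so no domain changes.\<close>

lemma redfield_parity:
  assumes m: "\<And>j. j < m \<Longrightarrow> homogeneous (L j) \<and> \<zeta> j \<in> {1, - 1 :: real}" and \<rho>: "homogeneous \<rho>"
  shows "redfield hbar H m (\<lambda>j. of_real (\<zeta> j) \<odot> L j) \<mu> C t \<rho> =
    redfield hbar H m L (\<lambda>j. of_real (\<zeta> j) * \<mu> j) (\<lambda>j l \<tau>. of_real (\<zeta> j * \<zeta> l) * C j l \<tau>) t \<rho>"
proof -
  have int: "integral {0..t} (\<lambda>\<tau>. of_real (\<zeta> j * \<zeta> l) * C j l \<tau>) =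
      of_real (\<zeta> j * \<zeta> l) * integral {0..t} (C j l)" for j l
    using integral_cmul[of "{0..t}" "\<zeta> j * \<zeta> l" "C j l"] by (simp add: scaleR_conv_of_real)
  have 1: "\<mu> j \<odot> commutator (of_real (\<zeta> j) \<odot> L j) \<rho> = (of_real (\<zeta> j) * \<mu> j) \<odot> commutator (L j) \<rho>"
    if "j < m" for j
    using m[OF that] by (subst commutator_scale_left[OF \<rho>]) (auto simp: op_scale_scale mult.commute)
  have 2: "a \<odot> commutator (of_real (\<zeta> j) \<odot> L j) ((of_real (\<zeta> l) \<odot> L l) \<cdot> \<rho>) =
      (of_real (\<zeta> j * \<zeta> l) * a) \<odot> commutator (L j) (L l \<cdot> \<rho>)" if "j < m" "l < m" for a j l
  proof -
    have [simp]: "\<zeta> j \<noteq> 0" "\<zeta> l \<noteq> 0" using m that by force+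
    have h: "homogeneous (L j)" "homogeneous (L l \<cdot> \<rho>)" using m that \<rho> homogeneous_times by blast+
    have "commutator (of_real (\<zeta> j) \<odot> L j) ((of_real (\<zeta> l) \<odot> L l) \<cdot> \<rho>) =
        of_real (\<zeta> j) \<odot> commutator (L j) ((of_real (\<zeta> l) \<odot> L l) \<cdot> \<rho>)"
      by (rule commutator_scale_left) (simp_all add: op_scale_times homogeneous_scale h)
    also have "\<dots> = of_real (\<zeta> j) \<odot> of_real (\<zeta> l) \<odot> commutator (L j) (L l \<cdot> \<rho>)"
      unfolding op_scale_times by (subst commutator_scale_right[OF h(1)]) simp_all
    finally show ?thesis by (simp add: op_scale_scale mult_ac)
  qed
  have 3: "a \<odot> commutator (\<rho> \<cdot> (of_real (\<zeta> l) \<odot> L l)) (of_real (\<zeta> j) \<odot> L j) =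
      (of_real (\<zeta> j * \<zeta> l) * a) \<odot> commutator (\<rho> \<cdot> L l) (L j)" if "j < m" "l < m" for a j l
  proof -
    have [simp]: "\<zeta> j \<noteq> 0" "\<zeta> l \<noteq> 0" using m that by force+
    have h: "homogeneous (L j)" "homogeneous (\<rho> \<cdot> L l)" using m that \<rho> homogeneous_times by blast+
    have "commutator (\<rho> \<cdot> (of_real (\<zeta> l) \<odot> L l)) (of_real (\<zeta> j) \<odot> L j) =
        commutator (of_real (\<zeta> l) \<odot> (\<rho> \<cdot> L l)) (of_real (\<zeta> j) \<odot> L j)"
      by (simp add: op_times_scale[OF \<rho>])
    also have "\<dots> = of_real (\<zeta> l) \<odot> commutator (\<rho> \<cdot> L l) (of_real (\<zeta> j) \<odot> L j)"
      by (rule commutator_scale_left) (simp_all add: homogeneous_scale h)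
    also have "\<dots> = of_real (\<zeta> l) \<odot> of_real (\<zeta> j) \<odot> commutator (\<rho> \<cdot> L l) (L j)"
      by (subst commutator_scale_right[OF h(2)]) simp_all
    finally show ?thesis by (simp add: op_scale_scale mult_ac)
  qed
  define A where "A j l = integral {0..t} (C j l)" for j l
  have s1: "op_sum {..<m} (\<lambda>j. \<mu> j \<odot> commutator (of_real (\<zeta> j) \<odot> L j) \<rho>) =
      op_sum {..<m} (\<lambda>j. (of_real (\<zeta> j) * \<mu> j) \<odot> commutator (L j) \<rho>)"
    by (rule op_sum_cong) (simp only: 1 lessThan_iff)
  have s2: "op_sum ({..<m} \<times> {..<m}) (\<lambda>(j, l). A j l \<odot> commutator (of_real (\<zeta> j) \<odot> L j) ((of_real (\<zeta> l) \<odot> L l) \<cdot> \<rho>)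
        \<oplus> cnj (A j l) \<odot> commutator (\<rho> \<cdot> (of_real (\<zeta> l) \<odot> L l)) (of_real (\<zeta> j) \<odot> L j)) =
      op_sum ({..<m} \<times> {..<m}) (\<lambda>(j, l). (of_real (\<zeta> j * \<zeta> l) * A j l) \<odot> commutator (L j) (L l \<cdot> \<rho>)
        \<oplus> cnj (of_real (\<zeta> j * \<zeta> l) * A j l) \<odot> commutator (\<rho> \<cdot> L l) (L j))"
    by (rule op_sum_cong) (clarsimp simp only: 2 3 lessThan_iff mem_Sigma_iff complex_cnj_mult complex_cnj_complex_of_real prod.case)
  show ?thesis
    unfolding redfield_def Let_def int by (simp only: s1 s2[unfolded A_def])
qed

text \<open>CP on the system alone acts like sign changes of the environment data. This serves in
  both directions: signs that the environment absorbs give covariance, a sign that it does not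
  absorb gives bias.\<close>

lemma redfield_covariant:
  assumes U: "unitary U" and H: "conj_op U H = H"
    and L: "\<And>j. j < m \<Longrightarrow> self_adjoint (L j) \<and> \<zeta> j \<in> {1, -1} \<and> conj_op U (L j) = of_real (\<zeta> j) \<odot> L j"
    and \<rho>: "density_op \<rho>"
  shows "conj_op U (redfield hbar H m L \<mu> C t \<rho>) =
    redfield hbar H m L (\<lambda>j. of_real (\<zeta> j) * \<mu> j) (\<lambda>j l \<tau>. of_real (\<zeta> j * \<zeta> l) * C j l \<tau>) t (conj_op U \<rho>)"
proof -
  have "homogeneous (conj_op U \<rho>)"
    using \<rho> by (intro homogeneous_conj[OF U] trace_class_homogeneous) (simp add: density_op_def)
  moreover have "homogeneous (L j) \<and> \<zeta> j \<in> {1, -1}" if "j < m" for j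
    using L[OF that] self_adjoint_homogeneous by blast
  moreover have "conj_op U (redfield hbar H m L \<mu> C t \<rho>) =
      redfield hbar H m (\<lambda>j. of_real (\<zeta> j) \<odot> L j) \<mu> C t (conj_op U \<rho>)"
    unfolding conj_op_redfield[OF U] H by (rule redfield_cong) (simp_all add: L)
  ultimately show ?thesis by (simp only: redfield_parity)
qed

lemma apparently_cp_invariantI:
  assumes U: "unitary U" and H: "conj_op U H = H"
    and L: "\<And>j. j < m \<Longrightarrow> self_adjoint (L j) \<and> \<zeta> j \<in> {1, -1} \<and> conj_op U (L j) = of_real (\<zeta> j) \<odot> L j"
    and "\<And>j. j < m \<Longrightarrow> of_real (\<zeta> j) * \<mu> j = \<mu> j"
    and "\<And>j l \<tau>. j < m \<Longrightarrow> l < m \<Longrightarrow> of_real (\<zeta> j * \<zeta> l) * C j l \<tau> = C j l \<tau>"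
  shows "apparently_cp_invariant U (redfield hbar H m L \<mu> C)"
  unfolding apparently_cp_invariant_def
proof (intro allI impI)
  fix t :: real and \<rho> :: "'a op" assume "density_op \<rho>"
  show "conj_op U (redfield hbar H m L \<mu> C t \<rho>) = redfield hbar H m L \<mu> C t (conj_op U \<rho>)"
    by (rule trans[OF redfield_covariant[OF U H L \<open>density_op \<rho>\<close>] redfield_cong])
       (simp_all only: assms(4,5))
qed

section \<open>Uniqueness of the propagator\<close>

lemma generatesD:
  assumes "generates hbar H P"
  shows "P (s + t) x = P s (P t x)" "P 0 x = x" "unitary (P t)" "continuous_on UNIV (\<lambda>t. P t x)"
    and "(x, y) \<in> H \<longleftrightarrow> ((\<lambda>t. P t x) has_vector_derivative (- \<i> / of_real hbar) *\<^sub>C y) (at 0)"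
  using assms by (auto simp: generates_def)

text \<open>The group law is read in two ways: \<open>P t\<close> applied after \<open>P s\<close>
  moves the derivative from 0 to \<open>t\<close>, while \<open>P s\<close> applied after
  \<open>P t\<close> shows that the domain of \<open>H\<close> is invariant under
  \<open>P t\<close>.\<close>

lemma has_vector_derivative_propagator:
  assumes P: "generates hbar H P" and xy: "(x, y) \<in> H"
  shows "((\<lambda>t. P t x) has_vector_derivative (- \<i> / of_real hbar) *\<^sub>C P t y) (at t)"
    and "(P t x, P t y) \<in> H"
proof -
  have *: "((\<lambda>s. P (t + s) x) has_vector_derivative (- \<i> / of_real hbar) *\<^sub>C P t y) (at 0)"
    using bounded_linear.has_vector_derivative[OF bounded_linear_unitary[OF generatesD(3)[OF P, of t]]
        generatesD(5)[OF P, THEN iffD1, OF xy]]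
    by (simp add: generatesD(1)[OF P] unitary_scaleC[OF generatesD(3)[OF P]])
  show "(P t x, P t y) \<in> H"
    unfolding generatesD(5)[OF P] using * by (simp add: add.commute flip: generatesD(1)[OF P])
  have "((\<lambda>s. s - t) has_vector_derivative 1) (at t)"
    by (auto intro!: derivative_eq_intros)
  from vector_diff_chain_at[OF this, of "\<lambda>s. P (t + s) x"] *
  show "((\<lambda>t. P t x) has_vector_derivative (- \<i> / of_real hbar) *\<^sub>C P t y) (at t)"
    by (simp add: o_def)
qed

lemma self_adjoint_diff:
  assumes "self_adjoint H" "(x, y) \<in> H" "(x', y') \<in> H"
  shows "(x - x', y - y') \<in> H"
proof -
  have "(x, y) \<in> adj_op H" "(x', y') \<in> adj_op H" using assms by (simp_all add: self_adjoint_def)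
  then have "(x - x', y - y') \<in> adj_op H" unfolding adj_op_iff by (simp add: cinner_diff_left)
  then show ?thesis using assms(1) by (simp add: self_adjoint_def)
qed

lemma self_adjoint_real:
  assumes "self_adjoint H" "(x, y) \<in> H" shows "Im (cinner x y) = 0"
proof -
  have "(x, y) \<in> adj_op H" using assms by (simp add: self_adjoint_def)
  then have "cinner x y = cinner y x" using assms(2) unfolding adj_op_iff by blast
  also have "\<dots> = cnj (cinner x y)" by (rule cinner_commute)
  finally show ?thesis by (simp add: complex_eq_iff)
qed

text \<open>For two solutions starting at \<open>x\<close> the squared norm of the difference
  \<open>u\<close> is constant, its derivative being twice the real part of an imaginary multiple of
  the real number \<open>cinner (u t) (w t)\<close>. It starts at 0. Density of the domain and
  continuity extend the equality to all vectors.\<close>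

lemma generates_unique:
  assumes H: "self_adjoint H" and P: "generates hbar H P" and Q: "generates hbar H Q"
  shows "P = Q"
proof (intro ext)
  fix t x
  have eq: "P t x = Q t x" if "(x, y) \<in> H" for x y
  proof -
    define u where "u t = P t x - Q t x" for t
    define w where "w t = P t y - Q t y" for t
    have u: "(u has_vector_derivative (- \<i> / of_real hbar) *\<^sub>C w t) (at t)" for t
      unfolding u_def w_def scaleC_diff
      by (intro has_vector_derivative_diff has_vector_derivative_propagator[OF P that]
          has_vector_derivative_propagator[OF Q that])
    have "Im (cinner (u t) (w t)) = 0" for t
      unfolding u_def w_def using has_vector_derivative_propagator(2)[OF P that]
        has_vector_derivative_propagator(2)[OF Q that] by (intro self_adjoint_real[OF H] self_adjoint_diff[OF H])
    then have "inner (u t) ((- \<i> / of_real hbar) *\<^sub>C w t) = 0" for t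
      by (simp add: inner_ell2_def cinner_scaleC_right)
    then have "((\<lambda>t. inner (u t) (u t)) has_vector_derivative 0) (at t within UNIV)" for t
      using bounded_bilinear.has_vector_derivative[OF bounded_bilinear_inner u u, of t]
      by (simp add: inner_commute)
    then obtain c where "\<And>t. inner (u t) (u t) = c"
      using has_vector_derivative_zero_constant[of UNIV "\<lambda>t. inner (u t) (u t)"] by auto
    then have "inner (u t) (u t) = inner (u 0) (u 0)" by metis
    then have "u t = 0" by (simp add: u_def generatesD(2)[OF P] generatesD(2)[OF Q])
    then show ?thesis by (simp add: u_def)
  qed
  have "closed {x. P t x = Q t x}"
    by (intro closed_Collect_eq linear_continuous_on bounded_linear_unitary generatesD(3)[OF P] generatesD(3)[OF Q])
  moreover have "Domain H \<subseteq> {x. P t x = Q t x}" using eq by auto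
  ultimately have "closure (Domain H) \<subseteq> {x. P t x = Q t x}" by (rule closure_minimal[rotated])
  then show "P t x = Q t x" using H by (auto simp: self_adjoint_def)
qed

lemma unitary_comp: "unitary U \<Longrightarrow> unitary V \<Longrightarrow> unitary (U \<circ> V)"
  using comp_surj[of V U] by (simp add: unitary_def o_def)

lemma generates_conj:
  assumes U: "unitary U" and P: "generates hbar H P"
  shows "generates hbar (conj_op U H) (\<lambda>t. U \<circ> P t \<circ> inv U)"
proof -
  have inv: "unitary (inv U)" by (rule unitary_inv[OF U])
  have "unitary (U \<circ> P t \<circ> inv U)" for t
    by (intro unitary_comp U inv generatesD(3)[OF P])
  moreover have "continuous_on UNIV (\<lambda>t. U (P t (inv U x)))" for x
    by (rule continuous_on_compose2[OF linear_continuous_on[OF bounded_linear_unitary[OF U], of UNIV]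
          generatesD(4)[OF P]]) simp
  moreover have "(x, y) \<in> conj_op U H \<longleftrightarrow>
      ((\<lambda>t. U (P t (inv U x))) has_vector_derivative (- \<i> / of_real hbar) *\<^sub>C y) (at 0)" for x y
  proof -
    have "((\<lambda>t. P t (inv U x)) has_vector_derivative (- \<i> / of_real hbar) *\<^sub>C inv U y) (at 0) \<longleftrightarrow>
        ((\<lambda>t. U (P t (inv U x))) has_vector_derivative (- \<i> / of_real hbar) *\<^sub>C y) (at 0)"
      using bounded_linear.has_vector_derivative[OF bounded_linear_unitary[OF U],
          of "\<lambda>t. P t (inv U x)" "(- \<i> / of_real hbar) *\<^sub>C inv U y" "at 0"]
        bounded_linear.has_vector_derivative[OF bounded_linear_unitary[OF inv],
          of "\<lambda>t. U (P t (inv U x))" "(- \<i> / of_real hbar) *\<^sub>C y" "at 0"]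
      by (auto simp: U unitary_scaleC inv)
    then show ?thesis by (simp add: conj_op_inv_iff[OF U] generatesD(5)[OF P])
  qed
  ultimately show ?thesis
    unfolding generates_def o_def using U by (auto simp: fun_eq_iff generatesD(1,2)[OF P])
qed

lemma propagator_eqI: "self_adjoint H \<Longrightarrow> generates hbar H P \<Longrightarrow> propagator hbar H = P"
  unfolding propagator_def using generates_unique by (auto intro!: the_equality)

text \<open>Conjugating the group by \<open>U\<close> gives a group with the same generator, hence
  the same group. The default propagator is the identity and commutes with everything.\<close>

lemma propagator_commute:
  assumes H: "self_adjoint H" and U: "unitary U" and inv: "conj_op U H = H"
  shows "U \<circ> propagator hbar H t = propagator hbar H t \<circ> U"
proof (cases "\<exists>P. generates hbar H P")
  case True
  then obtain P where P: "generates hbar H P" by blast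
  have "(\<lambda>t. U \<circ> P t \<circ> inv U) = P"
    using generates_unique[OF H] generates_conj[OF U P] P inv by metis
  then have "U \<circ> P t \<circ> inv U = P t" by (simp add: fun_eq_iff)
  then have "U (P t x) = P t (U x)" for x
    using U by (metis comp_apply unitary_inv_apply(2))
  then show ?thesis using propagator_eqI[OF H P] by auto
qed (simp add: propagator_def)

lemma unitary_propagator: "self_adjoint H \<Longrightarrow> unitary (propagator hbar H t)"
proof (cases "\<exists>P. generates hbar H P")
  case True
  assume "self_adjoint H"
  with True show ?thesis using propagator_eqI generatesD(3) by metis
qed (simp add: propagator_def unitary_def)

section \<open>Thermal baths\<close>

lemma conj_diag_op: "unitary U \<Longrightarrow> conj_op U (diag_op b v) = diag_op (U \<circ> b) v"
  by (auto simp: conj_op_inv_iff diag_op_def cinner_unitary_inv)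

lemma orthonormal_basis_unitary: "unitary U \<Longrightarrow> orthonormal_basis b \<Longrightarrow> orthonormal_basis (U \<circ> b)"
  unfolding orthonormal_basis_def
  by (auto simp: cinner_unitary) (metis cinner_unitary_inv unitary_inv_apply(1) unitary_zero)

lemma diag_op_basis: "orthonormal_basis b \<Longrightarrow> (b l, of_real (v l) *\<^sub>C b l) \<in> diag_op b v"
  by (auto simp: diag_op_def cinner_scaleC_right orthonormal_basisD(1))

text \<open>Two eigenbases of one operator mix only vectors of equal eigenvalue, so a function of the
  operator does not depend on the basis.\<close>

lemma diag_op_fun_subset:
  assumes b: "orthonormal_basis b" and eq: "diag_op b E = diag_op b' E'"
  shows "diag_op b (\<lambda>k. f (E k)) \<subseteq> diag_op b' (\<lambda>k. f (E' k))"
proof (clarsimp simp: diag_op_def)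
  fix x y k
  assume xy: "\<forall>l. cinner (b l) y = of_real (f (E l)) * cinner (b l) x"
  have "cinner (b' k) (b l) * cinner (b l) y = of_real (f (E' k)) * (cinner (b' k) (b l) * cinner (b l) x)" for l
  proof (cases "E l = E' k")
    case False
    have "(b l, of_real (E l) *\<^sub>C b l) \<in> diag_op b' E'" using diag_op_basis[OF b] eq by blast
    then have "cinner (b' k) (b l) = 0" using False by (auto simp: diag_op_def cinner_scaleC_right)
    then show ?thesis by simp
  qed (simp add: xy)
  then have "((\<lambda>l. of_real (f (E' k)) * (cinner (b' k) (b l) * cinner (b l) x)) has_sum cinner (b' k) y) UNIV"
    using Parseval_identity[OF b, of "b' k" y] by (simp only:)
  moreover have "((\<lambda>l. of_real (f (E' k)) * (cinner (b' k) (b l) * cinner (b l) x)) has_sum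
      of_real (f (E' k)) * cinner (b' k) x) UNIV"
    by (intro has_sum_cmult_right Parseval_identity[OF b])
  ultimately show "cinner (b' k) y = of_real (f (E' k)) * cinner (b' k) x"
    using has_sum_unique by blast
qed

text \<open>\<open>U \<circ> b\<close> is a second eigenbasis of \<open>H\<close> with the same
  energies, so the Boltzmann operator built from it is the same; the normalisation is a
  scalar.\<close>

lemma conj_gibbs_state:
  fixes H :: "'a op"
  assumes U: "unitary U" and inv: "conj_op U H = H" and g: "gibbs_state kB temp H \<rho>"
  shows "conj_op U \<rho> = \<rho>"
proof -
  obtain b :: "'a \<Rightarrow> 'a ell2" and E X where b: "orthonormal_basis b" and H: "H = diag_op b E"
    and X: "X = diag_op b (\<lambda>k. exp (- E k / (kB * temp)))" and \<rho>: "\<rho> = (1 / op_trace X) \<odot> X"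
    using g unfolding gibbs_state_def by blast
  have eq: "diag_op b E = diag_op (U \<circ> b) E" using inv by (simp add: H conj_diag_op[OF U])
  have "conj_op U X = X"
    unfolding X conj_diag_op[OF U]
    using diag_op_fun_subset[OF b eq, of "\<lambda>e. exp (- e / (kB * temp))"]
      diag_op_fun_subset[OF orthonormal_basis_unitary[OF U b] eq[symmetric], of "\<lambda>e. exp (- e / (kB * temp))"]
    by blast
  then show ?thesis by (simp add: \<rho> conj_op_scale[OF U])
qed

text \<open>The trace does not see the conjugation but does see the sign, so \<open>r = -1\<close>
  forces a zero trace: this is how a balanced state loses its CP-odd moments.\<close>

lemma op_trace_parity:
  assumes "unitary U" "conj_op U A = of_real r \<odot> A" "r \<in> {1, - 1}"
  shows "of_real r * op_trace A = op_trace A"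
  using op_trace_conj[OF assms(1), of A] op_trace_scale[of "of_real r" A] assms(2,3) by auto

lemma conj_correlation:
  assumes U: "unitary U" and H: "self_adjoint H" "conj_op U H = H"
  shows "conj_op U (V \<cdot> conj_op (propagator hbar H \<tau>) W \<cdot> \<rho>) =
    conj_op U V \<cdot> conj_op (propagator hbar H \<tau>) (conj_op U W) \<cdot> conj_op U \<rho>"
  by (simp add: conj_op_times[OF U] propagator_commute[OF H(1) U H(2)] flip: conj_op_comp)

lemma scaled_correlation:
  assumes H: "self_adjoint H" and V: "homogeneous V" and "b \<noteq> 0"
  shows "(a \<odot> V) \<cdot> conj_op (propagator hbar H \<tau>) (b \<odot> W) \<cdot> \<rho> =
    (a * b) \<odot> (V \<cdot> conj_op (propagator hbar H \<tau>) W \<cdot> \<rho>)"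
  using assms by (simp add: conj_op_scale unitary_propagator op_times_scale op_scale_times op_scale_scale)

lemma equilibrated_bath_no_bias:
  assumes S: "sector_ok S" and B: "sector_ok B" and K: "coupling_ok S B K"
    and g: "gibbs_state kB temp (ham B) \<rho>"
  shows "apparently_cp_invariant (cp S) (redfield_bath hbar S B K \<rho>)"
  unfolding redfield_bath_def
proof (rule apparently_cp_invariantI)
  have B': "self_adjoint (ham B)" "unitary (cp B)" "conj_op (cp B) (ham B) = ham B"
    and S': "unitary (cp S)" "conj_op (cp S) (ham S) = ham S"
    using S B by (simp_all add: sector_ok_def cp_cpt_invariant_def)
  show "unitary (cp S)" "conj_op (cp S) (ham S) = ham S" by fact+
  have K': "self_adjoint (sys_op K j)" "self_adjoint (bath_op K j)" "parity K j \<in> {1, -1}"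
    "conj_op (cp S) (sys_op K j) = of_real (parity K j) \<odot> sys_op K j"
    "conj_op (cp B) (bath_op K j) = of_real (parity K j) \<odot> bath_op K j" if "j < num K" for j
    using K that by (simp_all add: coupling_ok_def)
  show "self_adjoint (sys_op K j) \<and> parity K j \<in> {1, -1} \<and>
      conj_op (cp S) (sys_op K j) = of_real (parity K j) \<odot> sys_op K j" if "j < num K" for j
    using K'[OF that] by blast
  have \<rho>: "conj_op (cp B) \<rho> = \<rho>" by (rule conj_gibbs_state[OF B'(2,3) g])
  show mean: "of_real (parity K j) * bath_mean K \<rho> j = bath_mean K \<rho> j" if "j < num K" for j
    unfolding bath_mean_def using K'[OF that]
    by (intro op_trace_parity[OF B'(2)]) (simp_all add: conj_op_times[OF B'(2)] \<rho> op_scale_times)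
  show "of_real (parity K j * parity K l) * corr hbar (ham B) (bath_op K) (bath_mean K \<rho>) \<rho> j l \<tau> =
      corr hbar (ham B) (bath_op K) (bath_mean K \<rho>) \<rho> j l \<tau>" if jl: "j < num K" "l < num K" for j l \<tau>
  proof -
    have [simp]: "parity K l \<noteq> 0" using K'(3)[OF jl(2)] by auto
    have "of_real (parity K j * parity K l) *
        op_trace (bath_op K j \<cdot> conj_op (propagator hbar (ham B) \<tau>) (bath_op K l) \<cdot> \<rho>) =
        op_trace (bath_op K j \<cdot> conj_op (propagator hbar (ham B) \<tau>) (bath_op K l) \<cdot> \<rho>)"
    proof (rule op_trace_parity[OF B'(2)])
      show "parity K j * parity K l \<in> {1, -1}" using K'(3)[OF jl(1)] K'(3)[OF jl(2)] by auto
    qed (simp add: conj_correlation[OF B'(2,1,3)] K'(5) jl \<rho>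
        scaled_correlation[OF B'(1) self_adjoint_homogeneous[OF K'(2)]])
    moreover have "of_real (parity K j * parity K l) * (bath_mean K \<rho> j * bath_mean K \<rho> l) =
        bath_mean K \<rho> j * bath_mean K \<rho> l"
      by (subst (3 4) mean[symmetric]) (simp_all add: jl mult_ac)
    ultimately show ?thesis by (simp only: corr_def right_diff_distrib)
  qed
qed

section \<open>Tensor products\<close>

lemma summable_amp_times: "(\<lambda>(i, j). (cmod (amp z (i, j)))\<^sup>2) summable_on UNIV \<times> UNIV"
  using summable_amp[of z] by (simp add: case_prod_unfold)

lemma amp_slice1 [simp]: "amp (slice1 z j) i = amp z (i, j)"
proof -
  have "(\<lambda>(j, i). (cmod (amp z (i, j)))\<^sup>2) summable_on UNIV \<times> UNIV"
    using summable_on_swap[THEN iffD1, OF summable_amp_times[of z]] by (simp add: case_prod_unfold)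
  from summable_on_SigmaD1[of "\<lambda>j i. (cmod (amp z (i, j)))\<^sup>2" UNIV "\<lambda>_. UNIV", OF this]
  show ?thesis unfolding slice1_def by (subst amp_Abs) auto
qed

lemma amp_slice2 [simp]: "amp (slice2 z i) j = amp z (i, j)"
  using summable_on_SigmaD1[of "\<lambda>i j. (cmod (amp z (i, j)))\<^sup>2" UNIV "\<lambda>_. UNIV", OF summable_amp_times]
  unfolding slice2_def by (subst amp_Abs) auto

text \<open>Fubini for the squared moduli: the product space is the direct sum of its slices. Norms
  of slicewise maps are computed from this.\<close>

lemma slice1_has_sum: "((\<lambda>j. (norm (slice1 z j))\<^sup>2) has_sum (norm z)\<^sup>2) UNIV"
proof -
  have "((\<lambda>x. (cmod (amp z x))\<^sup>2) has_sum (norm z)\<^sup>2) (UNIV \<times> UNIV)"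
    unfolding norm_sq_ell2 using has_sum_infsum[OF summable_amp[of z]] by simp
  from has_sum_SigmaD[OF has_sum_swap[THEN iffD1, OF this], of "\<lambda>j. (norm (slice1 z j))\<^sup>2"]
  show ?thesis
    using has_sum_infsum[OF summable_amp[of "slice1 z _"]] by (simp add: norm_sq_ell2)
qed

lemma slice2_has_sum: "((\<lambda>i. (norm (slice2 z i))\<^sup>2) has_sum (norm z)\<^sup>2) UNIV"
proof -
  have "((\<lambda>x. (cmod (amp z x))\<^sup>2) has_sum (norm z)\<^sup>2) (UNIV \<times> UNIV)"
    unfolding norm_sq_ell2 using has_sum_infsum[OF summable_amp[of z]] by simp
  from has_sum_SigmaD[OF this, of "\<lambda>i. (norm (slice2 z i))\<^sup>2"]
  show ?thesis
    using has_sum_infsum[OF summable_amp[of "slice2 z _"]] by (simp add: norm_sq_ell2)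
qed

lemma norm_slice2_le: "norm (slice2 z i) \<le> norm z"
proof -
  have "(\<Sum>i\<in>{i}. (norm (slice2 z i))\<^sup>2) \<le> (norm z)\<^sup>2"
    by (rule finite_sum_le_has_sum[OF slice2_has_sum]) auto
  then show ?thesis by (simp add: power2_le_iff_abs_le)
qed

lemma slice1_plus: "slice1 (x + y) j = slice1 x j + slice1 y j"
  and slice1_scaleC: "slice1 (c *\<^sub>C x) j = c *\<^sub>C slice1 x j"
  and slice2_plus: "slice2 (x + y) i = slice2 x i + slice2 y i"
  and slice2_scaleC: "slice2 (c *\<^sub>C x) i = c *\<^sub>C slice2 x i"
  by (auto intro!: ell2_eqI simp: amp_ops)

lemma slice1_ext: "(\<And>j. slice1 x j = slice1 y j) \<Longrightarrow> x = y"
  and slice2_ext: "(\<And>i. slice2 x i = slice2 y i) \<Longrightarrow> x = y"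
  by (auto intro!: ell2_eqI) (metis amp_slice1 amp_slice2 surj_pair)+

lemma summable_sq_times:
  assumes "(\<lambda>i. (norm (g i))\<^sup>2) summable_on UNIV"
  shows "(\<lambda>(i, j). (cmod (amp (g i) j))\<^sup>2) summable_on UNIV \<times> UNIV"
proof (rule summable_on_SigmaI)
  show "((\<lambda>j. (\<lambda>(i, j). (cmod (amp (g i) j))\<^sup>2) (i, j)) has_sum (norm (g i))\<^sup>2) UNIV" for i
    using has_sum_infsum[OF summable_amp[of "g i"]] by (simp add: norm_sq_ell2)
qed (use assms in auto)

text \<open>\<open>map1\<close> is built with \<open>Abs_ell2\<close>, whose argument must be square
  summable; norm preservation by \<open>f\<close> on each slice provides this. The form covers
  antilinear maps as well.\<close>

lemma slice1_map1:
  assumes "\<And>x. norm (f x) = norm x" shows "slice1 (map1 f z) j = f (slice1 z j)"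
proof -
  have "(\<lambda>j. (norm (f (slice1 z j)))\<^sup>2) summable_on UNIV"
    using slice1_has_sum[of z] by (auto simp: assms summable_on_def)
  from summable_sq_times[OF this] have "(\<lambda>(i, j). (cmod (amp (f (slice1 z j)) i))\<^sup>2) summable_on UNIV \<times> UNIV"
    by (subst summable_on_swap) (simp add: case_prod_unfold)
  then show ?thesis
    unfolding map1_def by (intro ell2_eqI) (subst amp_slice1, subst amp_Abs, auto simp: case_prod_unfold)
qed

lemma slice2_map2:
  assumes "\<And>x. norm (f x) = norm x" shows "slice2 (map2 f z) i = f (slice2 z i)"
proof -
  have "(\<lambda>i. (norm (f (slice2 z i)))\<^sup>2) summable_on UNIV"
    using slice2_has_sum[of z] by (auto simp: assms summable_on_def)
  from summable_sq_times[OF this] show ?thesis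
    unfolding map2_def by (intro ell2_eqI) (subst amp_slice2, subst amp_Abs, auto simp: case_prod_unfold)
qed

lemma norm_map1: assumes "\<And>x. norm (f x) = norm x" shows "norm (map1 f z) = norm z"
proof -
  have "(norm (map1 f z))\<^sup>2 = (norm z)\<^sup>2"
    using has_sum_unique[OF slice1_has_sum[of "map1 f z"]] slice1_has_sum[of z]
    by (simp add: slice1_map1 assms)
  then show ?thesis by (simp add: power2_eq_iff_nonneg)
qed

lemma norm_map2: assumes "\<And>x. norm (f x) = norm x" shows "norm (map2 f z) = norm z"
proof -
  have "(norm (map2 f z))\<^sup>2 = (norm z)\<^sup>2"
    using has_sum_unique[OF slice2_has_sum[of "map2 f z"]] slice2_has_sum[of z]
    by (simp add: slice2_map2 assms)
  then show ?thesis by (simp add: power2_eq_iff_nonneg)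
qed

lemma map1_inv: "unitary U \<Longrightarrow> map1 U (map1 (inv U) z) = z" "unitary U \<Longrightarrow> map1 (inv U) (map1 U z) = z"
  by (auto intro!: slice1_ext simp: slice1_map1 norm_unitary unitary_inv)

lemma map2_inv: "unitary U \<Longrightarrow> map2 U (map2 (inv U) z) = z" "unitary U \<Longrightarrow> map2 (inv U) (map2 U z) = z"
  by (auto intro!: slice2_ext simp: slice2_map2 norm_unitary unitary_inv)

lemma unitary_map1: assumes U: "unitary U" shows "unitary (map1 U)"
  unfolding unitary_def
proof (intro conjI allI)
  note [simp] = slice1_map1[OF norm_unitary[OF U]]
  show "map1 U (x + y) = map1 U x + map1 U y" for x y
    by (rule slice1_ext) (simp add: slice1_plus unitary_add[OF U])
  show "map1 U (c *\<^sub>C x) = c *\<^sub>C map1 U x" for c x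
    by (rule slice1_ext) (simp add: slice1_scaleC unitary_scaleC[OF U])
  show "norm (map1 U x) = norm x" for x by (rule norm_map1[OF norm_unitary[OF U]])
  show "surj (map1 U)" by (rule surjI[of _ "map1 (inv U)"]) (rule map1_inv[OF U])
qed

lemma unitary_map2: assumes U: "unitary U" shows "unitary (map2 U)"
  unfolding unitary_def
proof (intro conjI allI)
  note [simp] = slice2_map2[OF norm_unitary[OF U]]
  show "map2 U (x + y) = map2 U x + map2 U y" for x y
    by (rule slice2_ext) (simp add: slice2_plus unitary_add[OF U])
  show "map2 U (c *\<^sub>C x) = c *\<^sub>C map2 U x" for c x
    by (rule slice2_ext) (simp add: slice2_scaleC unitary_scaleC[OF U])
  show "norm (map2 U x) = norm x" for x by (rule norm_map2[OF norm_unitary[OF U]])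
  show "surj (map2 U)" by (rule surjI[of _ "map2 (inv U)"]) (rule map2_inv[OF U])
qed

lemma unitary_tensor: "unitary U \<Longrightarrow> unitary V \<Longrightarrow> unitary (tensor_unitary U V)"
  unfolding tensor_unitary_def by (intro unitary_comp unitary_map1 unitary_map2)

lemma amp_tensor [simp]: "amp (x \<otimes> y) (i, j) = amp x i * amp y j"
proof -
  have "(\<lambda>i. (norm (amp x i *\<^sub>C y))\<^sup>2) summable_on UNIV"
    using summable_on_cmult_left[OF summable_amp[of x], of "(norm y)\<^sup>2"]
    by (simp add: norm_scaleC power_mult_distrib)
  from summable_sq_times[OF this] show ?thesis
    unfolding tensor_def by (subst amp_Abs) (auto simp: case_prod_unfold)
qed

lemma slice1_tensor [simp]: "slice1 (x \<otimes> y) j = amp y j *\<^sub>C x"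
  and slice2_tensor [simp]: "slice2 (x \<otimes> y) i = amp x i *\<^sub>C y"
  by (auto intro!: ell2_eqI simp: mult.commute)

lemma tensor_unitary_tensor:
  assumes U: "unitary U" and V: "unitary V" shows "tensor_unitary U V (x \<otimes> y) = U x \<otimes> V y"
proof -
  have "map2 V (x \<otimes> y) = x \<otimes> V y"
    by (rule slice2_ext) (simp add: slice2_map2 norm_unitary V unitary_scaleC)
  moreover have "map1 U (x \<otimes> V y) = U x \<otimes> V y"
    by (rule slice1_ext) (simp add: slice1_map1 norm_unitary U unitary_scaleC)
  ultimately show ?thesis by (simp add: tensor_unitary_def)
qed

text \<open>Adjoints of \<open>x \<otimes> _\<close> and \<open>_ \<otimes> y\<close>.\<close>

definition contract1 :: "'a ell2 \<Rightarrow> ('a \<times> 'b) ell2 \<Rightarrow> 'b ell2" where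
  "contract1 x z = Abs_ell2 (\<lambda>j. cinner x (slice1 z j))"

definition contract2 :: "'b ell2 \<Rightarrow> ('a \<times> 'b) ell2 \<Rightarrow> 'a ell2" where
  "contract2 y z = Abs_ell2 (\<lambda>i. cinner y (slice2 z i))"

lemma amp_contract1: "amp (contract1 x z) j = cinner x (slice1 z j)"
  and norm_contract1: "norm (contract1 x z) \<le> norm x * norm z"
proof -
  have le: "(cmod (cinner x (slice1 z j)))\<^sup>2 \<le> (norm x)\<^sup>2 * (norm (slice1 z j))\<^sup>2" for j
    unfolding power_mult_distrib[symmetric] by (intro power_mono cinner_Cauchy_Schwarz) simp
  have sum: "((\<lambda>j. (norm x)\<^sup>2 * (norm (slice1 z j))\<^sup>2) has_sum (norm x)\<^sup>2 * (norm z)\<^sup>2) UNIV"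
    by (intro has_sum_cmult_right slice1_has_sum)
  have "(\<lambda>j. (cmod (cinner x (slice1 z j)))\<^sup>2) summable_on UNIV"
    by (rule summable_on_comparison_test[of "\<lambda>j. (norm x)\<^sup>2 * (norm (slice1 z j))\<^sup>2"])
       (use le sum in \<open>auto simp: summable_on_def\<close>)
  then show amp: "amp (contract1 x z) j = cinner x (slice1 z j)" for j
    unfolding contract1_def by (subst amp_Abs) auto
  have "(norm (contract1 x z))\<^sup>2 \<le> (norm x * norm z)\<^sup>2"
    unfolding power_mult_distrib norm_sq_ell2[of "contract1 x z"]
    by (rule has_sum_mono[OF has_sum_infsum[OF summable_amp] sum]) (simp add: amp le)
  then show "norm (contract1 x z) \<le> norm x * norm z" by (simp add: power2_le_iff_abs_le)
qed

lemma amp_contract2: "amp (contract2 y z) i = cinner y (slice2 z i)"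
  and norm_contract2: "norm (contract2 y z) \<le> norm y * norm z"
proof -
  have le: "(cmod (cinner y (slice2 z i)))\<^sup>2 \<le> (norm y)\<^sup>2 * (norm (slice2 z i))\<^sup>2" for i
    unfolding power_mult_distrib[symmetric] by (intro power_mono cinner_Cauchy_Schwarz) simp
  have sum: "((\<lambda>i. (norm y)\<^sup>2 * (norm (slice2 z i))\<^sup>2) has_sum (norm y)\<^sup>2 * (norm z)\<^sup>2) UNIV"
    by (intro has_sum_cmult_right slice2_has_sum)
  have "(\<lambda>i. (cmod (cinner y (slice2 z i)))\<^sup>2) summable_on UNIV"
    by (rule summable_on_comparison_test[of "\<lambda>i. (norm y)\<^sup>2 * (norm (slice2 z i))\<^sup>2"])
       (use le sum in \<open>auto simp: summable_on_def\<close>)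
  then show amp: "amp (contract2 y z) i = cinner y (slice2 z i)" for i
    unfolding contract2_def by (subst amp_Abs) auto
  have "(norm (contract2 y z))\<^sup>2 \<le> (norm y * norm z)\<^sup>2"
    unfolding power_mult_distrib norm_sq_ell2[of "contract2 y z"]
    by (rule has_sum_mono[OF has_sum_infsum[OF summable_amp] sum]) (simp add: amp le)
  then show "norm (contract2 y z) \<le> norm y * norm z" by (simp add: power2_le_iff_abs_le)
qed

lemma cinner_tensor_contract2: "cinner (x \<otimes> y) z = cinner x (contract2 y z)"
proof -
  have "((\<lambda>p. cnj (amp (x \<otimes> y) p) * amp z p) has_sum cinner (x \<otimes> y) z) (UNIV \<times> UNIV)"
    unfolding cinner_def using has_sum_infsum[OF summable_cinner[of "x \<otimes> y" z]] by simp
  then have "((\<lambda>i. cnj (amp x i) * cinner y (slice2 z i)) has_sum cinner (x \<otimes> y) z) UNIV"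
  proof (rule has_sum_SigmaD)
    fix i
    show "((\<lambda>j. cnj (amp (x \<otimes> y) (i, j)) * amp z (i, j)) has_sum cnj (amp x i) * cinner y (slice2 z i)) UNIV"
      using has_sum_cmult_right[OF has_sum_infsum[OF summable_cinner[of y "slice2 z i"]], of "cnj (amp x i)"]
      by (simp add: cinner_def mult.assoc)
  qed
  then show ?thesis unfolding cinner_def[of x] by (simp add: amp_contract2 infsumI)
qed

lemma cinner_tensor_contract1: "cinner (x \<otimes> y) z = cinner y (contract1 x z)"
proof -
  have "((\<lambda>p. cnj (amp (x \<otimes> y) p) * amp z p) has_sum cinner (x \<otimes> y) z) (UNIV \<times> UNIV)"
    unfolding cinner_def using has_sum_infsum[OF summable_cinner[of "x \<otimes> y" z]] by simp
  then have "((\<lambda>(j, i). cnj (amp (x \<otimes> y) (i, j)) * amp z (i, j)) has_sum cinner (x \<otimes> y) z) (UNIV \<times> UNIV)"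
    by (subst (asm) has_sum_swap)
  then have "((\<lambda>j. cnj (amp y j) * cinner x (slice1 z j)) has_sum cinner (x \<otimes> y) z) UNIV"
  proof (rule has_sum_SigmaD)
    fix j
    show "((\<lambda>i. (\<lambda>(j, i). cnj (amp (x \<otimes> y) (i, j)) * amp z (i, j)) (j, i)) has_sum
        cnj (amp y j) * cinner x (slice1 z j)) UNIV"
      using has_sum_cmult_right[OF has_sum_infsum[OF summable_cinner[of x "slice1 z j"]], of "cnj (amp y j)"]
      by (simp add: cinner_def mult_ac)
  qed
  then show ?thesis unfolding cinner_def[of y] by (simp add: amp_contract1 infsumI)
qed

lemma contract1_unitary:
  assumes U: "unitary U" and V: "unitary V"
  shows "contract1 (U x) (tensor_unitary U V z) = V (contract1 x z)"
proof (rule cinner_ext)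
  fix w
  have "cinner w (contract1 (U x) (tensor_unitary U V z)) = cinner (U x \<otimes> V (inv V w)) (tensor_unitary U V z)"
    using V by (simp add: cinner_tensor_contract1)
  also have "\<dots> = cinner (x \<otimes> inv V w) z"
    by (simp add: cinner_unitary[OF unitary_tensor[OF U V]] flip: tensor_unitary_tensor[OF U V])
  also have "\<dots> = cinner w (V (contract1 x z))"
    using cinner_unitary[OF V, of "inv V w"] V by (simp add: cinner_tensor_contract1)
  finally show "cinner w (contract1 (U x) (tensor_unitary U V z)) = cinner w (V (contract1 x z))" .
qed

lemma contract2_unitary:
  assumes U: "unitary U" and V: "unitary V"
  shows "contract2 (V y) (tensor_unitary U V z) = U (contract2 y z)"
proof (rule cinner_ext)
  fix w
  have "cinner w (contract2 (V y) (tensor_unitary U V z)) = cinner (U (inv U w) \<otimes> V y) (tensor_unitary U V z)"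
    using U by (simp add: cinner_tensor_contract2)
  also have "\<dots> = cinner (inv U w \<otimes> y) z"
    by (simp add: cinner_unitary[OF unitary_tensor[OF U V]] flip: tensor_unitary_tensor[OF U V])
  also have "\<dots> = cinner w (U (contract2 y z))"
    using cinner_unitary[OF U, of "inv U w"] U by (simp add: cinner_tensor_contract2)
  finally show "cinner w (contract2 (V y) (tensor_unitary U V z)) = cinner w (U (contract2 y z))" .
qed

section \<open>Operators on one tensor factor under local unitaries\<close>

lemma cinner_commute_eq: "cinner x v = cinner y u \<longleftrightarrow> cinner v x = cinner u y"
  by (subst cinner_commute[of x], subst cinner_commute[of y]) simp

lemma ell2_eq_iff: "x = y \<longleftrightarrow> (\<forall>i. amp x i = amp y i)"
  by (auto intro: ell2_eqI)

text \<open>\<open>ext1\<close> looks at slices along \<open>ket\<close>, which a unitary on the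
  other factor mixes. Testing against all pairs in the self-adjoint \<open>A\<close> replaces the
  slices by contractions, and these transform well under any product of unitaries.\<close>

lemma ext1_iff_contract:
  assumes "self_adjoint A"
  shows "(x, y) \<in> ext1 A \<longleftrightarrow> (\<forall>u v. (u, v) \<in> A \<longrightarrow> contract1 v x = contract1 u y)"
proof -
  have "(x, y) \<in> ext1 A \<longleftrightarrow> (\<forall>j. (slice1 x j, slice1 y j) \<in> adj_op A)"
    using assms by (simp add: ext1_def self_adjoint_def)
  also have "\<dots> \<longleftrightarrow> (\<forall>u v. (u, v) \<in> A \<longrightarrow> (\<forall>j. cinner (slice1 x j) v = cinner (slice1 y j) u))"
    unfolding adj_op_iff by blast
  also have "\<dots> \<longleftrightarrow> (\<forall>u v. (u, v) \<in> A \<longrightarrow> (\<forall>j. cinner v (slice1 x j) = cinner u (slice1 y j)))"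
    by (intro all_cong1 imp_cong[OF refl] cinner_commute_eq)
  also have "\<dots> \<longleftrightarrow> (\<forall>u v. (u, v) \<in> A \<longrightarrow> contract1 v x = contract1 u y)"
    by (simp only: ell2_eq_iff[of "contract1 _ _"] amp_contract1)
  finally show ?thesis .
qed

lemma ext2_iff_contract:
  assumes "self_adjoint A"
  shows "(x, y) \<in> ext2 A \<longleftrightarrow> (\<forall>u v. (u, v) \<in> A \<longrightarrow> contract2 v x = contract2 u y)"
proof -
  have "(x, y) \<in> ext2 A \<longleftrightarrow> (\<forall>i. (slice2 x i, slice2 y i) \<in> adj_op A)"
    using assms by (simp add: ext2_def self_adjoint_def)
  also have "\<dots> \<longleftrightarrow> (\<forall>u v. (u, v) \<in> A \<longrightarrow> (\<forall>i. cinner (slice2 x i) v = cinner (slice2 y i) u))"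
    unfolding adj_op_iff by blast
  also have "\<dots> \<longleftrightarrow> (\<forall>u v. (u, v) \<in> A \<longrightarrow> (\<forall>i. cinner v (slice2 x i) = cinner u (slice2 y i)))"
    by (intro all_cong1 imp_cong[OF refl] cinner_commute_eq)
  also have "\<dots> \<longleftrightarrow> (\<forall>u v. (u, v) \<in> A \<longrightarrow> contract2 v x = contract2 u y)"
    by (simp only: ell2_eq_iff[of "contract2 _ _"] amp_contract2)
  finally show ?thesis .
qed

lemma conj_adj_op:
  assumes U: "unitary U" shows "conj_op U (adj_op A) = adj_op (conj_op U A)"
proof (rule set_eqI, clarify)
  fix x y
  have "(\<forall>u v. (u, v) \<in> A \<longrightarrow> cinner (inv U x) v = cinner (inv U y) u) \<longleftrightarrow>
      (\<forall>u v. (inv U u, inv U v) \<in> A \<longrightarrow> cinner x v = cinner y u)"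
    (is "_ \<longleftrightarrow> ?R")
  proof -
    have "?R \<longleftrightarrow> (\<forall>u v. (inv U u, inv U v) \<in> A \<longrightarrow> cinner (inv U x) (inv U v) = cinner (inv U y) (inv U u))"
      by (simp only: cinner_unitary[OF unitary_inv[OF U]])
    then show ?thesis by (metis unitary_inv_apply(2)[OF U])
  qed
  then show "(x, y) \<in> conj_op U (adj_op A) \<longleftrightarrow> (x, y) \<in> adj_op (conj_op U A)"
    by (simp add: conj_op_inv_iff[OF U] adj_op_iff)
qed

lemma closure_unitary_image:
  assumes U: "unitary U" shows "closure (U ` X) = U ` closure X"
proof
  have sub: "V ` closure X \<subseteq> closure (V ` X)" if "unitary V" for V :: "'a ell2 \<Rightarrow> 'a ell2" and X
    by (rule image_closure_subset) (auto simp: closure_subset[THEN subsetD]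
        intro: linear_continuous_on bounded_linear_unitary that)
  show "U ` closure X \<subseteq> closure (U ` X)" by (rule sub[OF U])
  have "inv U ` closure (U ` X) \<subseteq> closure X"
    using sub[OF unitary_inv[OF U], of "U ` X"] by (simp add: image_image U)
  then have "U ` inv U ` closure (U ` X) \<subseteq> U ` closure X" by (rule image_mono)
  then show "closure (U ` X) \<subseteq> U ` closure X" by (simp add: image_image U)
qed

lemma self_adjoint_conj:
  assumes U: "unitary U" and A: "self_adjoint A" shows "self_adjoint (conj_op U A)"
proof -
  have "Domain (conj_op U A) = U ` Domain A" unfolding conj_op_def by auto
  then show ?thesis
    using A by (simp add: self_adjoint_def closure_unitary_image[OF U] surj_unitary[OF U]
        flip: conj_adj_op[OF U])
qed

text \<open>In contraction form \<open>V\<close> acts on both sides of each equation and cancels,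
  and \<open>U\<close> only moves the test pairs from \<open>A\<close> to its conjugate.\<close>

lemma conj_tensor_ext1:
  assumes U: "unitary U" and V: "unitary V" and A: "self_adjoint A"
  shows "conj_op (tensor_unitary U V) (ext1 A) = ext1 (conj_op U A)"
proof (rule set_eqI, clarify)
  fix x y
  let ?T = "tensor_unitary U V"
  have T: "unitary ?T" by (rule unitary_tensor[OF U V])
  define x' y' where "x' = inv ?T x" and "y' = inv ?T y"
  have xy: "x = ?T x'" "y = ?T y'" by (simp_all add: x'_def y'_def T)
  have "(\<forall>u v. (u, v) \<in> A \<longrightarrow> contract1 v x' = contract1 u y') \<longleftrightarrow>
      (\<forall>u v. (u, v) \<in> A \<longrightarrow> contract1 (U v) x = contract1 (U u) y)"
    unfolding xy contract1_unitary[OF U V] by (simp only: inj_eq[OF inj_unitary[OF V]])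
  also have "\<dots> \<longleftrightarrow> (\<forall>u v. (u, v) \<in> conj_op U A \<longrightarrow> contract1 v x = contract1 u y)"
    unfolding conj_op_def by blast
  finally show "(x, y) \<in> conj_op ?T (ext1 A) \<longleftrightarrow> (x, y) \<in> ext1 (conj_op U A)"
    by (simp add: conj_op_inv_iff[OF T] ext1_iff_contract A self_adjoint_conj U flip: x'_def y'_def)
qed

lemma conj_tensor_ext2:
  assumes U: "unitary U" and V: "unitary V" and A: "self_adjoint A"
  shows "conj_op (tensor_unitary U V) (ext2 A) = ext2 (conj_op V A)"
proof (rule set_eqI, clarify)
  fix x y
  let ?T = "tensor_unitary U V"
  have T: "unitary ?T" by (rule unitary_tensor[OF U V])
  define x' y' where "x' = inv ?T x" and "y' = inv ?T y"
  have xy: "x = ?T x'" "y = ?T y'" by (simp_all add: x'_def y'_def T)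
  have "(\<forall>u v. (u, v) \<in> A \<longrightarrow> contract2 v x' = contract2 u y') \<longleftrightarrow>
      (\<forall>u v. (u, v) \<in> A \<longrightarrow> contract2 (V v) x = contract2 (V u) y)"
    unfolding xy contract2_unitary[OF U V] by (simp only: inj_eq[OF inj_unitary[OF U]])
  also have "\<dots> \<longleftrightarrow> (\<forall>u v. (u, v) \<in> conj_op V A \<longrightarrow> contract2 v x = contract2 u y)"
    unfolding conj_op_def by blast
  finally show "(x, y) \<in> conj_op ?T (ext2 A) \<longleftrightarrow> (x, y) \<in> ext2 (conj_op V A)"
    by (simp add: conj_op_inv_iff[OF T] ext2_iff_contract A self_adjoint_conj V flip: x'_def y'_def)
qed

lemma conj_op_closure:
  assumes U: "unitary U" shows "conj_op U (closure A) = closure (conj_op U A)"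
proof -
  have sub: "conj_op V (closure B) \<subseteq> closure (conj_op V B)" if V: "unitary V" for V :: "'a ell2 \<Rightarrow> 'a ell2" and B
  proof -
    have img: "conj_op V C = (\<lambda>p. (V (fst p), V (snd p))) ` C" for C unfolding conj_op_def by force
    have V': "continuous_on UNIV V" by (rule linear_continuous_on[OF bounded_linear_unitary[OF V]])
    have "continuous_on (closure B) (\<lambda>p. (V (fst p), V (snd p)))"
      by (intro continuous_on_Pair continuous_on_compose2[OF V'] continuous_intros) auto
    then show ?thesis unfolding img by (rule image_closure_subset) (simp_all add: closure_subset)
  qed
  have "conj_op (inv U) (closure (conj_op U A)) \<subseteq> closure A"
    using sub[OF unitary_inv[OF U], of "conj_op U A"] U by simp
  then have "conj_op U (conj_op (inv U) (closure (conj_op U A))) \<subseteq> conj_op U (closure A)"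
    unfolding conj_op_def by blast
  then show ?thesis using sub[OF U, of A] U by auto
qed

text \<open>A rank-one term |a><b| contributes \<open>contract2 (contract1 x b) a\<close>, free of
  the basis \<open>ket\<close> over which \<open>ptrace2\<close> sums. Nuclearity justifies
  exchanging that sum with the series.\<close>

lemma ptrace2_nuclear:
  assumes s: "summable (\<lambda>n. norm (\<alpha> n) * norm (\<beta> n))"
  shows "(x, y) \<in> ptrace2 (nuclear_op \<alpha> \<beta>) \<longleftrightarrow> y = (\<Sum>n. contract2 (contract1 x (\<beta> n)) (\<alpha> n))"
    and "summable (\<lambda>n. contract2 (contract1 x (\<beta> n)) (\<alpha> n))"
proof -
  have bound: "norm (contract1 x (\<beta> n)) * norm z \<le> norm x * (norm (\<alpha> n) * norm (\<beta> n))"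
    if "norm z \<le> norm (\<alpha> n)" for z :: "'c ell2" and n
    using mult_mono[OF norm_contract1[of x "\<beta> n"] that] by (simp add: mult_ac)
  show sum: "summable (\<lambda>n. contract2 (contract1 x (\<beta> n)) (\<alpha> n))"
  proof (rule summable_comparison_test[OF _ summable_mult[OF s, of "norm x"]], intro exI allI impI)
    fix n
    show "norm (contract2 (contract1 x (\<beta> n)) (\<alpha> n)) \<le> norm x * (norm (\<alpha> n) * norm (\<beta> n))"
      using order_trans[OF norm_contract2[of "contract1 x (\<beta> n)" "\<alpha> n"]
          mult_right_mono[OF norm_contract1[of x "\<beta> n"] norm_ge_zero[of "\<alpha> n"]]]
      by (simp add: mult_ac)
  qed
  have "((\<lambda>j. amp (app (nuclear_op \<alpha> \<beta>) (x \<otimes> ket j)) (i, j)) has_sum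
      amp (\<Sum>n. contract2 (contract1 x (\<beta> n)) (\<alpha> n)) i) UNIV" for i
  proof -
    have eq1: "amp (app (nuclear_op \<alpha> \<beta>) (x \<otimes> ket j)) (i, j) =
        (\<Sum>n. cnj (amp (contract1 x (\<beta> n)) j) * amp (slice2 (\<alpha> n) i) j)" for j
    proof -
      have "cinner (\<beta> n) (x \<otimes> ket j) = cnj (amp (contract1 x (\<beta> n)) j)" for n
        by (subst cinner_commute) (simp add: cinner_tensor_contract1)
      then show ?thesis
        unfolding app_nuclear[OF s]
        using bounded_linear.suminf[OF bounded_linear_amp[of "(i, j)"] summable_nuclear[OF s, of "x \<otimes> ket j"]]
        by simp
    qed
    have sm: "summable (\<lambda>n. norm (contract1 x (\<beta> n)) * norm (slice2 (\<alpha> n) i))"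
      by (rule summable_comparison_test[OF _ summable_mult[OF s, of "norm x"]])
         (auto intro!: bound norm_slice2_le)
    have eq2: "amp (\<Sum>n. contract2 (contract1 x (\<beta> n)) (\<alpha> n)) i =
        (\<Sum>n. cinner (contract1 x (\<beta> n)) (slice2 (\<alpha> n) i))"
      using bounded_linear.suminf[OF bounded_linear_amp[of i] sum] by (simp add: amp_contract2)
    show ?thesis unfolding eq1 eq2 by (rule has_sum_cinner_series[OF sm])
  qed
  then show "(x, y) \<in> ptrace2 (nuclear_op \<alpha> \<beta>) \<longleftrightarrow> y = (\<Sum>n. contract2 (contract1 x (\<beta> n)) (\<alpha> n))"
    unfolding ptrace2_def using has_sum_unique by (fastforce intro!: ell2_eqI)
qed

text \<open>In each nuclear term the inner contraction produces a \<open>V\<close>, and the outer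
  one consumes it and leaves \<open>U\<close> in front.\<close>

lemma ptrace2_conj:
  assumes U: "unitary U" and V: "unitary V" and \<rho>: "trace_class \<rho>"
  shows "ptrace2 (conj_op (tensor_unitary U V) \<rho>) = conj_op U (ptrace2 \<rho>)"
proof (rule set_eqI, clarify)
  fix x y
  let ?T = "tensor_unitary U V"
  note T = unitary_tensor[OF U V]
  from \<rho> obtain \<alpha> \<beta> where s: "summable (\<lambda>n. norm (\<alpha> n) * norm (\<beta> n))" and "\<rho> = nuclear_op \<alpha> \<beta>"
    by (rule trace_classE)
  have s': "summable (\<lambda>n. norm (?T (\<alpha> n)) * norm (?T (\<beta> n)))" using s by (simp add: norm_unitary[OF T])
  define x' where "x' = inv U x"
  have x: "x = U x'" by (simp add: x'_def U)
  have "(x, y) \<in> ptrace2 (conj_op ?T \<rho>) \<longleftrightarrow> y = (\<Sum>n. U (contract2 (contract1 x' (\<beta> n)) (\<alpha> n)))"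
    unfolding \<open>\<rho> = _\<close> conj_nuclear_op[OF T] ptrace2_nuclear(1)[OF s'] x
    by (simp add: contract1_unitary[OF U V] contract2_unitary[OF U V])
  also have "\<dots> \<longleftrightarrow> y = U (\<Sum>n. contract2 (contract1 x' (\<beta> n)) (\<alpha> n))"
    using bounded_linear.suminf[OF bounded_linear_unitary[OF U] ptrace2_nuclear(2)[OF s]] by simp
  also have "\<dots> \<longleftrightarrow> (x', inv U y) \<in> ptrace2 \<rho>"
    unfolding \<open>\<rho> = _\<close> ptrace2_nuclear(1)[OF s] using U by (metis unitary_inv_apply)
  finally show "(x, y) \<in> ptrace2 (conj_op ?T \<rho>) \<longleftrightarrow> (x, y) \<in> conj_op U (ptrace2 \<rho>)"
    by (simp add: conj_op_inv_iff[OF U] x'_def)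
qed

section \<open>CP-diagonal couplings\<close>

lemma ext1_scale: "c \<noteq> 0 \<Longrightarrow> ext1 (c \<odot> A) = c \<odot> ext1 A"
  by (auto simp: ext1_def op_scale_iff slice1_scaleC)

lemma homogeneous_ext1: "homogeneous A \<Longrightarrow> homogeneous (ext1 A)"
  by (auto simp: ext1_def homogeneous_def slice1_scaleC)

lemma diag_op_eigenvector_phases:
  assumes "\<And>k. \<xi> k \<in> {1, -1 :: real}" shows "diag_op (\<lambda>k. of_real (\<xi> k) *\<^sub>C b k) v = diag_op b v"
proof -
  have "cinner (of_real (\<xi> k) *\<^sub>C b k) y = of_real (v k) * cinner (of_real (\<xi> k) *\<^sub>C b k) x \<longleftrightarrow>
      cinner (b k) y = of_real (v k) * cinner (b k) x" for x y k
    using assms[of k] by (auto simp: cinner_scaleC_left)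
  then show ?thesis unfolding diag_op_def by presburger
qed

lemma conj_cp_diagonal:
  assumes B: "unitary (cp B)" and d: "cp_diagonal_coupling B K" and j: "j < num K"
  shows "conj_op (cp B) (bath_op K j) = bath_op K j"
proof -
  obtain b :: "'a \<Rightarrow> 'a ell2" and \<xi> v where \<xi>: "\<And>k. \<xi> k \<in> {1, -1 :: real}"
    and eig: "\<And>k. cp B (b k) = of_real (\<xi> k) *\<^sub>C b k" and V: "bath_op K j = diag_op b v"
    using d j unfolding cp_diagonal_coupling_def by metis
  have "cp B \<circ> b = (\<lambda>k. of_real (\<xi> k) *\<^sub>C b k)" by (auto simp: eig)
  then show ?thesis by (simp add: V conj_diag_op[OF B] diag_op_eigenvector_phases[OF \<xi>])
qed

lemma conj_env_ham:
  assumes "environment_ok B G h \<rho>"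
  shows "conj_op (tensor_unitary (cp B) (cp G)) (env_ham B G h) = env_ham B G h"
proof -
  have e: "unitary (cp B)" "unitary (cp G)" "self_adjoint (ham B)" "self_adjoint (ham G)"
    "conj_op (cp B) (ham B) = ham B" "conj_op (cp G) (ham G) = ham G"
    "conj_op (tensor_unitary (cp B) (cp G)) h = h"
    using assms by (simp_all add: environment_ok_def sector_ok_def cp_cpt_invariant_def)
  show ?thesis
    unfolding env_ham_def
    by (simp add: conj_op_closure conj_op_plus unitary_tensor e conj_tensor_ext1 conj_tensor_ext2)
qed

text \<open>Covariance follows by absorbing each parity into \<open>bath_op\<close>, with the state
  left untouched. For the second claim, that the CP image of the state acts alike, the trace is
  transformed, while \<open>bath_op\<close>, its extension and \<open>env_ham\<close> are all
  CP-invariant.\<close>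

lemma cp_diagonal_coupling_screens:
  assumes S: "sector_ok S" and K: "coupling_ok S B K" and E: "environment_ok B G h \<rho>"
    and d: "cp_diagonal_coupling B K"
  shows "apparently_cp_invariant (cp S) (redfield_env hbar S B G h K \<rho>)"
    and "redfield_env hbar S B G h K (conj_op (tensor_unitary (cp B) (cp G)) \<rho>) t \<sigma> =
      redfield_env hbar S B G h K \<rho> t \<sigma>"
proof -
  let ?T = "tensor_unitary (cp B) (cp G)" and ?H = "env_ham B G h"
  have S': "unitary (cp S)" "conj_op (cp S) (ham S) = ham S"
    using S by (simp_all add: sector_ok_def cp_cpt_invariant_def)
  have E': "unitary (cp B)" "unitary (cp G)" "self_adjoint ?H" "trace_class \<rho>"
    using E by (simp_all add: environment_ok_def sector_ok_def density_op_def)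
  note T = unitary_tensor[OF E'(1,2)]
  have K': "self_adjoint (sys_op K j)" "self_adjoint (bath_op K j)" "parity K j \<in> {1, -1}"
    "conj_op (cp S) (sys_op K j) = of_real (parity K j) \<odot> sys_op K j"
    "conj_op (cp B) (bath_op K j) = of_real (parity K j) \<odot> bath_op K j" if "j < num K" for j
    using K that by (simp_all add: coupling_ok_def)
  have V: "conj_op (cp B) (bath_op K j) = bath_op K j" if "j < num K" for j
    by (rule conj_cp_diagonal[OF E'(1) d that])
  \<comment> \<open>The operator is both even and of parity \<open>parity K j\<close>; with parity
    -1 it equals its own negative.\<close>
  have V': "of_real (parity K j) \<odot> bath_op K j = bath_op K j" if "j < num K" for j
    using V[OF that] K'(5)[OF that] by simp
  have p0: "parity K j \<noteq> 0" if "j < num K" for j using K'(3)[OF that] by auto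
  have W: "conj_op ?T (ext1 (bath_op K j)) = ext1 (bath_op K j)" if "j < num K" for j
    by (simp add: conj_tensor_ext1 E'(1,2) K'(2) that V)
  show "apparently_cp_invariant (cp S) (redfield_env hbar S B G h K \<rho>)"
    unfolding redfield_env_def
  proof (rule apparently_cp_invariantI[where \<zeta> = "parity K"])
    show "unitary (cp S)" "conj_op (cp S) (ham S) = ham S" by fact+
    show "self_adjoint (sys_op K j) \<and> parity K j \<in> {1, -1} \<and>
        conj_op (cp S) (sys_op K j) = of_real (parity K j) \<odot> sys_op K j" if "j < num K" for j
      using K'[OF that] by blast
    show mean: "of_real (parity K j) * bath_mean K (ptrace2 \<rho>) j = bath_mean K (ptrace2 \<rho>) j"
      if "j < num K" for j
      using p0[OF that] by (simp add: bath_mean_def V' that flip: op_trace_scale op_scale_times)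
    show "of_real (parity K j * parity K l) * env_corr hbar B G h K \<rho> j l \<tau> = env_corr hbar B G h K \<rho> j l \<tau>"
      if jl: "j < num K" "l < num K" for j l \<tau>
    proof -
      let ?W = "\<lambda>j. ext1 (bath_op K j) :: ('b \<times> 'c) op"
      have W': "of_real (parity K j) \<odot> ?W j = ?W j" if "j < num K" for j
        by (rule trans[OF ext1_scale[symmetric] arg_cong[where f=ext1, OF V'[OF that]]]) (simp add: p0 that)
      have "of_real (parity K j * parity K l) * op_trace (?W j \<cdot> conj_op (propagator hbar ?H \<tau>) (?W l) \<cdot> \<rho>) =
          op_trace ((of_real (parity K j * parity K l)) \<odot> (?W j \<cdot> conj_op (propagator hbar ?H \<tau>) (?W l) \<cdot> \<rho>))"
        using p0 jl by (simp add: op_trace_scale)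
      also have "\<dots> = op_trace ((of_real (parity K j) \<odot> ?W j) \<cdot>
          conj_op (propagator hbar ?H \<tau>) (of_real (parity K l) \<odot> ?W l) \<cdot> \<rho>)"
        using p0 jl by (subst scaled_correlation)
          (simp_all add: E' homogeneous_ext1 self_adjoint_homogeneous K')
      also have "\<dots> = op_trace (?W j \<cdot> conj_op (propagator hbar ?H \<tau>) (?W l) \<cdot> \<rho>)"
        by (simp add: W' jl)
      finally have "of_real (parity K j * parity K l) *
          op_trace (?W j \<cdot> conj_op (propagator hbar ?H \<tau>) (?W l) \<cdot> \<rho>) =
          op_trace (?W j \<cdot> conj_op (propagator hbar ?H \<tau>) (?W l) \<cdot> \<rho>)" .
      moreover have "of_real (parity K j * parity K l) *
          (bath_mean K (ptrace2 \<rho>) j * bath_mean K (ptrace2 \<rho>) l) =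
          bath_mean K (ptrace2 \<rho>) j * bath_mean K (ptrace2 \<rho>) l"
        by (subst (3 4) mean[symmetric]) (simp_all add: jl mult_ac)
      ultimately show ?thesis by (simp only: env_corr_def corr_def right_diff_distrib)
    qed
  qed
  have mean: "bath_mean K (ptrace2 (conj_op ?T \<rho>)) j = bath_mean K (ptrace2 \<rho>) j" if "j < num K" for j
    using op_trace_conj[OF E'(1), of "bath_op K j \<cdot> ptrace2 \<rho>"]
    by (simp add: bath_mean_def ptrace2_conj E' conj_op_times V that)
  have "env_corr hbar B G h K (conj_op ?T \<rho>) j l \<tau> = env_corr hbar B G h K \<rho> j l \<tau>"
    if "j < num K" "l < num K" for j l \<tau>
    using op_trace_conj[OF T, of "ext1 (bath_op K j) \<cdot> conj_op (propagator hbar ?H \<tau>) (ext1 (bath_op K l)) \<cdot> \<rho>"]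
    by (simp add: env_corr_def corr_def mean that W conj_correlation[OF T E'(3) conj_env_ham[OF E]])
  then show "redfield_env hbar S B G h K (conj_op ?T \<rho>) t \<sigma> = redfield_env hbar S B G h K \<rho> t \<sigma>"
    unfolding redfield_env_def by (intro redfield_cong) (simp_all add: mean)
qed

section \<open>Weighted permutation operators\<close>

text \<open>Row \<open>i\<close> of the matrix has the single entry \<open>w i\<close> in column
  \<open>p i\<close>. With \<open>p = id\<close> and unbounded \<open>w\<close> this is a
  Hamiltonian on its maximal domain, with an involution \<open>p\<close> a transition operator.
  Products and symmetry transforms stay in the class, so the example reduces to arithmetic of
  weights.\<close>

definition mono_op :: "('a \<Rightarrow> complex) \<Rightarrow> ('a \<Rightarrow> 'a) \<Rightarrow> 'a op" where
  "mono_op w p = {(x, y). \<forall>i. amp y i = w i * amp x (p i)}"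

text \<open>The function version for bounded \<open>w\<close> and bijective \<open>p\<close>;
  otherwise the argument of \<open>Abs_ell2\<close> need not be square summable.
  \<open>mono_cvec\<close> is its antilinear companion, for time reversal.\<close>

definition mono_vec :: "('a \<Rightarrow> complex) \<Rightarrow> ('a \<Rightarrow> 'a) \<Rightarrow> 'a ell2 \<Rightarrow> 'a ell2" where
  "mono_vec w p x = Abs_ell2 (\<lambda>i. w i * amp x (p i))"

definition mono_cvec :: "('a \<Rightarrow> complex) \<Rightarrow> ('a \<Rightarrow> 'a) \<Rightarrow> 'a ell2 \<Rightarrow> 'a ell2" where
  "mono_cvec w p x = Abs_ell2 (\<lambda>i. w i * cnj (amp x (p i)))"

lemma mono_op_iff: "(x, y) \<in> mono_op w p \<longleftrightarrow> (\<forall>i. amp y i = w i * amp x (p i))"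
  by (simp add: mono_op_def)

lemma amp_mono_vec:
  assumes "bounded (range w)" "bij p" shows "amp (mono_vec w p x) i = w i * amp x (p i)"
proof -
  obtain C where "\<And>i. cmod (w i) \<le> C" using assms(1) by (auto simp: bounded_iff)
  moreover have "amp (Abs_ell2 (\<lambda>i. amp x (p i))) = (\<lambda>i. amp x (p i))"
    by (rule amp_Abs) (rule summable_sq_bij[OF assms(2)])
  ultimately show ?thesis
    unfolding mono_vec_def by (subst amp_Abs) (use summable_sq_bounded[of w C "Abs_ell2 (\<lambda>i. amp x (p i))"] in auto)
qed

lemma amp_mono_cvec:
  assumes "bounded (range w)" "bij p" shows "amp (mono_cvec w p x) i = w i * cnj (amp x (p i))"
proof -
  have "bounded (range (\<lambda>i. cnj (w i)))" using assms(1) by (auto simp: bounded_iff)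
  from amp_mono_vec[OF this assms(2)]
  have "(\<lambda>i. (cmod (cnj (w i) * amp x (p i)))\<^sup>2) summable_on UNIV"
    using summable_amp[of "mono_vec (\<lambda>i. cnj (w i)) p x"] by simp
  then show ?thesis unfolding mono_cvec_def by (subst amp_Abs) (auto simp: norm_mult)
qed

lemma mono_op_bounded_iff:
  assumes "bounded (range w)" "bij p" shows "(x, y) \<in> mono_op w p \<longleftrightarrow> y = mono_vec w p x"
  by (simp add: mono_op_iff ell2_eq_iff amp_mono_vec assms)

lemma app_mono_op: "bounded (range w) \<Longrightarrow> bij p \<Longrightarrow> app (mono_op w p) x = mono_vec w p x"
  by (simp add: app_def mono_op_bounded_iff)

lemma diag_op_ket: "diag_op ket v = mono_op (\<lambda>i. of_real (v i)) id"
  by (simp add: diag_op_def mono_op_def)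

lemma bounded_range_unit: "(\<And>i. cmod (w i) = 1) \<Longrightarrow> bounded (range w)"
  by (auto simp: bounded_iff intro!: exI[of _ 1])

text \<open>A bounded right factor always yields an intermediate vector, so the product has the full
  maximal domain of the combined weights.\<close>

lemma mono_op_times:
  assumes "bounded (range v)" "bij q"
  shows "mono_op w p \<cdot> mono_op v q = mono_op (\<lambda>i. w i * v (p i)) (q \<circ> p)"
  unfolding op_times_def by (auto simp: mono_op_bounded_iff[OF assms])
    (auto simp: mono_op_iff amp_mono_vec[OF assms] mult.assoc)

lemma mono_op_scale: "c \<noteq> 0 \<Longrightarrow> c \<odot> mono_op w p = mono_op (\<lambda>i. c * w i) p"
  by (auto simp: op_scale_iff mono_op_iff field_simps)

lemma mono_op_sum:
  assumes "\<And>j. j \<in> J \<Longrightarrow> bounded (range (w j))" "bij p"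
  shows "op_sum J (\<lambda>j. mono_op (w j) p) = mono_op (\<lambda>i. \<Sum>j\<in>J. w j i) p"
proof (rule set_eqI, clarify)
  fix x y
  have "(x, y) \<in> op_sum J (\<lambda>j. mono_op (w j) p) \<longleftrightarrow> y = (\<Sum>j\<in>J. mono_vec (w j) p x)"
  proof -
    have "(\<exists>f. y = sum f J \<and> (\<forall>j\<in>J. f j = mono_vec (w j) p x)) \<longleftrightarrow> y = (\<Sum>j\<in>J. mono_vec (w j) p x)"
      by (metis (no_types, lifting) sum.cong)
    then show ?thesis by (simp add: op_sum_def mono_op_bounded_iff assms)
  qed
  also have "\<dots> \<longleftrightarrow> (x, y) \<in> mono_op (\<lambda>i. \<Sum>j\<in>J. w j i) p"
    by (simp add: ell2_eq_iff amp_sum mono_op_iff amp_mono_vec assms sum_distrib_right)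
  finally show "(x, y) \<in> op_sum J (\<lambda>j. mono_op (w j) p) \<longleftrightarrow> (x, y) \<in> mono_op (\<lambda>i. \<Sum>j\<in>J. w j i) p" .
qed

lemma mono_op_plus:
  assumes "bounded (range v)" "bij p"
  shows "mono_op w p \<oplus> mono_op v p = mono_op (\<lambda>i. w i + v i) p"
proof (rule set_eqI, clarify)
  fix x y
  have "(x, y) \<in> mono_op w p \<oplus> mono_op v p \<longleftrightarrow> (x, y - mono_vec v p x) \<in> mono_op w p"
    unfolding op_plus_def by (auto simp: mono_op_bounded_iff[OF assms]) (metis diff_add_cancel)
  also have "\<dots> \<longleftrightarrow> (x, y) \<in> mono_op (\<lambda>i. w i + v i) p"
    by (simp add: mono_op_iff amp_ops amp_mono_vec[OF assms] diff_eq_eq distrib_right)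
  finally show "(x, y) \<in> mono_op w p \<oplus> mono_op v p \<longleftrightarrow> (x, y) \<in> mono_op (\<lambda>i. w i + v i) p" .
qed

lemma ext1_mono_op: "ext1 (mono_op w p) = mono_op (\<lambda>x. w (fst x)) (map_prod p id)"
  and ext2_mono_op: "ext2 (mono_op w p) = mono_op (\<lambda>x. w (snd x)) (map_prod id p)"
  by (auto simp: ext1_def ext2_def mono_op_def)

section \<open>Unitary and antiunitary weighted permutations\<close>

lemma mono_vec_inverse:
  assumes "\<And>i. cmod (s i) = 1" "bij f"
  shows "mono_vec s f (mono_vec (\<lambda>i. cnj (s (inv f i))) (inv f) x) = x"
proof (rule ell2_eqI)
  fix i
  have "s i * cnj (s i) = 1" using assms(1)[of i] by (simp add: complex_norm_square[symmetric])
  then show "amp (mono_vec s f (mono_vec (\<lambda>i. cnj (s (inv f i))) (inv f) x)) i = amp x i"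
    using assms(2) by (simp add: amp_mono_vec bounded_range_unit assms bij_imp_bij_inv bij_is_inj mult.assoc[symmetric])
qed

lemma mono_cvec_inverse:
  assumes "\<And>i. cmod (s i) = 1" "bij f"
  shows "mono_cvec s f (mono_cvec (\<lambda>i. s (inv f i)) (inv f) x) = x"
proof (rule ell2_eqI)
  fix i
  have "s i * cnj (s i) = 1" using assms(1)[of i] by (simp add: complex_norm_square[symmetric])
  then show "amp (mono_cvec s f (mono_cvec (\<lambda>i. s (inv f i)) (inv f) x)) i = amp x i"
    using assms(2) by (simp add: amp_mono_cvec bounded_range_unit assms bij_imp_bij_inv bij_is_inj mult.assoc[symmetric])
qed

lemma unitary_mono_vec:
  assumes "\<And>i. cmod (s i) = 1" "bij f" shows "unitary (mono_vec s f)"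
  unfolding unitary_def
proof (intro conjI allI)
  note amp = amp_mono_vec[OF bounded_range_unit assms(2), of s, OF assms(1)]
  show "mono_vec s f (x + y) = mono_vec s f x + mono_vec s f y" for x y
    by (rule ell2_eqI) (simp add: amp amp_ops distrib_left)
  show "mono_vec s f (c *\<^sub>C x) = c *\<^sub>C mono_vec s f x" for c x
    by (rule ell2_eqI) (simp add: amp)
  show "norm (mono_vec s f x) = norm x" for x
  proof -
    have "(norm (mono_vec s f x))\<^sup>2 = (norm x)\<^sup>2"
      using infsum_reindex_bij_betw[OF assms(2), of "\<lambda>i. (cmod (amp x i))\<^sup>2"]
      by (simp add: norm_sq_ell2 amp norm_mult assms(1))
    then show ?thesis by (simp add: power2_eq_iff_nonneg)
  qed
  show "surj (mono_vec s f)" by (rule surjI) (rule mono_vec_inverse[OF assms])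
qed

lemma antiunitary_mono_cvec:
  assumes "\<And>i. cmod (s i) = 1" "bij f" shows "antiunitary (mono_cvec s f)"
  unfolding antiunitary_def
proof (intro conjI allI)
  note amp = amp_mono_cvec[OF bounded_range_unit assms(2), of s, OF assms(1)]
  show "mono_cvec s f (x + y) = mono_cvec s f x + mono_cvec s f y" for x y
    by (rule ell2_eqI) (simp add: amp amp_ops distrib_left)
  show "mono_cvec s f (c *\<^sub>C x) = cnj c *\<^sub>C mono_cvec s f x" for c x
    by (rule ell2_eqI) (simp add: amp)
  show "norm (mono_cvec s f x) = norm x" for x
  proof -
    have "(norm (mono_cvec s f x))\<^sup>2 = (norm x)\<^sup>2"
      using infsum_reindex_bij_betw[OF assms(2), of "\<lambda>i. (cmod (amp x i))\<^sup>2"]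
      by (simp add: norm_sq_ell2 amp norm_mult assms(1))
    then show ?thesis by (simp add: power2_eq_iff_nonneg)
  qed
  show "surj (mono_cvec s f)" by (rule surjI) (rule mono_cvec_inverse[OF assms])
qed

text \<open>\<open>r\<close> is \<open>p\<close> seen through the relabelling \<open>f\<close>. It
  is characterised by an equation rather than built with \<open>inv f\<close>, because in the
  applications \<open>f\<close> commutes with \<open>p\<close> and then
  \<open>r = p\<close>.\<close>

lemma conj_mono_op:
  assumes s: "\<And>i. cmod (s i) = 1" and f: "bij f" and r: "\<And>i. f (r i) = p (f i)"
  shows "conj_op (mono_vec s f) (mono_op w p) = mono_op (\<lambda>i. s i * w (f i) * cnj (s (r i))) r"
proof (rule set_eqI, clarify)
  fix x y
  let ?U = "mono_vec s f"
  have U: "unitary ?U" by (rule unitary_mono_vec[OF s f])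
  note amp = amp_mono_vec[OF bounded_range_unit f, of s, OF s]
  obtain x' y' where xy: "x = ?U x'" "y = ?U y'" using surj_unitary[OF U] by (metis surjD)
  have s0: "s i \<noteq> 0" for i using s[of i] by auto
  have ss: "cnj (s i) * s i = 1" for i
    using s[of i] by (metis complex_norm_square mult.commute of_real_1 one_power2)
  have "(\<forall>i. amp y' i = w i * amp x' (p i)) \<longleftrightarrow> (\<forall>i. amp y' (f i) = w (f i) * amp x' (p (f i)))"
    using bij_is_surj[OF f] by (metis surjD)
  also have "\<dots> \<longleftrightarrow> (\<forall>i. s i * amp y' (f i) = s i * w (f i) * (cnj (s (r i)) * s (r i)) * amp x' (f (r i)))"
    by (simp add: ss s0 r)
  also have "\<dots> \<longleftrightarrow> (x, y) \<in> mono_op (\<lambda>i. s i * w (f i) * cnj (s (r i))) r"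
    by (simp add: xy amp mono_op_iff mult.assoc)
  finally show "(x, y) \<in> conj_op ?U (mono_op w p) \<longleftrightarrow>
      (x, y) \<in> mono_op (\<lambda>i. s i * w (f i) * cnj (s (r i))) r"
    by (simp add: xy conj_op_iff[OF U] mono_op_iff)
qed

lemma conj_mono_cvec:
  assumes s: "\<And>i. cmod (s i) = 1" and f: "bij f" and r: "\<And>i. f (r i) = p (f i)"
  shows "conj_op (mono_cvec s f) (mono_op w p) = mono_op (\<lambda>i. s i * cnj (w (f i)) * cnj (s (r i))) r"
proof (rule set_eqI, clarify)
  fix x y
  let ?U = "mono_cvec s f"
  note amp = amp_mono_cvec[OF bounded_range_unit f, of s, OF s]
  have s0: "s i \<noteq> 0" for i using s[of i] by auto
  have ss: "cnj (s i) * s i = 1" for i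
    using s[of i] by (metis complex_norm_square mult.commute of_real_1 one_power2)
  have inj: "x = z" if "?U x = ?U z" for x z
  proof (rule ell2_eqI)
    fix i
    obtain k where "i = f k" using bij_is_surj[OF f] by (metis surjD)
    then show "amp x i = amp z i" using that s0[of k] by (auto simp: ell2_eq_iff amp)
  qed
  have "surj ?U" using antiunitary_mono_cvec[OF s f] by (simp add: antiunitary_def)
  then obtain x' y' where xy: "x = ?U x'" "y = ?U y'" by (metis surjD)
  have "(\<forall>i. amp y' i = w i * amp x' (p i)) \<longleftrightarrow> (\<forall>i. amp y' (f i) = w (f i) * amp x' (p (f i)))"
    using bij_is_surj[OF f] by (metis surjD)
  also have "\<dots> \<longleftrightarrow> (\<forall>i. s i * cnj (amp y' (f i)) =
      s i * cnj (w (f i)) * (cnj (s (r i)) * s (r i)) * cnj (amp x' (f (r i))))"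
    by (simp add: ss s0 r flip: complex_cnj_mult)
  also have "\<dots> \<longleftrightarrow> (x, y) \<in> mono_op (\<lambda>i. s i * cnj (w (f i)) * cnj (s (r i))) r"
    by (simp add: xy amp mono_op_iff mult.assoc)
  finally show "(x, y) \<in> conj_op ?U (mono_op w p) \<longleftrightarrow>
      (x, y) \<in> mono_op (\<lambda>i. s i * cnj (w (f i)) * cnj (s (r i))) r"
    unfolding conj_op_def xy by (auto simp: mono_op_iff dest!: inj)
qed

lemma bij_map_prod: "bij f \<Longrightarrow> bij g \<Longrightarrow> bij (map_prod f g)"
  by (simp add: bij_def prod.inj_map map_prod_surj)

lemma tensor_unitary_mono:
  fixes s :: "'a \<Rightarrow> complex" and s' :: "'b \<Rightarrow> complex"
  assumes s: "\<And>i. cmod (s i) = 1" "bij f" and s': "\<And>i. cmod (s' i) = 1" "bij f'"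
  shows "tensor_unitary (mono_vec s f) (mono_vec s' f') =
    mono_vec (\<lambda>x. s (fst x) * s' (snd x)) (map_prod f f')"
proof (intro ext ell2_eqI)
  fix z :: "('a \<times> 'b) ell2" and x :: "'a \<times> 'b"
  obtain i j where x: "x = (i, j)" by (cases x)
  have 2: "amp (map2 (mono_vec s' f') z) (i, j) = s' j * amp z (i, f' j)" for i j
    using arg_cong[OF slice2_map2[where f="mono_vec s' f'" and z=z and i=i], of "\<lambda>v. amp v j"]
      norm_unitary[OF unitary_mono_vec[OF s']]
    by (simp add: amp_mono_vec bounded_range_unit s')
  have 1: "amp (map1 (mono_vec s f) y) (i, j) = s i * amp y (f i, j)" for y :: "('a \<times> 'b) ell2" and i j
    using arg_cong[OF slice1_map1[where f="mono_vec s f" and z=y and j=j], of "\<lambda>v. amp v i"]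
      norm_unitary[OF unitary_mono_vec[OF s]]
    by (simp add: amp_mono_vec bounded_range_unit s)
  show "amp (tensor_unitary (mono_vec s f) (mono_vec s' f') z) x =
      amp (mono_vec (\<lambda>x. s (fst x) * s' (snd x)) (map_prod f f') z) x"
    by (simp add: x tensor_unitary_def 1 2 amp_mono_vec bounded_range_unit norm_mult s s' bij_map_prod)
qed

lemma amp_cnj_vec: "amp (cnj_vec x) i = cnj (amp x i)"
  unfolding cnj_vec_def by (subst amp_Abs) (use summable_amp[of x] in auto)

lemma norm_antiunitary: "antiunitary T \<Longrightarrow> norm (T x) = norm x"
  by (simp add: antiunitary_def)

lemma tensor_antiunitary_mono:
  fixes s :: "'a \<Rightarrow> complex" and s' :: "'b \<Rightarrow> complex"
  assumes s: "\<And>i. cmod (s i) = 1" "bij f" and s': "\<And>i. cmod (s' i) = 1" "bij f'"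
  shows "tensor_antiunitary (mono_cvec s f) (mono_cvec s' f') =
    mono_cvec (\<lambda>x. s (fst x) * s' (snd x)) (map_prod f f')"
proof (intro ext ell2_eqI)
  fix z :: "('a \<times> 'b) ell2" and x :: "'a \<times> 'b"
  obtain i j where x: "x = (i, j)" by (cases x)
  have 2: "amp (map2 (mono_cvec s' f') z) (i, j) = s' j * cnj (amp z (i, f' j))" for i j
    using arg_cong[OF slice2_map2[where f="mono_cvec s' f'" and z=z and i=i], of "\<lambda>v. amp v j"]
      norm_antiunitary[OF antiunitary_mono_cvec[OF s']]
    by (simp add: amp_mono_cvec bounded_range_unit s')
  have 1: "amp (map1 (mono_cvec s f) y) (i, j) = s i * cnj (amp y (f i, j))" for y :: "('a \<times> 'b) ell2" and i j
    using arg_cong[OF slice1_map1[where f="mono_cvec s f" and z=y and j=j], of "\<lambda>v. amp v i"]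
      norm_antiunitary[OF antiunitary_mono_cvec[OF s]]
    by (simp add: amp_mono_cvec bounded_range_unit s)
  show "amp (tensor_antiunitary (mono_cvec s f) (mono_cvec s' f') z) x =
      amp (mono_cvec (\<lambda>x. s (fst x) * s' (snd x)) (map_prod f f') z) x"
    by (simp add: x tensor_antiunitary_def 1 2 amp_cnj_vec amp_mono_cvec bounded_range_unit norm_mult s s' bij_map_prod)
qed

text \<open>There is one closed coordinate condition per row. Hence the closure in
  \<open>env_ham\<close> adds nothing in the example.\<close>

lemma closed_mono_op: "closed (mono_op w p)"
proof -
  have c: "continuous_on UNIV (\<lambda>x. amp x i)" for i :: 'a
    by (rule linear_continuous_on[OF bounded_linear_amp])
  have "mono_op w p = (\<Inter>i. {z. amp (snd z) i = w i * amp (fst z) (p i)})"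
    by (auto simp: mono_op_def)
  also have "closed \<dots>"
    by (intro closed_INT ballI closed_Collect_eq continuous_on_mult continuous_on_const
        continuous_on_compose2[OF c] continuous_on_fst continuous_on_snd continuous_on_id) auto
  finally show ?thesis .
qed

lemma ket_in_mono_op:
  assumes "\<And>i. p (p i) = i" shows "(ket l, w (p l) *\<^sub>C ket (p l)) \<in> mono_op w p"
  using assms by (auto simp: mono_op_iff)

lemma closure_Domain_mono_op:
  assumes p: "\<And>i. p (p i) = i" shows "closure (Domain (mono_op w p)) = UNIV"
proof (rule UNIV_eq_I[symmetric])
  fix x :: "'a ell2"
  let ?D = "Domain (mono_op w p)"
  have fin: "(\<Sum>l\<in>F. amp x l *\<^sub>C ket l) \<in> ?D" if "finite F" for F
  proof -
    have "(\<Sum>l\<in>F. amp x l *\<^sub>C ket l, \<Sum>l\<in>F. amp x l *\<^sub>C w (p l) *\<^sub>C ket (p l)) \<in> mono_op w p"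
      using ket_in_mono_op[of p, OF p]
      by (auto simp: mono_op_iff amp_sum sum_distrib_left simp del: amp_ket intro!: sum.cong)
    then show ?thesis by blast
  qed
  have lim: "(sum (\<lambda>l. amp x l *\<^sub>C ket l) \<longlongrightarrow> x) (finite_subsets_at_top UNIV)"
    using orthonormal_expansion[OF orthonormal_basis_ket, of x] by (simp add: has_sum_def)
  show "x \<in> closure ?D"
  proof (rule Lim_in_closed_set[OF closed_closure _ _ lim])
    show "\<forall>\<^sub>F F in finite_subsets_at_top UNIV. (\<Sum>l\<in>F. amp x l *\<^sub>C ket l) \<in> closure ?D"
      using fin closure_subset by (intro eventually_finite_subsets_at_top_weakI) blast
  qed simp
qed

text \<open>\<open>w (p i) = cnj (w i)\<close> is the Hermitian symmetry of the matrix. Testing a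
  pair of the adjoint against kets returns every row equation, so the adjoint is no larger;
  reindexing by \<open>p\<close> gives the other inclusion.\<close>

lemma self_adjoint_mono_op:
  assumes p: "\<And>i. p (p i) = i" and w: "\<And>i. w (p i) = cnj (w i)"
  shows "self_adjoint (mono_op w p)"
  unfolding self_adjoint_def
proof (intro conjI closure_Domain_mono_op p equalityI subsetI; clarify)
  fix x y assume "(x, y) \<in> adj_op (mono_op w p)"
  then have "cinner x (w (p l) *\<^sub>C ket (p l)) = cinner y (ket l)" for l
    using ket_in_mono_op[of p, OF p] unfolding adj_op_iff by blast
  then have "cnj (w (p l) * cnj (amp x (p l))) = amp y l" for l
    by (simp add: cinner_scaleC_right)
  then show "(x, y) \<in> mono_op w p" by (auto simp: mono_op_iff w)
next
  fix x y assume xy: "(x, y) \<in> mono_op w p"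
  have bij: "bij p" using p by (metis bij_betw_byWitness UNIV_I subset_UNIV)
  have "cinner x v = cinner y u" if "(u, v) \<in> mono_op w p" for u v
  proof -
    have "cinner y u = (\<Sum>\<^sub>\<infinity>i. cnj (amp y (p i)) * amp u (p i))"
      unfolding cinner_def using infsum_reindex_bij_betw[OF bij, of "\<lambda>i. cnj (amp y i) * amp u i"] by simp
    also have "\<dots> = cinner x v"
      using xy that unfolding cinner_def by (simp add: mono_op_iff p w mult_ac)
    finally show ?thesis by simp
  qed
  then show "(x, y) \<in> adj_op (mono_op w p)" by (simp add: adj_op_iff)
qed

lemma self_adjoint_hermitian: "self_adjoint A \<Longrightarrow> hermitian A"
  by (simp add: self_adjoint_def hermitian_def)

section \<open>Traces of weighted permutations\<close>

lemma bounded_range_summable: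
  assumes "(\<lambda>i. cmod (w i)) summable_on UNIV" shows "bounded (range w)"
proof -
  have "cmod (w i) \<le> (\<Sum>\<^sub>\<infinity>i. cmod (w i))" for i
    using finite_sum_le_infsum[OF assms, of "{i}"] by simp
  then show ?thesis by (auto simp: bounded_iff)
qed

text \<open>Summable weights have countable support \<open>S\<close>; \<open>e\<close> numbers it,
  so the nonzero entries become a nuclear series over the naturals. Numbers outside the image of
  \<open>e\<close> get the zero vector for \<alpha>.\<close>

lemma trace_class_mono_op:
  assumes w: "(\<lambda>i. cmod (w i)) summable_on UNIV" and p: "bij p"
  shows "trace_class (mono_op w p)"
proof -
  define S where "S = {i. w i \<noteq> 0}"
  have "countable S" using summable_countable_real[OF w] by (simp add: S_def)
  define e where "e = to_nat_on S"
  have e: "inj_on e S" unfolding e_def by (rule inj_on_to_nat_on) fact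
  define \<alpha> where "\<alpha> n = (if n \<in> e ` S then w (inv_into S e n) *\<^sub>C ket (inv_into S e n) else 0)" for n
  define \<beta> where "\<beta> n = ket (p (inv_into S e n))" for n
  have \<alpha>_e: "\<alpha> (e i) = w i *\<^sub>C ket i" "\<beta> (e i) = ket (p i)" if "i \<in> S" for i
    using that e by (auto simp: \<alpha>_def \<beta>_def)
  have norm_ket: "norm (ket i) = 1" for i :: 'a
    using cinner_norm_sq[of "ket i"] by (simp add: power2_eq_1_iff flip: of_real_power)
      (metis norm_ge_zero not_one_le_zero neg_0_le_iff_le)
  have "(\<lambda>i. cmod (w i)) summable_on S" by (rule summable_on_subset_banach[OF w]) simp
  then have "((\<lambda>n. norm (\<alpha> n) * norm (\<beta> n)) \<circ> e) summable_on S"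
    by (rule summable_on_cong[THEN iffD1, rotated]) (simp add: \<alpha>_e norm_scaleC norm_ket)
  then have "(\<lambda>n. norm (\<alpha> n) * norm (\<beta> n)) summable_on e ` S"
    by (simp add: summable_on_reindex[OF e])
  then have "(\<lambda>n. norm (\<alpha> n) * norm (\<beta> n)) summable_on UNIV"
    by (rule summable_on_cong_neutral[THEN iffD1, rotated -1]) (auto simp: \<alpha>_def)
  then have s: "summable (\<lambda>n. norm (\<alpha> n) * norm (\<beta> n))"
    by (simp add: summable_on_UNIV_nonneg_real_iff)
  have "mono_op w p = nuclear_op \<alpha> \<beta>"
  proof (rule set_eqI, clarify)
    fix x y
    have "amp (\<Sum>n. cinner (\<beta> n) x *\<^sub>C \<alpha> n) i = w i * amp x (p i)" for i
    proof -
      have "amp (\<Sum>n. cinner (\<beta> n) x *\<^sub>C \<alpha> n) i = (\<Sum>n. cinner (\<beta> n) x * amp (\<alpha> n) i)"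
        using bounded_linear.suminf[OF bounded_linear_amp summable_nuclear[OF s]] by simp
      also have "\<dots> = (\<Sum>n\<in>(if i \<in> S then {e i} else {}). cinner (\<beta> n) x * amp (\<alpha> n) i)"
      proof (rule suminf_finite)
        fix n assume n: "n \<notin> (if i \<in> S then {e i} else {})"
        show "cinner (\<beta> n) x * amp (\<alpha> n) i = 0"
        proof (cases "n \<in> e ` S")
          case True
          then obtain k where "k \<in> S" "n = e k" by blast
          moreover from this n have "i \<noteq> k" by auto
          ultimately show ?thesis by (simp add: \<alpha>_e)
        qed (simp add: \<alpha>_def amp_ops)
      qed simp
      also have "\<dots> = w i * amp x (p i)" by (auto simp: \<alpha>_e) (simp add: S_def)
      finally show ?thesis .
    qed
    then show "(x, y) \<in> mono_op w p \<longleftrightarrow> (x, y) \<in> nuclear_op \<alpha> \<beta>"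
      by (simp add: nuclear_op_iff[OF s] mono_op_iff ell2_eq_iff)
  qed
  then show ?thesis using trace_class_nuclear[OF s] by simp
qed

lemma op_trace_mono_op:
  assumes w: "(\<lambda>i. cmod (w i)) summable_on UNIV" and p: "bij p"
  shows "op_trace (mono_op w p) = (\<Sum>\<^sub>\<infinity>i. if p i = i then w i else 0)"
  by (simp add: op_trace_def trace_class_mono_op assms app_mono_op bounded_range_summable amp_mono_vec
      if_distrib cong: if_cong)

lemma cinner_diag_nonneg:
  fixes x :: "'a ell2"
  assumes "(x, y) \<in> mono_op (\<lambda>i. of_real (v i)) id" "\<And>i. v i \<ge> 0"
  shows "Im (cinner x y) = 0 \<and> 0 \<le> Re (cinner x y)"
proof -
  have summand: "cnj (amp x i) * amp y i = of_real (v i * (cmod (amp x i))\<^sup>2)" for i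
    using assms(1) by (simp add: mono_op_iff complex_norm_square mult_ac del: of_real_power)
  have h: "((\<lambda>i. complex_of_real (v i * (cmod (amp x i))\<^sup>2)) has_sum cinner x y) UNIV"
    using has_sum_infsum[OF summable_cinner[of x y]] by (simp add: cinner_def summand del: of_real_mult of_real_power)
  have "((\<lambda>_. 0) has_sum Im (cinner x y)) (UNIV :: 'a set)"
    using has_sum_bounded_linear[OF bounded_linear_Im h] by (simp add: o_def)
  moreover have "((\<lambda>i. v i * (cmod (amp x i))\<^sup>2) has_sum Re (cinner x y)) UNIV"
    using has_sum_bounded_linear[OF bounded_linear_Re h] by (simp add: o_def)
  ultimately show ?thesis
    using assms(2) by (auto intro: has_sum_nonneg has_sum_unique[OF _ has_sum_0])
qed

lemma density_op_diag:
  assumes s: "(v has_sum 1) UNIV" and v: "\<And>i. v i \<ge> 0"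
  shows "density_op (mono_op (\<lambda>i. of_real (v i)) id)"
proof -
  have sum: "(\<lambda>i. cmod (of_real (v i))) summable_on UNIV"
    using s v by (simp add: summable_on_def) blast
  have "(\<Sum>\<^sub>\<infinity>i. complex_of_real (v i)) = 1"
    using has_sum_of_real[OF s, where 'a = complex] by (simp add: infsumI)
  then show ?thesis
    using cinner_diag_nonneg[of _ _ v] v sum
    by (auto simp: density_op_def trace_class_mono_op op_trace_mono_op)
qed

lemma commutes_with_diag:
  assumes "bounded (range w)" shows "commutes_with (mono_op w id) (mono_op v id)"
  unfolding commutes_with_def
proof clarify
  fix x z assume "(x, z) \<in> mono_op w id \<cdot> mono_op v id"
  then have "amp z i = v i * (w i * amp x i)" for i
    by (auto simp: op_times_def mono_op_iff mult.left_commute)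
  then have "(mono_vec w id x, z) \<in> mono_op v id" "(x, mono_vec w id x) \<in> mono_op w id"
    using assms by (auto simp: mono_op_iff amp_mono_vec)
  then show "(x, z) \<in> mono_op v id \<cdot> mono_op w id" unfolding op_times_def by blast
qed

section \<open>Propagator of a diagonal Hamiltonian\<close>

text \<open>A finite set \<open>K\<close> carries the squared norm of \<open>g\<close> up to
  \<open>e\<^sup>2 / 2\<close>, which controls the rest of \<open>f t\<close>; on \<open>K\<close>
  the finitely many coordinates converge.\<close>

lemma ell2_dominated_convergence:
  assumes f: "\<And>i. ((\<lambda>t. amp (f t) i) \<longlongrightarrow> 0) F"
    and g: "eventually (\<lambda>t. \<forall>i. cmod (amp (f t) i) \<le> cmod (amp g i)) F"
  shows "(f \<longlongrightarrow> 0) F"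
proof (rule tendstoI)
  fix e :: real assume e: "e > 0"
  have gs: "(\<lambda>i. (cmod (amp g i))\<^sup>2) summable_on UNIV" by (rule summable_amp)
  have "eventually (\<lambda>K. dist (\<Sum>i\<in>K. (cmod (amp g i))\<^sup>2) (\<Sum>\<^sub>\<infinity>i. (cmod (amp g i))\<^sup>2) < e\<^sup>2 / 2)
      (finite_subsets_at_top UNIV)"
    using has_sum_infsum[OF gs] e unfolding has_sum_def by (intro tendstoD) auto
  then obtain K where K: "finite K"
      "dist (\<Sum>i\<in>K. (cmod (amp g i))\<^sup>2) (\<Sum>\<^sub>\<infinity>i. (cmod (amp g i))\<^sup>2) < e\<^sup>2 / 2"
    unfolding eventually_finite_subsets_at_top by auto
  have "((\<lambda>t. \<Sum>i\<in>K. (cmod (amp (f t) i))\<^sup>2) \<longlongrightarrow> (\<Sum>i\<in>K. (cmod 0)\<^sup>2)) F"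
    by (intro tendsto_intros f)
  then have "eventually (\<lambda>t. dist (\<Sum>i\<in>K. (cmod (amp (f t) i))\<^sup>2) 0 < e\<^sup>2 / 2) F"
    using e by (intro tendstoD) auto
  then show "eventually (\<lambda>t. dist (f t) 0 < e) F"
    using g
  proof eventually_elim
    case (elim t)
    have split: "infsum h UNIV = sum h K + infsum h (- K)" if "h summable_on UNIV" for h :: "'a \<Rightarrow> real"
      using infsum_Un_disjoint[of h K "- K"] K(1) summable_on_subset_banach[OF that, of "- K"] by simp
    have "(norm (f t))\<^sup>2 = (\<Sum>i\<in>K. (cmod (amp (f t) i))\<^sup>2) + (\<Sum>\<^sub>\<infinity>i\<in>- K. (cmod (amp (f t) i))\<^sup>2)"
      unfolding norm_sq_ell2 by (rule split[OF summable_amp])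
    also have "(\<Sum>\<^sub>\<infinity>i\<in>- K. (cmod (amp (f t) i))\<^sup>2) \<le> (\<Sum>\<^sub>\<infinity>i\<in>- K. (cmod (amp g i))\<^sup>2)"
      using elim(2) by (intro infsum_mono summable_on_subset_banach[OF summable_amp] power_mono) auto
    also have "\<dots> < e\<^sup>2 / 2" using K(2) split[OF gs] by (simp add: dist_real_def)
    also have "(\<Sum>i\<in>K. (cmod (amp (f t) i))\<^sup>2) < e\<^sup>2 / 2" using elim(1) by (simp add: sum_nonneg)
    finally have "(norm (f t))\<^sup>2 < e\<^sup>2" by simp
    then show ?case using e by (simp add: power2_less_imp_less)
  qed
qed

lemma cmod_cis_minus_one: "cmod (cis a - 1) \<le> \<bar>a\<bar>"
  using dist_exp_i_1[of a] abs_sin_x_le_abs_x[of "a / 2"] by (simp add: cis_conv_exp)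

lemma has_vector_derivative_cis:
  "((\<lambda>t. cis (a * t)) has_vector_derivative \<i> * of_real a * cis (a * t)) (at t within S)"
proof -
  have "((\<lambda>z. exp (\<i> * of_real a * z)) has_field_derivative
      \<i> * of_real a * exp (\<i> * of_real a * of_real t)) (at (of_real t))"
    by (auto intro!: derivative_eq_intros)
  from has_vector_derivative_real_field[OF this] show ?thesis
    by (simp add: cis_conv_exp mult.assoc has_vector_derivative_at_within)
qed

lemma mono_vec_one [simp]: "mono_vec (\<lambda>_. 1) id x = x"
  by (rule ell2_eqI) (simp add: amp_mono_vec bounded_range_unit)

text \<open>Coordinatewise the generator is the derivative of \<open>cis\<close>. From
  differentiability the graph relation follows by uniqueness of derivatives; conversely, convergence
  in norm needs a square summable bound on the difference quotients.\<close>

lemma generates_diag: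
  fixes e :: "'a \<Rightarrow> real"
  assumes "hbar > 0"
  shows "generates hbar (mono_op (\<lambda>i. of_real (e i)) id) (\<lambda>t. mono_vec (\<lambda>i. cis (- (e i * t / hbar))) id)"
    (is "generates hbar ?H ?P")
proof -
  have amp: "amp (?P t x) i = cis (- (e i * t / hbar)) * amp x i" for t x i
    by (simp add: amp_mono_vec bounded_range_unit)
  have unitary: "unitary (?P t)" for t by (rule unitary_mono_vec) simp_all
  have group: "?P (s + t) x = ?P s (?P t x)" for s t x
    by (rule ell2_eqI, simp only: amp mult.assoc[symmetric] cis_mult)
       (simp add: distrib_left add_divide_distrib)
  have P0: "?P 0 x = x" for x by simp
  have at0: "((\<lambda>h. ?P h x - x) \<longlongrightarrow> 0) (at 0)" for x
  proof (rule ell2_dominated_convergence[where g="2 *\<^sub>C x"])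
    show "((\<lambda>h. amp (?P h x - x) i) \<longlongrightarrow> 0) (at 0)" for i
    proof -
      have "((\<lambda>h. cis (- (e i * h / hbar)) * amp x i - amp x i) \<longlongrightarrow> cis (- (e i * 0 / hbar)) * amp x i - amp x i) (at 0)"
        by (intro tendsto_intros) (use assms in auto)
      then show ?thesis by (simp add: amp amp_ops)
    qed
    show "eventually (\<lambda>h. \<forall>i. cmod (amp (?P h x - x) i) \<le> cmod (amp (2 *\<^sub>C x) i)) (at 0)"
    proof (intro always_eventually allI)
      fix h i
      have "cmod (amp (?P h x - x) i) = cmod (cis (- (e i * h / hbar)) - 1) * cmod (amp x i)"
        by (simp add: amp amp_ops norm_mult[symmetric] left_diff_distrib)
      also have "\<dots> \<le> 2 * cmod (amp x i)"
        using norm_triangle_ineq4[of "cis (- (e i * h / hbar))" 1] by (intro mult_right_mono) auto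
      finally show "cmod (amp (?P h x - x) i) \<le> cmod (amp (2 *\<^sub>C x) i)" by (simp add: norm_mult)
    qed
  qed
  have cont: "continuous_on UNIV (\<lambda>t. ?P t x)" for x
    unfolding continuous_on_eq_continuous_at[OF open_UNIV]
  proof
    fix t
    have "((\<lambda>h. ?P t (?P h x - x)) \<longlongrightarrow> ?P t 0) (at 0)"
      by (rule bounded_linear.tendsto[OF bounded_linear_unitary[OF unitary] at0])
    then have "((\<lambda>h. ?P (t + h) x - ?P t x) \<longlongrightarrow> 0) (at 0)"
      by (simp add: group unitary_diff[OF unitary] unitary_zero[OF unitary])
    then show "isCont (\<lambda>t. ?P t x) t" unfolding isCont_iff by (simp add: Lim_null[symmetric])
  qed
  have comp: "((\<lambda>t. amp (?P t x) i) has_vector_derivative (- \<i> * of_real (e i / hbar)) * amp x i) (at 0)" for x i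
    using has_vector_derivative_mult_left[OF has_vector_derivative_cis[of "- (e i / hbar)" 0 UNIV], of "amp x i"]
    by (simp add: amp)
  have gen: "(x, y) \<in> ?H \<longleftrightarrow> ((\<lambda>t. ?P t x) has_vector_derivative (- \<i> / of_real hbar) *\<^sub>C y) (at 0)" for x y
  proof
    assume "((\<lambda>t. ?P t x) has_vector_derivative (- \<i> / of_real hbar) *\<^sub>C y) (at 0)"
    then have d: "((\<lambda>t. amp (?P t x) i) has_vector_derivative amp ((- \<i> / of_real hbar) *\<^sub>C y) i) (at 0)" for i
      by (rule bounded_linear.has_vector_derivative[OF bounded_linear_amp])
    have "(- \<i> / of_real hbar) * amp y i = (- \<i> * of_real (e i / hbar)) * amp x i" for i
      using vector_derivative_unique_at[OF d[of i] comp[of x i]] by simp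
    then show "(x, y) \<in> ?H" using assms by (auto simp: mono_op_iff field_simps)
  next
    assume xy: "(x, y) \<in> ?H"
    define k where "k = - \<i> / of_real hbar"
    define q where "q h = (1 / h) *\<^sub>R (?P h x - ?P 0 x - h *\<^sub>R (k *\<^sub>C y))" for h :: real
    have ampq: "amp (q h) i = (cis (- (e i * h / hbar)) - 1) / of_real h * amp x i - k * of_real (e i) * amp x i"
      if "h \<noteq> 0" for h i
      using xy that by (simp only: q_def amp amp_ops amp_scaleC) (simp add: mono_op_iff field_simps)
    \<comment> \<open>As the distance of \<open>cis a\<close> from 1 is at most the modulus of
      \<open>a\<close>, each quotient is bounded by
      \<open>\<bar>e i\<bar> / hbar * cmod (amp x i)\<close>, and so is the derivative term. This is
      the modulus of an entry of \<open>y\<close> over \<open>hbar\<close>, so membership in the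
      graph provides the dominating vector.\<close>
    have "(q \<longlongrightarrow> 0) (at 0)"
    proof (rule ell2_dominated_convergence[where g="(2 / of_real hbar) *\<^sub>C y"])
      show "((\<lambda>h. amp (q h) i) \<longlongrightarrow> 0) (at 0)" for i
      proof (rule tendsto_norm_zero_cancel)
        have "norm (amp (q h) i) =
            norm (amp (?P (0 + h) x) i - amp (?P 0 x) i - h *\<^sub>R (- \<i> * of_real (e i / hbar) * amp x i)) / norm h" for h
          using xy by (simp add: q_def k_def amp_ops norm_mult mono_op_iff scaleR_conv_of_real norm_divide mult.assoc)
        then show "((\<lambda>h. norm (amp (q h) i)) \<longlongrightarrow> 0) (at 0)"
          using comp[of x i] unfolding has_vector_derivative_def has_derivative_at by (simp only:)
      qed
      have "cmod (amp (q h) i) \<le> 2 / hbar * cmod (amp y i)" if "h \<noteq> 0" for h i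
      proof -
        have a: "cmod ((cis (- (e i * h / hbar)) - 1) / of_real h) \<le> \<bar>e i\<bar> / hbar"
          using cmod_cis_minus_one[of "- (e i * h / hbar)"] that assms
          by (simp add: norm_divide field_simps abs_mult)
        have b: "cmod (k * of_real (e i)) \<le> \<bar>e i\<bar> / hbar"
          using assms by (simp add: k_def norm_mult norm_divide)
        have "cmod (amp (q h) i) \<le> cmod ((cis (- (e i * h / hbar)) - 1) / of_real h * amp x i) +
            cmod (k * of_real (e i) * amp x i)"
          unfolding ampq[OF that] by (rule norm_triangle_ineq4)
        also have "\<dots> \<le> \<bar>e i\<bar> / hbar * cmod (amp x i) + \<bar>e i\<bar> / hbar * cmod (amp x i)"
          unfolding norm_mult[of _ "amp x i"] by (intro add_mono mult_right_mono a b norm_ge_zero)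
        also have "\<dots> = 2 / hbar * cmod (amp y i)" using xy by (simp add: mono_op_iff norm_mult)
        finally show ?thesis .
      qed
      then show "eventually (\<lambda>h. \<forall>i. cmod (amp (q h) i) \<le> cmod (amp ((2 / of_real hbar) *\<^sub>C y) i)) (at 0)"
        using assms by (auto simp: eventually_at_filter norm_mult norm_divide)
    qed
    then show "((\<lambda>t. ?P t x) has_vector_derivative (- \<i> / of_real hbar) *\<^sub>C y) (at 0)"
      unfolding has_vector_derivative_def has_derivative_at
      using tendsto_norm_zero[of q "at 0"]
      by (auto simp: q_def k_def divide_inverse mult.commute intro: bounded_linear_scaleR_left)
  qed
  show ?thesis
    unfolding generates_def using unitary cont gen group P0 by (auto simp: fun_eq_iff)
qed

section \<open>Coherences of the Redfield generator\<close>

text \<open>Graphs of everywhere defined functions. When all operators are bounded the generator is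
  one of them, and \<open>app\<close> can evaluate it.\<close>

definition fun_op :: "('a ell2 \<Rightarrow> 'a ell2) \<Rightarrow> 'a op" where
  "fun_op f = {(x, f x) | x. True}"

lemma fun_op_iff: "(x, y) \<in> fun_op f \<longleftrightarrow> y = f x"
  by (auto simp: fun_op_def)

lemma fun_op_times: "fun_op f \<cdot> fun_op g = fun_op (\<lambda>x. f (g x))"
  and fun_op_plus: "fun_op f \<oplus> fun_op g = fun_op (\<lambda>x. f x + g x)"
  and fun_op_scale: "c \<odot> fun_op f = fun_op (\<lambda>x. c *\<^sub>C f x)"
  by (auto simp: fun_op_def op_times_def op_plus_def op_scale_def)

lemma fun_op_sum: "op_sum J (\<lambda>j. fun_op (f j)) = fun_op (\<lambda>x. \<Sum>j\<in>J. f j x)"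
proof (rule set_eqI, clarify)
  fix x y
  have "(\<exists>h. y = sum h J \<and> (\<forall>j\<in>J. h j = f j x)) \<longleftrightarrow> y = (\<Sum>j\<in>J. f j x)"
    by (metis (no_types, lifting) sum.cong)
  then show "(x, y) \<in> op_sum J (\<lambda>j. fun_op (f j)) \<longleftrightarrow> (x, y) \<in> fun_op (\<lambda>x. \<Sum>j\<in>J. f j x)"
    by (simp add: op_sum_def fun_op_iff)
qed

lemma fun_op_commutator: "commutator (fun_op f) (fun_op g) = fun_op (\<lambda>x. f (g x) - g (f x))"
  by (simp add: commutator_def fun_op_times fun_op_scale fun_op_plus)

lemma mono_op_fun: "bounded (range w) \<Longrightarrow> bij p \<Longrightarrow> mono_op w p = fun_op (mono_vec w p)"
  by (auto simp: mono_op_bounded_iff fun_op_iff)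

text \<open>In the common eigenbasis of the Hamiltonian and the coupling operators, pure dephasing
  multiplies each matrix element of the state by a number. The bias is read off from one such
  factor.\<close>

lemma redfield_coherence:
  fixes e :: "'a \<Rightarrow> real" and lam :: "nat \<Rightarrow> 'a \<Rightarrow> real"
  assumes e: "bounded (range (\<lambda>i. complex_of_real (e i)))"
    and lam: "\<And>j. bounded (range (\<lambda>i. complex_of_real (lam j i)))"
    and s: "\<And>c x. s (c *\<^sub>C x) = c *\<^sub>C s x"
    and R: "R = redfield hbar (mono_op (\<lambda>i. of_real (e i)) id) m (\<lambda>j. mono_op (\<lambda>i. of_real (lam j i)) id)
      \<mu> C t (fun_op s)"
  shows "amp (app R (ket k)) n =
    ((- \<i> / of_real hbar) * of_real (e n - e k)
     + (- \<i> / of_real hbar) * (\<Sum>j<m. \<mu> j * of_real (lam j n - lam j k))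
     + (- 1 / of_real (hbar\<^sup>2)) * (\<Sum>(j, l)\<in>{..<m} \<times> {..<m}. of_real (lam j n - lam j k) *
         (integral {0..t} (C j l) * of_real (lam l n) - cnj (integral {0..t} (C j l)) * of_real (lam l k))))
    * amp (s (ket k)) n"
proof -
  define H where "H = mono_vec (\<lambda>i. complex_of_real (e i)) id"
  define L where "L j = mono_vec (\<lambda>i. complex_of_real (lam j i)) id" for j
  define A where "A j l = integral {0..t} (C j l)" for j l
  have H: "amp (H x) i = of_real (e i) * amp x i" "H (ket k) = of_real (e k) *\<^sub>C ket k" for x i k
    unfolding H_def by (auto intro!: ell2_eqI simp: amp_mono_vec e)
  have L: "amp (L j x) i = of_real (lam j i) * amp x i" "L j (ket k) = of_real (lam j k) *\<^sub>C ket k" for j x i k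
    unfolding L_def by (auto intro!: ell2_eqI simp: amp_mono_vec lam)
  have Lc: "L j (c *\<^sub>C x) = c *\<^sub>C L j x" for j c x
    by (auto intro!: ell2_eqI simp: L)
  have "R = fun_op (\<lambda>x. (- \<i> / of_real hbar) *\<^sub>C (H (s x) - s (H x))
      + (- \<i> / of_real hbar) *\<^sub>C (\<Sum>j<m. \<mu> j *\<^sub>C (L j (s x) - s (L j x)))
      + (- 1 / of_real (hbar\<^sup>2)) *\<^sub>C (\<Sum>(j, l)\<in>{..<m} \<times> {..<m}.
          A j l *\<^sub>C (L j (L l (s x)) - L l (s (L j x))) + cnj (A j l) *\<^sub>C (s (L l (L j x)) - L j (s (L l x)))))"
    unfolding R redfield_def Let_def mono_op_fun[OF e bij_id] mono_op_fun[OF lam bij_id]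
      H_def[symmetric] L_def[symmetric] A_def[symmetric]
    by (simp add: fun_op_times fun_op_commutator fun_op_scale fun_op_plus fun_op_sum case_prod_unfold)
  then have "app R (ket k) = (- \<i> / of_real hbar) *\<^sub>C (H (s (ket k)) - s (H (ket k)))
      + (- \<i> / of_real hbar) *\<^sub>C (\<Sum>j<m. \<mu> j *\<^sub>C (L j (s (ket k)) - s (L j (ket k))))
      + (- 1 / of_real (hbar\<^sup>2)) *\<^sub>C (\<Sum>(j, l)\<in>{..<m} \<times> {..<m}.
          A j l *\<^sub>C (L j (L l (s (ket k))) - L l (s (L j (ket k)))) +
          cnj (A j l) *\<^sub>C (s (L l (L j (ket k))) - L j (s (L l (ket k)))))"
    by (simp add: app_def fun_op_iff)
  then show ?thesis
    by (simp only: amp_ops amp_scaleC amp_sum H L Lc s case_prod_unfold A_def[symmetric] sum_distrib_right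
        distrib_right scaleC_scaleC of_real_diff)
       (simp add: algebra_simps sum_distrib_left sum_distrib_right sum_subtractf sum.distrib)
qed

section \<open>Pure states as density operators\<close>

definition rank_one :: "'a ell2 \<Rightarrow> 'a op" where
  "rank_one v = fun_op (\<lambda>x. cinner v x *\<^sub>C v)"

lemma rank_one_nuclear:
  "rank_one v = nuclear_op (\<lambda>n. if n = 0 then v else 0) (\<lambda>n. if n = 0 then v else 0)"
proof (rule set_eqI, clarify)
  fix x y
  have "(\<lambda>n. cinner (if n = 0 then v else 0) x *\<^sub>C (if n = 0 then v else 0)) sums (cinner v x *\<^sub>C v)"
    using sums_If_finite_set[of "{0::nat}" "\<lambda>_. cinner v x *\<^sub>C v"] by (simp add: if_distrib cong: if_cong)
  then show "(x, y) \<in> rank_one v \<longleftrightarrow>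
      (x, y) \<in> nuclear_op (\<lambda>n. if n = 0 then v else 0) (\<lambda>n. if n = 0 then v else 0)"
    unfolding rank_one_def fun_op_iff nuclear_op_def using sums_unique2 by blast
qed

lemma density_rank_one:
  assumes "norm v = 1" shows "density_op (rank_one v)"
proof -
  let ?\<alpha> = "\<lambda>n::nat. if n = 0 then v else 0"
  have s: "summable (\<lambda>n. norm (?\<alpha> n) * norm (?\<alpha> n))"
    by (rule summable_finite[of "{0}"]) auto
  have "(\<Sum>n. cinner (?\<alpha> n) (?\<alpha> n)) = (\<Sum>n\<in>{0}. cinner (?\<alpha> n) (?\<alpha> n))"
    by (rule suminf_finite) auto
  then have "op_trace (rank_one v) = 1"
    unfolding rank_one_nuclear op_trace_nuclear[OF s] by (simp add: cinner_norm_sq assms)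
  moreover have "cinner x (cinner v x *\<^sub>C v) = of_real ((cmod (cinner v x))\<^sup>2)" for x
    using cinner_commute[of x v] by (simp add: cinner_scaleC_right complex_norm_square del: of_real_power)
  ultimately show ?thesis
    using trace_class_nuclear[OF s] unfolding density_op_def
    by (auto simp: rank_one_nuclear[symmetric]) (auto simp: rank_one_def fun_op_iff)
qed

lemma conj_rank_one: "unitary U \<Longrightarrow> conj_op U (rank_one v) = rank_one (U v)"
  by (simp add: rank_one_nuclear conj_nuclear_op if_distrib unitary_zero cong: if_cong)

section \<open>A CP-conductive bath\<close>

text \<open>\<open>f\<close> is CP and \<open>(s, g)\<close> is time reversal on the labels of an eigenbasis of the bath. The
  surroundings shift the bath levels by the CP-odd \<open>\<plusminus>q\<close>; the CP-odd \<open>\<eta>\<close> marks the transitions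
  \<open>i \<leftrightarrow> p i\<close> to which the system couples. The shift makes the transitions with \<open>\<eta> = 1\<close> resonant
  and leaves those with \<open>\<eta> = -1\<close> off resonance by \<open>\<omega>\<close>, so the correlation of an even with an odd
  coupling operator no longer cancels.\<close>

lemma cp_cpt_invariant_mono:
  assumes u: "\<And>i. cmod (u i) = 1" "bij f" "\<And>i. f (p i) = p (f i)" "\<And>i. u i * w (f i) * cnj (u (p i)) = w i"
    and v: "\<And>i. cmod (v i) = 1" "bij g" "\<And>i. g (p i) = p (g i)" "\<And>i. v i * cnj (w (g i)) * cnj (v (p i)) = w i"
  shows "cp_cpt_invariant (mono_vec u f) (mono_cvec v g) (mono_op w p)"
  unfolding cp_cpt_invariant_def conj_op_comp
  using conj_mono_op[of u f p p w] conj_mono_cvec[of v g p p w] u v by simp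

lemma sign_sq: "r = 1 \<or> r = - 1 \<Longrightarrow> complex_of_real r * of_real r = 1"
  by auto

text \<open>\<open>p_moves\<close> gives the coupling operators a zero diagonal and hence zero
  means, leaving only correlations; \<open>finite_\<eta>\<close> makes these finite sums of phases.
  \<open>sp\<close> lets real coupling weights be invariant under a time reversal with signs
  \<open>s\<close>. \<open>q_bounded\<close> makes the shift bounded, so that it does not reduce the
  domain of the sum.\<close>

locale conductive_bath =
  fixes hbar kB temp \<omega> :: real and E :: "'b \<Rightarrow> real" and f g p :: "'b \<Rightarrow> 'b" and s \<eta> q :: "'b \<Rightarrow> real"
  assumes hbar: "hbar > 0" and \<omega>: "\<omega> > 0"
    and f: "\<And>i. f (f i) = i" and g: "\<And>i. g (g i) = i" and p: "\<And>i. p (p i) = i"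
    and fp: "\<And>i. f (p i) = p (f i)" and gp: "\<And>i. g (p i) = p (g i)"
    and Ef: "\<And>i. E (f i) = E i" and Eg: "\<And>i. E (g i) = E i"
    and s: "\<And>i. s i = 1 \<or> s i = - 1" and sp: "\<And>i. s (p i) = s i"
    and \<eta>: "\<And>i. \<eta> i = 1 \<or> \<eta> i = - 1 \<or> \<eta> i = 0"
    and \<eta>f: "\<And>i. \<eta> (f i) = - \<eta> i" and \<eta>g: "\<And>i. \<eta> (g i) = \<eta> i" and \<eta>p: "\<And>i. \<eta> (p i) = \<eta> i"
    and finite_\<eta>: "finite {i. \<eta> i \<noteq> 0}" and ex_\<eta>: "\<exists>i. \<eta> i = 1"
    and qf: "\<And>i. q (f i) = - q i" and qg: "\<And>i. q (g i) = q i"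
    and q_bounded: "\<exists>C. \<forall>i. \<bar>q i\<bar> \<le> C"
    and p_moves: "\<And>i. \<eta> i \<noteq> 0 \<Longrightarrow> p i \<noteq> i"
    and resonant: "\<And>i. \<eta> i = 1 \<Longrightarrow> E (p i) + q (p i) = E i + q i"
    and detuned: "\<And>i. \<eta> i = - 1 \<Longrightarrow> \<bar>E (p i) + q (p i) - (E i + q i)\<bar> = \<omega>"
    and summable: "(\<lambda>i. exp (- E i / (kB * temp))) summable_on UNIV"
begin

definition bath :: "'b sector" where
  "bath = \<lparr>ham = diag_op ket E, cp = mono_vec (\<lambda>_. 1) f, trev = mono_cvec (\<lambda>i. of_real (s i)) g\<rparr>"

text \<open>CP fixes the state \<open>0\<close> and exchanges \<open>1\<close> with
  \<open>-1\<close>. A zero Hamiltonian leaves the environment as the only source of coherence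
  dynamics.\<close>

definition system :: "3 sector" where
  "system = \<lparr>ham = diag_op ket (\<lambda>_. 0), cp = mono_vec (\<lambda>_. 1) uminus, trev = mono_cvec (\<lambda>_. 1) id\<rparr>"

definition surroundings :: "2 sector" where
  "surroundings = \<lparr>ham = diag_op ket (\<lambda>_. 0), cp = mono_vec (\<lambda>_. 1) (\<lambda>i. 1 - i), trev = mono_cvec (\<lambda>_. 1) id\<rparr>"

text \<open>One even and one odd observable, both separating \<open>0\<close> from \<open>1\<close>;
  the coherence between these two states therefore contains the mixed terms.\<close>

definition lam :: "nat \<Rightarrow> 3 \<Rightarrow> real" where
  "lam j n = (if j = 0 then of_bool (n = 0) else of_bool (n = 1) - of_bool (n = - 1))"

text \<open>The square confines the even operator to the transitions marked by the odd one. As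
  \<eta> takes the values 0, 1 and -1, a mixed product has weight \<eta>.\<close>

definition vw :: "nat \<Rightarrow> 'b \<Rightarrow> real" where
  "vw j i = (if j = 0 then (\<eta> i)\<^sup>2 else \<eta> i)"

definition coup :: "(3, 'b) coupling" where
  "coup = \<lparr>num = 2, sys_op = (\<lambda>j. diag_op ket (lam j)), bath_op = (\<lambda>j. mono_op (\<lambda>i. of_real (vw j i)) p),
     parity = (\<lambda>j. if j = 0 then 1 else - 1)\<rparr>"

definition sg :: "2 \<Rightarrow> real" where "sg k = (if k = 0 then 1 else - 1)"

text \<open>Both factors are CP-odd, so the product is CP-invariant as an interaction must be. On
  the state \<open>0\<close> of the surroundings it acts as the CP-odd \<open>q\<close>.\<close>

definition shift :: "('b \<times> 2) op" where
  "shift = mono_op (\<lambda>x. of_real (q (fst x) * sg (snd x))) id"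

definition Z :: real where "Z = (\<Sum>\<^sub>\<infinity>i. exp (- E i / (kB * temp)))"

definition gibbs :: "'b \<Rightarrow> real" where "gibbs i = exp (- E i / (kB * temp)) / Z"

definition \<rho>\<^sub>B :: "'b op" where "\<rho>\<^sub>B = mono_op (\<lambda>i. of_real (gibbs i)) id"

text \<open>The bath stays in its exact Gibbs state and only the surroundings are unbalanced. A
  diagonal state is stationary for the diagonal Hamiltonian, although it is not the Gibbs state of
  that Hamiltonian.\<close>

definition \<rho> :: "('b \<times> 2) op" where
  "\<rho> = mono_op (\<lambda>x. of_real (gibbs (fst x) * of_bool (snd x = 0))) id"

section \<open>Admissibility of the example\<close>

lemma bij_f: "bij f" and bij_g: "bij g" and bij_p: "bij p"
  using f g p by (auto intro: involuntory_imp_bij)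

lemma abs_s: "\<bar>s i\<bar> = 1"
  using s[of i] by auto

lemma Z_pos: "Z > 0"
proof -
  have "exp (- E undefined / (kB * temp)) \<le> Z"
    using finite_sum_le_infsum[OF summable, of "{undefined}"] by (simp add: Z_def)
  then show ?thesis using exp_gt_zero less_le_trans by blast
qed

lemma gibbs_pos: "gibbs i > 0" by (simp add: gibbs_def Z_pos)

lemma gibbs_has_sum: "(gibbs has_sum 1) UNIV"
  using has_sum_cmult_left[OF has_sum_infsum[OF summable], of "1 / Z"] Z_pos
  unfolding Z_def[symmetric] gibbs_def[abs_def] by simp

lemma gibbs_state_\<rho>\<^sub>B: "gibbs_state kB temp (ham bath) \<rho>\<^sub>B"
proof -
  define X where "X = diag_op ket (\<lambda>k. exp (- E k / (kB * temp)))"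
  have sum: "(\<lambda>i. cmod (of_real (exp (- E i / (kB * temp))))) summable_on UNIV" using summable by simp
  have "(\<Sum>\<^sub>\<infinity>i. complex_of_real (exp (- E i / (kB * temp)))) = of_real Z"
    unfolding Z_def by (intro infsumI has_sum_of_real has_sum_infsum summable)
  then have tr: "op_trace X = of_real Z" using sum by (simp add: X_def diag_op_ket op_trace_mono_op)
  have "trace_class X" using sum by (simp add: X_def diag_op_ket trace_class_mono_op)
  moreover have "\<rho>\<^sub>B = (1 / op_trace X) \<odot> X"
    using Z_pos unfolding tr by (simp add: X_def diag_op_ket mono_op_scale \<rho>\<^sub>B_def gibbs_def)
  ultimately show ?thesis
    unfolding gibbs_state_def bath_def using orthonormal_basis_ket X_def by auto
qed

lemma abs_vw_le: "\<bar>vw j i\<bar> \<le> 1"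
  using \<eta>[of i] by (auto simp: vw_def)

lemma bounded_range_real: "(\<And>i. \<bar>r i\<bar> \<le> C) \<Longrightarrow> bounded (range (\<lambda>i. complex_of_real (r i)))"
  by (auto simp: bounded_iff)

lemma abs_lam_le: "\<bar>lam j n\<bar> \<le> 1"
  by (simp add: lam_def)

lemma bounded_lam: "bounded (range (\<lambda>i. complex_of_real (lam j i)))"
  by (rule bounded_range_real[of _ 1]) (rule abs_lam_le)

lemma sectors_ok: "sector_ok bath" "sector_ok system" "sector_ok surroundings"
proof -
  have "bij (uminus :: 3 \<Rightarrow> 3)" by (rule involuntory_imp_bij) simp
  moreover have "bij (\<lambda>i :: 2. 1 - i)" by (rule involuntory_imp_bij) simp
  ultimately show "sector_ok bath" "sector_ok system" "sector_ok surroundings"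
    unfolding sector_ok_def bath_def system_def surroundings_def diag_op_ket sector.simps
    using s by (auto intro!: self_adjoint_mono_op unitary_mono_vec antiunitary_mono_cvec bij_f bij_g
        cp_cpt_invariant_mono simp: Ef Eg abs_s sign_sq)
qed

lemma bij_pair: "bij (map_prod id p)" "bij (map_prod p id)"
  by (simp_all add: bij_map_prod bij_p)

lemma interaction_coup:
  "interaction coup = mono_op (\<lambda>x. of_real (lam 0 (fst x) * vw 0 (snd x) + lam 1 (fst x) * vw 1 (snd x)))
     (map_prod id p)"
proof -
  have b: "bounded (range (\<lambda>x :: 3 \<times> 'b. complex_of_real (vw j (snd x))))" for j
    by (rule bounded_range_real[of _ 1]) (rule abs_vw_le)
  have "ext1 (sys_op coup j) \<cdot> ext2 (bath_op coup j) =
      mono_op (\<lambda>x. of_real (lam j (fst x) * vw j (snd x))) (map_prod id p)" for j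
    unfolding coup_def coupling.simps diag_op_ket ext1_mono_op ext2_mono_op
    by (subst mono_op_times[OF b bij_pair(1)]) (simp add: prod.map_id0)
  moreover have "bounded (range (\<lambda>x :: 3 \<times> 'b. complex_of_real (lam j (fst x) * vw j (snd x))))" for j
    using mult_mono[of "\<bar>lam j _\<bar>" 1 "\<bar>vw j _\<bar>" 1]
    by (intro bounded_range_real[of _ 1]) (simp add: abs_mult abs_vw_le abs_lam_le)
  ultimately show ?thesis
    unfolding interaction_def
    by (simp add: coup_def mono_op_sum bij_pair lessThan_Suc numeral_2_eq_2 add.commute)
qed

lemma coupling_ok_coup: "coupling_ok system bath coup"
proof -
  have bij: "bij (uminus :: 3 \<Rightarrow> 3)" by (rule involuntory_imp_bij) simp
  have vw: "vw j (p i) = vw j i" "vw j (g i) = vw j i" "vw j (f i) = parity coup j * vw j i" for j i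
    by (simp_all add: vw_def coup_def \<eta>p \<eta>g \<eta>f)
  have lam: "lam j (- n) = parity coup j * lam j n" for j n
    by (auto simp: lam_def coup_def minus_equation_iff[of n] equation_minus_iff)
  have par: "parity coup j = 1 \<or> parity coup j = - 1" for j by (simp add: coup_def)
  have parsq: "parity coup j * parity coup j = 1" for j by (simp add: coup_def)
  have "conj_op (cp system) (sys_op coup j) = of_real (parity coup j) \<odot> sys_op coup j" for j
    using par[of j] conj_mono_op[OF _ bij, of "\<lambda>_. 1" id id "\<lambda>i. complex_of_real (lam j i)"]
    by (auto simp: system_def coup_def diag_op_ket mono_op_scale lam)
  moreover have "conj_op (cp bath) (bath_op coup j) = of_real (parity coup j) \<odot> bath_op coup j" for j
    using par[of j] conj_mono_op[OF _ bij_f, of "\<lambda>_. 1" p p "\<lambda>i. complex_of_real (vw j i)"]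
    by (auto simp: bath_def coup_def mono_op_scale vw fp)
  moreover have "self_adjoint (sys_op coup j)" "self_adjoint (bath_op coup j)" for j
    unfolding coup_def coupling.simps diag_op_ket by (auto intro!: self_adjoint_mono_op p simp: vw)
  moreover have "hermitian (interaction coup)"
    unfolding interaction_coup by (intro self_adjoint_hermitian self_adjoint_mono_op) (auto simp: p vw)
  moreover have "cp_cpt_invariant (tensor_unitary (cp system) (cp bath))
      (tensor_antiunitary (trev system) (trev bath)) (interaction coup)"
  proof -
    define W where "W x = lam 0 (fst x) * vw 0 (snd x) + lam 1 (fst x) * vw 1 (snd x)" for x
    \<comment> \<open>The parities of the system factor and of the bath factor multiply to
      1.\<close>
    have "lam j (- n) * vw j (f i) = lam j n * vw j i" for j n i
      using parsq[of j] by (simp add: lam vw)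
    then have Wf: "W (map_prod uminus f x) = W x" for x by (simp only: W_def fst_map_prod snd_map_prod)
    have Wg: "W (map_prod id g x) = W x" for x by (simp add: W_def vw)
    have "cp_cpt_invariant (mono_vec (\<lambda>x. 1 * 1) (map_prod uminus f))
        (mono_cvec (\<lambda>x. 1 * of_real (s (snd x))) (map_prod id g)) (interaction coup)"
      unfolding interaction_coup W_def[symmetric]
    proof (rule cp_cpt_invariant_mono)
      fix x
      show "1 * complex_of_real (s (snd x)) * cnj (of_real (W (map_prod id g x))) *
          cnj (1 * of_real (s (snd (map_prod id p x)))) = of_real (W x)"
        using s[of "snd x"] by (auto simp: Wg sp)
    qed (auto simp: bij_map_prod bij bij_f bij_g fp gp abs_s Wf)
    then show ?thesis
      by (simp add: system_def bath_def tensor_unitary_mono tensor_antiunitary_mono bij bij_f bij_g abs_s s)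
  qed
  moreover have "\<exists>v. sys_op coup j = diag_op ket v" for j unfolding coup_def by auto
  ultimately show ?thesis
    unfolding coupling_ok_def using par orthonormal_basis_ket
    by (auto simp: system_def intro!: exI[of _ ket])
qed

definition level :: "'b \<times> 2 \<Rightarrow> real" where "level x = E (fst x) + q (fst x) * sg (snd x)"

lemma bounded_shift: "bounded (range (\<lambda>x. complex_of_real (q (fst x) * sg (snd x))))"
proof -
  obtain C where "\<And>i. \<bar>q i\<bar> \<le> C" using q_bounded by blast
  then show ?thesis by (intro bounded_range_real[of _ C]) (simp add: sg_def abs_mult)
qed

lemma env_ham_eq: "env_ham bath surroundings shift = mono_op (\<lambda>x. of_real (level x)) id"
proof -
  have "ext1 (ham bath) \<oplus> ext2 (ham surroundings) \<oplus> shift = mono_op (\<lambda>x. of_real (level x)) id"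
    unfolding bath_def surroundings_def sector.simps diag_op_ket ext1_mono_op ext2_mono_op shift_def
    using bounded_shift by (simp add: mono_op_plus level_def prod.map_id0)
  then show ?thesis unfolding env_ham_def by (simp add: closed_mono_op closure_closed)
qed

lemma self_adjoint_env: "self_adjoint (env_ham bath surroundings shift)"
  unfolding env_ham_eq by (rule self_adjoint_mono_op) auto

lemma sum_UNIV_2: "(\<Sum>k\<in>UNIV. h k) = h 0 + h (1 :: 2)" for h :: "2 \<Rightarrow> 'c :: comm_monoid_add"
proof -
  have "x = 0 \<or> x = 1" for x :: 2 using exhaust_2[of x] by auto
  then have UNIV: "(UNIV :: 2 set) = {0, 1}" by blast
  show ?thesis unfolding UNIV by simp
qed

definition weight :: "'b \<times> 2 \<Rightarrow> real" where "weight x = gibbs (fst x) * of_bool (snd x = 0)"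

lemma weight_nonneg: "weight x \<ge> 0" using gibbs_pos by (simp add: weight_def less_imp_le)

lemma weight_has_sum: "(weight has_sum 1) UNIV"
proof -
  have "((weight \<circ> (\<lambda>i. (i, 0))) has_sum 1) UNIV"
    using gibbs_has_sum by (simp add: o_def weight_def)
  then have "(weight has_sum 1) (range (\<lambda>i. (i, 0)))"
    by (subst has_sum_reindex) (auto intro: injI)
  then show ?thesis
    by (rule has_sum_cong_neutral[THEN iffD1, rotated -1]) (auto simp: weight_def image_iff)
qed

lemma summable_weight: "(\<lambda>x. cmod (of_real (weight x))) summable_on UNIV"
  using weight_has_sum weight_nonneg by (auto simp: summable_on_def)

lemma \<rho>_eq: "\<rho> = mono_op (\<lambda>x. of_real (weight x)) id"
  by (simp add: \<rho>_def weight_def)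

lemma summable_gibbs: "(\<lambda>i. cmod (of_real (gibbs i))) summable_on UNIV"
  using gibbs_has_sum gibbs_pos by (auto simp: summable_on_def less_imp_le)

lemma environment_ok: "environment_ok bath surroundings shift \<rho>"
proof -
  have bij: "bij (\<lambda>i :: 2. 1 - i)" by (rule involuntory_imp_bij) simp
  have sg: "sg (1 - k) = - sg k" for k using exhaust_2[of k] by (auto simp: sg_def)
  have "cp_cpt_invariant (mono_vec (\<lambda>x. 1 * 1) (map_prod f (\<lambda>i :: 2. 1 - i)))
      (mono_cvec (\<lambda>x. of_real (s (fst x)) * 1) (map_prod g id)) shift"
    unfolding shift_def using s
    by (intro cp_cpt_invariant_mono)
      (auto simp: bij_map_prod bij bij_f bij_g qf qg sg abs_s sign_sq)
  then have "cp_cpt_invariant (tensor_unitary (cp bath) (cp surroundings))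
      (tensor_antiunitary (trev bath) (trev surroundings)) shift"
    by (simp add: surroundings_def bath_def tensor_unitary_mono tensor_antiunitary_mono bij bij_f bij_g abs_s s)
  moreover have "hermitian shift"
    unfolding shift_def by (intro self_adjoint_hermitian self_adjoint_mono_op) auto
  moreover have "density_op \<rho>"
    unfolding \<rho>_eq by (rule density_op_diag[OF weight_has_sum weight_nonneg])
  moreover have "commutes_with \<rho> (env_ham bath surroundings shift)"
    unfolding \<rho>_eq env_ham_eq by (rule commutes_with_diag[OF bounded_range_summable[OF summable_weight]])
  ultimately show ?thesis
    unfolding environment_ok_def using sectors_ok self_adjoint_env by blast
qed

lemma app_\<rho>: "amp (app \<rho> z) x = of_real (weight x) * amp z x"
  unfolding \<rho>_eq by (simp add: app_mono_op bounded_range_summable[OF summable_weight] amp_mono_vec)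

lemma ptrace2_\<rho>: "ptrace2 \<rho> = \<rho>\<^sub>B"
proof (rule set_eqI, clarify)
  fix x y
  have "((\<lambda>j. amp (app \<rho> (x \<otimes> ket j)) (i, j)) has_sum of_real (gibbs i) * amp x i) UNIV" for i
    by (rule has_sum_finiteI) (simp_all add: app_\<rho> sum_UNIV_2 weight_def)
  then show "(x, y) \<in> ptrace2 \<rho> \<longleftrightarrow> (x, y) \<in> \<rho>\<^sub>B"
    unfolding ptrace2_def \<rho>\<^sub>B_def mono_op_iff using has_sum_unique by (fastforce simp: id_def)
qed

lemma ptrace1_\<rho>: "ptrace1 \<rho> = mono_op (\<lambda>j. of_bool (j = 0)) id"
proof (rule set_eqI, clarify)
  fix x y :: "2 ell2"
  have "((\<lambda>i. amp (app \<rho> (ket i \<otimes> x)) (i, j)) has_sum of_bool (j = 0) * amp x j) UNIV" for j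
    using has_sum_cmult_left[OF has_sum_of_real[OF gibbs_has_sum, where 'a = complex], of "amp x j"]
    by (cases "j = 0") (simp_all add: app_\<rho> weight_def)
  then show "(x, y) \<in> ptrace1 \<rho> \<longleftrightarrow> (x, y) \<in> mono_op (\<lambda>j. of_bool (j = 0)) id"
    unfolding ptrace1_def mono_op_iff using has_sum_unique by (fastforce simp: id_def)
qed

lemma unbalanced: "\<not> cp_balanced (cp surroundings) (ptrace1 \<rho>)"
proof
  have bij: "bij (\<lambda>i :: 2. 1 - i)" by (rule involuntory_imp_bij) simp
  assume "cp_balanced (cp surroundings) (ptrace1 \<rho>)"
  then have "mono_op (\<lambda>j :: 2. of_bool (1 - j = 0)) id = mono_op (\<lambda>j. of_bool (j = 0)) id"
    using conj_mono_op[OF _ bij, of "\<lambda>_. 1" id id "\<lambda>j. of_bool (j = 0)"]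
    by (simp add: cp_balanced_def ptrace1_\<rho> surroundings_def)
  moreover have "(ket 0, ket 0) \<in> mono_op (\<lambda>j :: 2. of_bool (j = 0)) id" by (simp add: mono_op_iff)
  ultimately have "(ket 0, ket 0) \<in> mono_op (\<lambda>j :: 2. of_bool (1 - j = 0)) id" by simp
  then show False by (auto simp: mono_op_iff dest: spec[of _ 0])
qed

section \<open>Correlation functions of the environment\<close>

abbreviation "P \<equiv> propagator hbar (env_ham bath surroundings shift)"

lemma generates_P: "generates hbar (env_ham bath surroundings shift)
    (\<lambda>t. mono_vec (\<lambda>x. cis (- (level x * t / hbar))) id)"
  unfolding env_ham_eq by (rule generates_diag[OF hbar])

lemma P_eq: "P t = mono_vec (\<lambda>x. cis (- (level x * t / hbar))) id"
  by (simp add: propagator_eqI[OF self_adjoint_env generates_P])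

definition nu :: "'b \<Rightarrow> real" where "nu i = (level (p i, 0) - level (i, 0)) / hbar"

text \<open>\<open>p\<close> is an involution, so a transition followed by its return is diagonal;
  each one contributes a phase turning with the level difference. Summability is inherited from the
  state, as the coupling weights are at most 1 in modulus.\<close>

lemma product_eq:
  "ext1 (bath_op coup j) \<cdot> conj_op (P \<tau>) (ext1 (bath_op coup l)) \<cdot> \<rho> =
    mono_op (\<lambda>x. of_real (vw j (fst x) * vw l (fst x) * weight x) *
      cis (- ((level (map_prod p id x) - level x) / hbar * \<tau>))) id" (is "?L = mono_op ?w id")
  and summable_product: "(\<lambda>x. cmod (of_real (vw j (fst x) * vw l (fst x) * weight x) *
      cis (- ((level (map_prod p id x) - level x) / hbar * \<tau>)))) summable_on UNIV"
proof -
  let ?r = "map_prod p id :: 'b \<times> 2 \<Rightarrow> _"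
  define u where "u x = cis (- (level x * \<tau> / hbar))" for x
  have Pu: "P \<tau> = mono_vec u id" unfolding P_eq u_def[abs_def] ..
  have u: "cmod (u x) = 1" for x by (simp add: u_def)
  have V: "ext1 (bath_op coup j) = mono_op (\<lambda>x. of_real (vw j (fst x))) ?r" for j
    by (simp add: coup_def ext1_mono_op)
  have b: "bounded (range (\<lambda>x :: 'b \<times> 2. complex_of_real (vw j (fst x))))" for j
    by (rule bounded_range_real[of _ 1]) (rule abs_vw_le)
  have "conj_op (P \<tau>) (ext1 (bath_op coup l)) = mono_op (\<lambda>x. u x * of_real (vw l (fst x)) * cnj (u (?r x))) ?r"
    using conj_mono_op[of u id ?r ?r "\<lambda>x. of_real (vw l (fst x))"] by (simp add: Pu V u)
  moreover
  have "bounded (range (\<lambda>x. u x * of_real (vw l (fst x)) * cnj (u (?r x))))"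
    using b[of l] by (auto simp: bounded_iff norm_mult u)
  ultimately have "ext1 (bath_op coup j) \<cdot> conj_op (P \<tau>) (ext1 (bath_op coup l)) \<cdot> \<rho> =
      mono_op (\<lambda>x. of_real (vw j (fst x)) * (u (?r x) * of_real (vw l (p (fst x))) * cnj (u (?r (?r x)))) *
        of_real (weight (?r (?r x)))) (?r \<circ> ?r)"
    unfolding V \<rho>_eq
    by (simp add: mono_op_times bij_pair bounded_range_summable[OF summable_weight] o_def)
  moreover have rr: "?r (?r x) = x" for x by (cases x) (simp add: p)
  moreover have "of_real (vw j (fst x)) * (u (?r x) * of_real (vw l (p (fst x))) * cnj (u (?r (?r x)))) *
      of_real (weight (?r (?r x))) = ?w x" for x
  proof -
    have "vw l (p (fst x)) = vw l (fst x)" by (simp add: vw_def \<eta>p)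
    moreover have "cis (- ((level (?r x) - level x) / hbar * \<tau>)) = u (?r x) * cnj (u x)"
      by (simp add: u_def cis_cnj cis_mult diff_divide_distrib left_diff_distrib)
    ultimately show ?thesis by (simp only: rr of_real_mult mult_ac)
  qed
  moreover have "?r \<circ> ?r = id" by (simp add: fun_eq_iff p)
  ultimately show "?L = mono_op ?w id" by presburger
  show "(\<lambda>x. cmod (?w x)) summable_on UNIV"
  proof (rule summable_on_comparison_test[OF summable_weight])
    fix x
    have "\<bar>vw j (fst x)\<bar> * \<bar>vw l (fst x)\<bar> * \<bar>weight x\<bar> \<le> 1 * 1 * \<bar>weight x\<bar>"
      by (intro mult_right_mono mult_mono abs_vw_le) auto
    then show "cmod (?w x) \<le> cmod (of_real (weight x))"
      by (simp add: norm_mult abs_mult)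
  qed simp
qed

text \<open>The operator has no diagonal: wherever its weight is nonzero, \<open>p\<close> moves the
  index.\<close>

lemma mean_zero: "bath_mean coup (ptrace2 \<rho>) j = 0" and trace_class_mean: "trace_class (bath_op coup j \<cdot> ptrace2 \<rho>)"
proof -
  have eq: "bath_op coup j \<cdot> ptrace2 \<rho> = mono_op (\<lambda>i. of_real (vw j i * gibbs (p i))) p"
    by (simp add: ptrace2_\<rho> \<rho>\<^sub>B_def coup_def mono_op_times bounded_range_summable[OF summable_gibbs])
  have sum: "(\<lambda>i. cmod (of_real (vw j i * gibbs (p i)))) summable_on UNIV"
  proof (rule summable_on_comparison_test)
    show "(\<lambda>i. cmod (of_real (gibbs (p i)))) summable_on UNIV"
      using summable_gibbs summable_on_reindex_bij_betw[OF bij_p, of "\<lambda>i. cmod (of_real (gibbs i))"] by simp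
    show "cmod (of_real (vw j i * gibbs (p i))) \<le> cmod (of_real (gibbs (p i)))" for i
      using mult_right_mono[OF abs_vw_le[of j i], of "\<bar>gibbs (p i)\<bar>"] by (simp add: abs_mult norm_mult)
  qed simp
  show "trace_class (bath_op coup j \<cdot> ptrace2 \<rho>)"
    unfolding eq by (rule trace_class_mono_op[OF sum bij_p])
  have "(if p i = i then complex_of_real (vw j i * gibbs (p i)) else 0) = 0" for i
    using p_moves[of i] by (auto simp: vw_def)
  then show "bath_mean coup (ptrace2 \<rho>) j = 0"
    unfolding bath_mean_def eq op_trace_mono_op[OF sum bij_p] by simp
qed

text \<open>The weights vanish off the finitely many marked levels and the state vanishes off the
  label \<open>0\<close> of the surroundings, so the trace collapses to a finite sum; the subtracted
  means are zero.\<close>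

lemma env_corr_eq:
  "env_corr hbar bath surroundings shift coup \<rho> j l \<tau> =
    (\<Sum>i | \<eta> i \<noteq> 0. of_real (vw j i * vw l i * gibbs i) * cis (- nu i * \<tau>))"
proof -
  let ?h = "\<lambda>x. of_real (vw j (fst x) * vw l (fst x) * weight x) *
      cis (- ((level (map_prod p id x) - level x) / hbar * \<tau>))"
  have "env_corr hbar bath surroundings shift coup \<rho> j l \<tau> = (\<Sum>\<^sub>\<infinity>x. ?h x)"
    unfolding env_corr_def corr_def mean_zero product_eq op_trace_mono_op[OF summable_product bij_id] by simp
  also have "\<dots> = (\<Sum>\<^sub>\<infinity>x\<in>(\<lambda>i. (i, 0)) ` {i. \<eta> i \<noteq> 0}. ?h x)"
    by (rule infsum_cong_neutral) (auto simp: weight_def vw_def image_iff)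
  also have "\<dots> = (\<Sum>x\<in>(\<lambda>i. (i, 0)) ` {i. \<eta> i \<noteq> 0}. ?h x)"
    using finite_\<eta> by simp
  also have "\<dots> = (\<Sum>i | \<eta> i \<noteq> 0. ?h (i, 0))"
    by (subst sum.reindex) (auto intro: inj_onI)
  also have "\<dots> = (\<Sum>i | \<eta> i \<noteq> 0. of_real (vw j i * vw l i * gibbs i) * cis (- nu i * \<tau>))"
    by (simp add: weight_def nu_def)
  finally show ?thesis .
qed

lemma continuous_env_corr: "continuous_on X (env_corr hbar bath surroundings shift coup \<rho> j l)"
  unfolding env_corr_eq[abs_def] by (intro continuous_intros)

lemma trace_class_product:
  "trace_class (ext1 (bath_op coup j) \<cdot> conj_op (P \<tau>) (ext1 (bath_op coup l)) \<cdot> \<rho>)"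
  unfolding product_eq by (rule trace_class_mono_op[OF summable_product bij_id])

lemma moments_exist: "moments_exist hbar bath surroundings shift coup \<rho>"
  unfolding moments_exist_def
  using generates_P trace_class_mean trace_class_product
  by (auto intro!: integrable_continuous_real continuous_env_corr)

lemma cis_period_integral:
  assumes "a \<noteq> 0" "cis (a * t) = 1" "t \<ge> 0" shows "integral {0..t} (\<lambda>\<tau>. cis (a * \<tau>)) = 0"
proof -
  have "((\<lambda>\<tau>. cis (a * \<tau>)) has_integral (cis (a * t) / (\<i> * of_real a) - cis (a * 0) / (\<i> * of_real a))) {0..t}"
  proof (rule fundamental_theorem_of_calculus)
    fix x
    show "((\<lambda>\<tau>. cis (a * \<tau>) / (\<i> * of_real a)) has_vector_derivative cis (a * x)) (at x within {0..t})"
      using has_vector_derivative_mult_left[OF has_vector_derivative_cis[of a x "{0..t}"], of "1 / (\<i> * of_real a)"] assms(1)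
      by simp
  qed fact
  then show ?thesis using assms(2) by (simp add: integral_unique)
qed

text \<open>\<open>t\<close> is one period of the detuned phases, whose integral is then zero; a
  resonant phase is constant and contributes \<open>gibbs i * t\<close>. The condition
  \<open>j + l = 1\<close> selects the two mixed index pairs.\<close>

lemma integral_env_corr:
  assumes t: "t = 2 * pi * hbar / \<omega>" and jl: "j + l = 1"
  obtains a :: real where "a > 0" "integral {0..t} (env_corr hbar bath surroundings shift coup \<rho> j l) = of_real a"
proof -
  have tpos: "t > 0" using t hbar \<omega> by simp
  have vw: "vw j i * vw l i = \<eta> i" for i
  proof -
    have "j = 0 \<and> l = 1 \<or> j = 1 \<and> l = 0" using jl by linarith
    then show ?thesis using \<eta>[of i] by (auto simp: vw_def)
  qed
  have nu: "integral {0..t} (\<lambda>\<tau>. cis (- nu i * \<tau>)) = (if \<eta> i = 1 then of_real t else 0)" if "\<eta> i \<noteq> 0" for i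
  proof (cases "\<eta> i = 1")
    case True
    then have "nu i = 0" using resonant[OF True] by (simp add: nu_def level_def sg_def)
    then show ?thesis using True tpos by (simp add: scaleR_conv_of_real)
  next
    case False
    then have "\<eta> i = - 1" using \<eta>[of i] that by auto
    from detuned[OF this] have "\<bar>nu i\<bar> = \<omega> / hbar" using hbar by (simp add: nu_def level_def sg_def)
    then have "nu i = \<omega> / hbar \<or> nu i = - (\<omega> / hbar)" by linarith
    moreover have "cis (- (\<omega> / hbar) * t) = 1" "cis (\<omega> / hbar * t) = 1"
      using t hbar \<omega> by (simp_all add: cis.ctr complex_eq_iff)
    ultimately show ?thesis
      using False hbar \<omega> tpos by (subst cis_period_integral) auto
  qed
  have "integral {0..t} (env_corr hbar bath surroundings shift coup \<rho> j l) =
      (\<Sum>i | \<eta> i \<noteq> 0. integral {0..t} (\<lambda>\<tau>. of_real (\<eta> i * gibbs i) * cis (- nu i * \<tau>)))"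
    unfolding env_corr_eq[abs_def] vw
    by (intro integral_sum finite_\<eta> integrable_continuous_real continuous_intros)
  also have "\<dots> = (\<Sum>i | \<eta> i \<noteq> 0. of_real (if \<eta> i = 1 then gibbs i * t else 0))"
  proof (rule sum.cong[OF refl])
    fix i assume "i \<in> {i. \<eta> i \<noteq> 0}"
    then have "\<eta> i \<noteq> 0" by simp
    from nu[OF this] show "integral {0..t} (\<lambda>\<tau>. of_real (\<eta> i * gibbs i) * cis (- nu i * \<tau>)) =
        of_real (if \<eta> i = 1 then gibbs i * t else 0)"
      unfolding integral_mult_right by simp
  qed
  also have "\<dots> = of_real (\<Sum>i | \<eta> i \<noteq> 0. if \<eta> i = 1 then gibbs i * t else 0)"
    by simp
  finally have eq: "integral {0..t} (env_corr hbar bath surroundings shift coup \<rho> j l) =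
      of_real (\<Sum>i | \<eta> i \<noteq> 0. if \<eta> i = 1 then gibbs i * t else 0)" .
  obtain i0 where i0: "\<eta> i0 = 1" using ex_\<eta> by blast
  have "0 < (\<Sum>i | \<eta> i \<noteq> 0. if \<eta> i = 1 then gibbs i * t else 0)"
    by (rule sum_pos2[OF finite_\<eta>, of i0]) (use i0 tpos gibbs_pos in \<open>auto simp: less_imp_le\<close>)
  then show thesis using eq that by blast
qed

lemma bias: "apparent_cp_bias (cp system) (redfield_env hbar system bath surroundings shift coup \<rho>)"
proof
  let ?C = "env_corr hbar bath surroundings shift coup \<rho>" and ?\<mu> = "bath_mean coup (ptrace2 \<rho>)"
  let ?R = "\<lambda>\<mu> C t. redfield hbar (ham system) (num coup) (sys_op coup) \<mu> C t"
  let ?\<zeta> = "parity coup"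
  define t where "t = 2 * pi * hbar / \<omega>"
  have t0: "t \<ge> 0" using hbar \<omega> by (simp add: t_def)
  obtain a where a: "a > 0" "integral {0..t} (?C 0 1) = of_real a" by (rule integral_env_corr[OF t_def, of 0 1]) simp_all
  obtain b where b: "b > 0" "integral {0..t} (?C 1 0) = of_real b" by (rule integral_env_corr[OF t_def, of 1 0]) simp_all
  have bij: "bij (uminus :: 3 \<Rightarrow> 3)" by (rule involuntory_imp_bij) simp
  have U: "unitary (cp system)" using sectors_ok(2) by (simp add: sector_ok_def)
  \<comment> \<open>A superposition of \<open>0\<close> and \<open>1\<close> has a nonzero coherence
    between them. Its CP preimage \<open>w\<close> is the state fed to the generator, so that both
    sides of covariance are evaluated at \<open>v\<close>.\<close>
  define v where "v = (1 / sqrt 2) *\<^sub>R (ket 0 + ket (1 :: 3))"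
  define w where "w = inv (cp system) v"
  have "(norm v)\<^sup>2 = 1"
  proof -
    have "cinner v v = 1"
      unfolding v_def by (simp add: cinner_add_left cinner_add_right cinner_scaleC_left cinner_scaleC_right
          amp_ops flip: scaleC_of_real of_real_mult)
    then show ?thesis by (simp add: cinner_norm_sq flip: of_real_power)
  qed
  then have "norm v = 1" by (simp add: power2_eq_1_iff) (metis norm_ge_zero not_one_le_zero neg_0_le_iff_le)
  then have dens: "density_op (rank_one w)"
    by (intro density_rank_one) (simp add: w_def norm_unitary unitary_inv U)
  have conj: "conj_op (cp system) (rank_one w) = rank_one v"
    by (simp add: conj_rank_one U w_def)
  have mu: "?\<mu> = (\<lambda>_. 0)" by (rule ext) (rule mean_zero)
  assume "apparently_cp_invariant (cp system) (redfield_env hbar system bath surroundings shift coup \<rho>)"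
  then have "conj_op (cp system) (?R ?\<mu> ?C t (rank_one w)) = ?R ?\<mu> ?C t (rank_one v)"
    unfolding apparently_cp_invariant_def redfield_env_def using t0 dens conj by auto
  moreover have "conj_op (cp system) (?R ?\<mu> ?C t (rank_one w)) =
      ?R (\<lambda>j. of_real (?\<zeta> j) * ?\<mu> j) (\<lambda>j l \<tau>. of_real (?\<zeta> j * ?\<zeta> l) * ?C j l \<tau>) t (conj_op (cp system) (rank_one w))"
    using coupling_ok_coup sectors_ok(2) dens
    by (intro redfield_covariant U) (auto simp: coupling_ok_def sector_ok_def cp_cpt_invariant_def)
  ultimately have eq: "?R (\<lambda>_. 0) ?C t (rank_one v) =
      ?R (\<lambda>_. 0) (\<lambda>j l \<tau>. of_real (?\<zeta> j * ?\<zeta> l) * ?C j l \<tau>) t (rank_one v)"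
    by (simp add: mu conj)
  have neg: "integral {0..t} (\<lambda>\<tau>. of_real (?\<zeta> j * ?\<zeta> l) * ?C j l \<tau>) =
      of_real (?\<zeta> j * ?\<zeta> l) * integral {0..t} (?C j l)" for j l
    using integral_cmul[of "{0..t}" "?\<zeta> j * ?\<zeta> l" "?C j l"] by (simp add: scaleR_conv_of_real)
  have coh: "amp (app (?R (\<lambda>_. 0) C t (rank_one v)) (ket 1)) 0 =
      (- 1 / of_real (hbar\<^sup>2)) * (\<Sum>(j, l)\<in>{..<2} \<times> {..<2}. of_real (lam j 0 - lam j 1) *
         (integral {0..t} (C j l) * of_real (lam l 0) - cnj (integral {0..t} (C j l)) * of_real (lam l 1)))
      * amp (cinner v (ket 1) *\<^sub>C v) 0" for C
    using redfield_coherence[where e="\<lambda>_. 0" and lam=lam and s="\<lambda>x. cinner v x *\<^sub>C v" and m=2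
        and \<mu>="\<lambda>_. 0" and hbar=hbar and t=t and C=C and k=1 and n=0, OF _ bounded_lam _ refl]
    by (simp add: system_def coup_def diag_op_ket rank_one_def cinner_scaleC_right)
  have lam: "lam 0 0 = 1" "lam 0 1 = 0" "lam 1 0 = 0" "lam (Suc 0) 0 = 0" "lam 1 1 = 1" "lam (Suc 0) 1 = 1"
    by (simp_all add: lam_def)
  have amp: "amp (cinner v (ket 1) *\<^sub>C v) 0 \<noteq> 0" by (simp add: v_def amp_ops)
  have S: "(\<Sum>(j, l)\<in>{..<2} \<times> {..<2}. h j l) = h 0 0 + h 0 1 + h 1 0 + h 1 (1::nat)"
    for h :: "nat \<Rightarrow> nat \<Rightarrow> complex"
    by (simp add: sum.cartesian_product[symmetric] numeral_2_eq_2 lessThan_Suc add_ac)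
  have par: "parity coup 0 = 1" "parity coup (Suc 0) = - 1" by (simp_all add: coup_def)
  \<comment> \<open>The unmixed terms agree on both sides. The mixed ones sum to
    \<open>- (a + b)\<close>, and the parities reverse that sign, so equal coherences would force
    twice \<open>a + b\<close> to be 0.\<close>
  have "2 * of_real b + 2 * of_real a = (0 :: complex)"
    using arg_cong[OF eq, of "\<lambda>A. amp (app A (ket 1)) 0"] amp hbar
    unfolding coh neg S by (simp add: a(2)[unfolded One_nat_def] b(2)[unfolded One_nat_def] lam par)
  then have "complex_of_real (2 * b + 2 * a) = complex_of_real 0" by simp
  then have "2 * b + 2 * a = 0" by (simp only: of_real_eq_iff)
  then show False using a(1) b(1) by simp
qed

end

section \<open>The partition function of free bosons\<close>

text \<open>Splitting off the occupation number of one mode \<open>a\<close> factors the sum: the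
  occupation numbers give a geometric series, the remaining modes the induction hypothesis.\<close>

lemma sum_prod_mset_le:
  fixes x :: "'m \<Rightarrow> real"
  assumes x: "\<And>m. 0 \<le> x m" "\<And>m. x m < 1" and M: "finite M"
  shows "finite F \<Longrightarrow> (\<And>N. N \<in> F \<Longrightarrow> set_mset N \<subseteq> M) \<Longrightarrow>
    (\<Sum>N\<in>F. \<Prod>m\<in>#N. x m) \<le> (\<Prod>m\<in>M. 1 / (1 - x m))"
  using M
proof (induction M arbitrary: F rule: finite_induct)
  case empty
  then have "F \<subseteq> {{#}}" by auto
  then consider "F = {}" | "F = {{#}}" by blast
  then show ?case by cases auto
next
  case (insert a M)
  let ?P = "\<lambda>N. \<Prod>m\<in>#N. x m"
  define \<phi> where "\<phi> N = (count N a, filter_mset (\<lambda>m. m \<noteq> a) N)" for N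
  have split: "N = replicate_mset (count N a) a + filter_mset (\<lambda>m. m \<noteq> a) N" for N
    by (rule multiset_eqI) auto
  have inj: "inj_on \<phi> F"
    by (rule inj_onI) (metis split \<phi>_def prod.inject)
  have P: "?P N = x a ^ fst (\<phi> N) * ?P (snd (\<phi> N))" for N
    by (subst (1) split) (simp add: \<phi>_def)
  let ?A = "fst ` \<phi> ` F" and ?B = "snd ` \<phi> ` F"
  have P0: "0 \<le> ?P N" for N by (induction N) (simp_all add: x)
  have "(\<Sum>N\<in>F. ?P N) = (\<Sum>(n, N)\<in>\<phi> ` F. x a ^ n * ?P N)"
    by (subst sum.reindex[OF inj]) (simp add: case_prod_unfold flip: P)
  \<comment> \<open>The pairs occurring in \<open>F\<close> need not form a rectangle; as the terms
    are nonnegative it can be filled up, and then the sum factors.\<close>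
  also have "\<dots> \<le> (\<Sum>(n, N)\<in>?A \<times> ?B. x a ^ n * ?P N)"
  proof (rule sum_mono2)
    show "\<phi> ` F \<subseteq> ?A \<times> ?B" by (rule subset_fst_snd)
    show "0 \<le> (case b of (n, N) \<Rightarrow> x a ^ n * ?P N)" for b
      using P0 x(1) by (cases b) simp
  qed (use insert.prems(1) in simp)
  also have "\<dots> = (\<Sum>n\<in>?A. x a ^ n) * (\<Sum>N\<in>?B. ?P N)"
    by (simp add: sum_product sum.cartesian_product)
  also have "\<dots> \<le> 1 / (1 - x a) * (\<Prod>m\<in>M. 1 / (1 - x m))"
  proof (rule mult_mono)
    have "(\<Sum>n\<in>?A. x a ^ n) \<le> (\<Sum>n. x a ^ n)"
      using x insert.prems(1) by (intro sum_le_suminf summable_geometric) auto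
    then show "(\<Sum>n\<in>?A. x a ^ n) \<le> 1 / (1 - x a)" using x by (simp add: suminf_geometric)
    show "(\<Sum>N\<in>?B. ?P N) \<le> (\<Prod>m\<in>M. 1 / (1 - x m))"
    proof (rule insert.IH)
      fix N assume "N \<in> ?B"
      then obtain N' where "N' \<in> F" "N = filter_mset (\<lambda>m. m \<noteq> a) N'" by (auto simp: \<phi>_def)
      then show "set_mset N \<subseteq> M" using insert.prems(2)[of N'] by auto
    qed (use insert.prems(1) in simp)
  qed (use x in \<open>auto intro!: sum_nonneg P0 simp: less_imp_le\<close>)
  also have "\<dots> = (\<Prod>m\<in>insert a M. 1 / (1 - x m))" using insert.hyps by simp
  finally show ?case .
qed

text \<open>The Weierstrass product inequality: expanding one factor at a time leaves a nonnegative
  cross term, which is dropped.\<close>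

lemma one_minus_sum_le_prod:
  fixes x :: "'m \<Rightarrow> real"
  assumes "finite M" "\<And>m. 0 \<le> x m" "\<And>m. x m \<le> 1"
  shows "1 - sum x M \<le> (\<Prod>m\<in>M. 1 - x m)"
  using assms(1)
proof (induction M rule: finite_induct)
  case (insert a M)
  have "0 \<le> x a * sum x M" using assms(2) by (simp add: sum_nonneg)
  then have "1 - sum x (insert a M) \<le> (1 - x a) * (1 - sum x M)"
    using insert.hyps by (simp add: algebra_simps)
  also have "\<dots> \<le> (1 - x a) * (\<Prod>m\<in>M. 1 - x m)"
    using insert.IH assms(3)[of a] by (intro mult_left_mono) auto
  finally show ?case using insert.hyps by simp
qed simp

text \<open>Outside a finite \<open>K\<close> the sum of \<open>x\<close> is below 1/2, which keeps
  the tail product of \<open>1 - x m\<close> at least 1/2. The finite products of geometric series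
  are therefore bounded uniformly in \<open>M\<close>.\<close>

lemma summable_prod_mset:
  fixes x :: "'m \<Rightarrow> real"
  assumes x: "\<And>m. 0 \<le> x m" "\<And>m. x m < 1" and sum: "x summable_on UNIV"
  shows "(\<lambda>N. \<Prod>m\<in>#N. x m) summable_on UNIV"
proof -
  have "eventually (\<lambda>K. dist (sum x K) (infsum x UNIV) < 1 / 2) (finite_subsets_at_top UNIV)"
    using has_sum_infsum[OF sum] unfolding has_sum_def by (intro tendstoD) auto
  then obtain K where K: "finite K" "dist (sum x K) (infsum x UNIV) < 1 / 2"
    unfolding eventually_finite_subsets_at_top by auto
  have bound: "(\<Prod>m\<in>M. 1 / (1 - x m)) \<le> 2 * (\<Prod>m\<in>K. 1 / (1 - x m))" if M: "finite M" "K \<subseteq> M" for M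
  proof -
    have "sum x K + sum x (M - K) = sum x M"
      using M K(1) by (metis sum.subset_diff add.commute)
    also have "\<dots> \<le> infsum x UNIV" by (rule finite_sum_le_infsum[OF sum M(1)]) (auto simp: x)
    finally have "sum x (M - K) < 1 / 2" using K(2) unfolding dist_real_def by linarith
    moreover have "1 - sum x (M - K) \<le> (\<Prod>m\<in>M - K. 1 - x m)"
      by (rule one_minus_sum_le_prod) (use x M(1) in \<open>auto simp: less_imp_le\<close>)
    ultimately have "1 / 2 \<le> (\<Prod>m\<in>M - K. 1 - x m)" by simp
    then have "1 / (\<Prod>m\<in>M - K. 1 - x m) \<le> 2" by (simp add: field_simps)
    then have "(\<Prod>m\<in>M - K. 1 / (1 - x m)) \<le> 2" by (simp add: prod_dividef)
    moreover have "(\<Prod>m\<in>M. 1 / (1 - x m)) = (\<Prod>m\<in>M - K. 1 / (1 - x m)) * (\<Prod>m\<in>K. 1 / (1 - x m))"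
      by (rule prod.subset_diff[OF M(2,1)])
    ultimately show ?thesis
      using x by (auto intro!: mult_right_mono prod_nonneg simp: less_imp_le)
  qed
  show ?thesis
  proof (rule nonneg_bdd_above_summable_on)
    show "0 \<le> (\<Prod>m\<in>#N. x m)" for N by (induction N) (simp_all add: x)
    show "bdd_above (sum (\<lambda>N. \<Prod>m\<in>#N. x m) ` {F. F \<subseteq> UNIV \<and> finite F})"
    proof (rule bdd_aboveI)
      fix y assume "y \<in> sum (\<lambda>N. \<Prod>m\<in>#N. x m) ` {F. F \<subseteq> UNIV \<and> finite F}"
      then obtain F where F: "finite F" "y = (\<Sum>N\<in>F. \<Prod>m\<in>#N. x m)" by auto
      let ?M = "K \<union> (\<Union>N\<in>F. set_mset N)"
      have "y \<le> (\<Prod>m\<in>?M. 1 / (1 - x m))"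
        unfolding F(2) by (rule sum_prod_mset_le) (use x K(1) F(1) in auto)
      also have "\<dots> \<le> 2 * (\<Prod>m\<in>K. 1 / (1 - x m))" by (rule bound) (use K(1) F(1) in auto)
      finally show "y \<le> 2 * (\<Prod>m\<in>K. 1 / (1 - x m))" .
    qed
  qed
qed

section \<open>Radiation\<close>

locale radiation =
  fixes hbar kB temp c :: real and \<kappa> :: "'k \<Rightarrow> real ^ 3"
  assumes pos: "hbar > 0" "kB > 0" "temp > 0" "c > 0"
    and wave_vectors: "wave_vectors \<kappa>"
    and summable_modes: "(\<lambda>k. exp (- (hbar * c * norm (\<kappa> k)) / (kB * temp))) summable_on UNIV"
begin

definition energy :: "('k \<times> bool) multiset \<Rightarrow> real" where
  "energy N = (\<Sum>(k, s)\<in>#N. hbar * c * norm (\<kappa> k))"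

definition cp_mode :: "'k \<times> bool \<Rightarrow> 'k \<times> bool" where "cp_mode = (\<lambda>(k, s). (opposite \<kappa> k, \<not> s))"

definition t_mode :: "'k \<times> bool \<Rightarrow> 'k \<times> bool" where "t_mode = (\<lambda>(k, s). (opposite \<kappa> k, s))"

definition k\<^sub>0 :: 'k where "k\<^sub>0 = undefined"

text \<open>The photon energy at wave vector \<plusminus>\<open>\<kappa> k\<^sub>0\<close>; the
  level distances below are multiples of it. The index \<open>k\<^sub>0\<close> is
  \<open>undefined\<close> because any wave vector serves.\<close>

definition eps :: real where "eps = hbar * c * norm (\<kappa> k\<^sub>0)"

text \<open>The coupling drives the transitions from one to three photons in a mode of wave vector
  \<open>\<plusminus>\<kappa>\<^sub>0\<close>. The number of photons changes by an even amount because time reversal multiplies an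
  \<open>n\<close>-photon state by \<open>(-1)\<^sup>n\<close>.\<close>

definition marked :: "bool \<Rightarrow> ('k \<times> bool) multiset \<Rightarrow> bool" where
  "marked s N \<longleftrightarrow> (\<exists>k\<in>{k\<^sub>0, opposite \<kappa> k\<^sub>0}. \<exists>n\<in>{1, 3}. N = replicate_mset n (k, s))"

definition helicity :: "('k \<times> bool) multiset \<Rightarrow> real" where
  "helicity N = of_bool (marked True N) - of_bool (marked False N)"

text \<open>\<open>4 - size N\<close> exchanges one and three photons. A marked state has all
  photons in one mode, so the choice by \<open>SOME\<close> is determined.\<close>

definition partner :: "('k \<times> bool) multiset \<Rightarrow> ('k \<times> bool) multiset" where
  "partner N = (if marked True N \<or> marked False N
     then replicate_mset (4 - size N) (SOME m. m \<in># N) else N)"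

text \<open>Two photons of energy \<open>eps\<close> separate the levels of a pair. Raising the
  one-photon level by \<open>2 * eps\<close> makes the pair degenerate at \<open>3 * eps\<close>;
  lowering it puts it at \<open>- eps\<close>, which gives the gap \<open>4 * eps\<close>.\<close>

definition level_shift :: "('k \<times> bool) multiset \<Rightarrow> real" where
  "level_shift N = (if size N = 1 then 2 * eps * helicity N else 0)"

lemma \<kappa>_opposite: "\<kappa> (opposite \<kappa> k) = - \<kappa> k"
proof -
  have "- \<kappa> k \<in> range \<kappa>" using wave_vectors unfolding wave_vectors_def by blast
  then show ?thesis unfolding opposite_def by (rule f_inv_into_f)
qed

lemma opposite_opposite: "opposite \<kappa> (opposite \<kappa> k) = k"
  using wave_vectors \<kappa>_opposite[of "opposite \<kappa> k"] \<kappa>_opposite[of k]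
  by (auto simp: wave_vectors_def dest: injD)

lemma modes: "cp_mode (cp_mode m) = m" "t_mode (t_mode m) = m"
  by (simp_all add: cp_mode_def t_mode_def opposite_opposite split: prod.splits)

lemma energy_image:
  "energy (image_mset cp_mode N) = energy N" "energy (image_mset t_mode N) = energy N"
  by (simp_all add: energy_def cp_mode_def t_mode_def multiset.map_comp o_def case_prod_unfold \<kappa>_opposite)

lemma marked_cases:
  assumes "marked s N"
  obtains k n where "k \<in> {k\<^sub>0, opposite \<kappa> k\<^sub>0}" "n = 1 \<or> n = 3" "N = replicate_mset n (k, s)"
  using assms unfolding marked_def by blast

lemma marked_set: "marked s N \<Longrightarrow> \<exists>k. set_mset N = {(k, s)}"
  by (auto simp: marked_def)

lemma marked_disjoint: "marked s N \<Longrightarrow> \<not> marked (\<not> s) N"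
  using marked_set[of s N] marked_set[of "\<not> s" N] by auto

lemma image_modes: "image_mset cp_mode (image_mset cp_mode N) = N" "image_mset t_mode (image_mset t_mode N) = N"
  by (simp_all add: multiset.map_comp o_def modes)

lemma marked_imp_image: "marked s N \<Longrightarrow> marked (\<not> s) (image_mset cp_mode N)"
  "marked s N \<Longrightarrow> marked s (image_mset t_mode N)"
  by (auto simp: marked_def cp_mode_def t_mode_def opposite_opposite)

lemma marked_image: "marked s (image_mset cp_mode N) \<longleftrightarrow> marked (\<not> s) N"
  "marked s (image_mset t_mode N) \<longleftrightarrow> marked s N"
  using marked_imp_image[of s "image_mset cp_mode N"] marked_imp_image[of "\<not> s" N]
    marked_imp_image[of s "image_mset t_mode N"] marked_imp_image[of s N]
  by (auto simp: image_modes)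

lemma partner_replicate:
  assumes "k \<in> {k\<^sub>0, opposite \<kappa> k\<^sub>0}" "n = 1 \<or> n = 3"
  shows "partner (replicate_mset n (k, s)) = replicate_mset (4 - n) (k, s)"
    and "marked s (replicate_mset n (k, s))"
proof -
  show m: "marked s (replicate_mset n (k, s))" unfolding marked_def using assms by blast
  have "(SOME m. m \<in># replicate_mset n (k, s)) = (k, s)" using assms(2) by auto
  moreover have "marked True (replicate_mset n (k, s)) \<or> marked False (replicate_mset n (k, s))"
    using m by (cases s) auto
  ultimately show "partner (replicate_mset n (k, s)) = replicate_mset (4 - n) (k, s)"
    by (simp add: partner_def)
qed

lemma partner_unmarked: "\<not> marked True N \<Longrightarrow> \<not> marked False N \<Longrightarrow> partner N = N"
  by (simp add: partner_def)

lemma marked_exhaust: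
  obtains (marked) k n s where "k \<in> {k\<^sub>0, opposite \<kappa> k\<^sub>0}" "n = 1 \<or> n = 3" "N = replicate_mset n (k, s)"
  | (unmarked) "\<not> marked True N" "\<not> marked False N"
  using marked_cases by metis

lemma helicity_replicate:
  assumes "k \<in> {k\<^sub>0, opposite \<kappa> k\<^sub>0}" "n = 1 \<or> n = 3"
  shows "helicity (replicate_mset n (k, s)) = (if s then 1 else - 1)"
  using partner_replicate(2)[OF assms, of s] marked_disjoint[of s "replicate_mset n (k, s)"]
  by (cases s) (simp_all add: helicity_def)

lemma helicity_unmarked: "\<not> marked True N \<Longrightarrow> \<not> marked False N \<Longrightarrow> helicity N = 0"
  by (simp add: helicity_def)

lemma opposite_in: "k \<in> {k\<^sub>0, opposite \<kappa> k\<^sub>0} \<Longrightarrow> opposite \<kappa> k \<in> {k\<^sub>0, opposite \<kappa> k\<^sub>0}"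
  by (auto simp: opposite_opposite)

lemma partner_image:
  "image_mset cp_mode (partner N) = partner (image_mset cp_mode N)"
  "image_mset t_mode (partner N) = partner (image_mset t_mode N)"
proof -
  show "image_mset cp_mode (partner N) = partner (image_mset cp_mode N)"
  proof (cases N rule: marked_exhaust)
    case (marked k n s)
    show ?thesis
      using partner_replicate(1)[OF marked(1,2)] partner_replicate(1)[OF opposite_in[OF marked(1)] marked(2)]
      by (simp add: marked(3) cp_mode_def)
  qed (simp add: partner_unmarked marked_image)
  show "image_mset t_mode (partner N) = partner (image_mset t_mode N)"
  proof (cases N rule: marked_exhaust)
    case (marked k n s)
    show ?thesis
      using partner_replicate(1)[OF marked(1,2)] partner_replicate(1)[OF opposite_in[OF marked(1)] marked(2)]
      by (simp add: marked(3) t_mode_def)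
  qed (simp add: partner_unmarked marked_image)
qed

lemma norm_marked: "k \<in> {k\<^sub>0, opposite \<kappa> k\<^sub>0} \<Longrightarrow> hbar * c * norm (\<kappa> k) = eps"
  by (auto simp: eps_def \<kappa>_opposite)

lemma eps_pos: "eps > 0"
proof -
  have "\<kappa> k\<^sub>0 \<noteq> 0" using wave_vectors unfolding wave_vectors_def by (metis rangeI)
  then show ?thesis using pos by (simp add: eps_def)
qed

lemma energy_replicate:
  "k \<in> {k\<^sub>0, opposite \<kappa> k\<^sub>0} \<Longrightarrow> energy (replicate_mset n (k, s)) = real n * eps"
  using norm_marked[of k] by (simp add: energy_def)

text \<open>The Boltzmann weight is a product of one factor per photon. Each factor is below 1 since
  no wave vector is zero, and the two helicities double a sum over wave vectors that converges by
  assumption.\<close>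

lemma summable_energy: "(\<lambda>N. exp (- energy N / (kB * temp))) summable_on UNIV"
proof -
  define x where "x m = exp (- (hbar * c * norm (\<kappa> (fst m))) / (kB * temp))" for m :: "'k \<times> bool"
  have x0: "0 \<le> x m" for m by (simp add: x_def)
  have x1: "x m < 1" for m
  proof -
    have "\<kappa> (fst m) \<noteq> 0" using wave_vectors unfolding wave_vectors_def by (metis rangeI)
    then show ?thesis using pos by (simp add: x_def)
  qed
  have "x summable_on UNIV"
  proof -
    have "x summable_on UNIV \<times> UNIV"
    proof (rule summable_on_SigmaI[where g="\<lambda>k. 2 * exp (- (hbar * c * norm (\<kappa> k)) / (kB * temp))"])
      show "((\<lambda>s. x (k, s)) has_sum 2 * exp (- (hbar * c * norm (\<kappa> k)) / (kB * temp))) UNIV" for k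
        by (rule has_sum_finiteI) (simp_all add: x_def)
    qed (use summable_modes in \<open>auto intro!: summable_on_cmult_right simp: x_def\<close>)
    then show ?thesis by simp
  qed
  then have "(\<lambda>N. \<Prod>m\<in>#N. x m) summable_on UNIV" by (rule summable_prod_mset[OF x0 x1])
  moreover have "(\<Prod>m\<in>#N. x m) = exp (- energy N / (kB * temp))" for N
    by (induction N) (simp_all add: x_def energy_def case_prod_unfold exp_add[symmetric] add_divide_distrib diff_divide_distrib)
  ultimately show ?thesis by simp
qed

sublocale conductive_bath hbar kB temp "4 * eps" energy "image_mset cp_mode" "image_mset t_mode" partner
  "\<lambda>N. (- 1) ^ size N" helicity level_shift
proof
  show "hbar > 0" "4 * eps > 0" using pos eps_pos by simp_all
  show "image_mset cp_mode (image_mset cp_mode N) = N" "image_mset t_mode (image_mset t_mode N) = N" for N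
    by (rule image_modes)+
  show "image_mset cp_mode (partner N) = partner (image_mset cp_mode N)"
    "image_mset t_mode (partner N) = partner (image_mset t_mode N)" for N by (rule partner_image)+
  show "energy (image_mset cp_mode N) = energy N" "energy (image_mset t_mode N) = energy N" for N
    by (rule energy_image)+
  show "(- 1) ^ size N = (1 :: real) \<or> (- 1) ^ size N = (- 1 :: real)" for N :: "('k \<times> bool) multiset"
    by (cases "even (size N)") simp_all
  show hel: "helicity (image_mset cp_mode N) = - helicity N" "helicity (image_mset t_mode N) = helicity N" for N
    by (simp_all add: helicity_def marked_image)
  show "level_shift (image_mset cp_mode N) = - level_shift N" "level_shift (image_mset t_mode N) = level_shift N" for N
    by (simp_all add: level_shift_def hel)
  show "helicity N = 1 \<or> helicity N = - 1 \<or> helicity N = 0" for N by (simp add: helicity_def)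
  show "\<exists>C. \<forall>N. \<bar>level_shift N\<bar> \<le> C"
    using eps_pos by (auto simp: level_shift_def helicity_def abs_mult intro!: exI[of _ "2 * eps"])
  show "(\<lambda>N. exp (- energy N / (kB * temp))) summable_on UNIV" by (rule summable_energy)
  have "{N. helicity N \<noteq> 0} \<subseteq> (\<lambda>(n, m). replicate_mset n m) ` ({1, 3} \<times> {k\<^sub>0, opposite \<kappa> k\<^sub>0} \<times> UNIV)"
  proof
    fix N assume "N \<in> {N. helicity N \<noteq> 0}"
    then show "N \<in> (\<lambda>(n, m). replicate_mset n m) ` ({1, 3} \<times> {k\<^sub>0, opposite \<kappa> k\<^sub>0} \<times> UNIV)"
      by (cases N rule: marked_exhaust) (force simp: helicity_unmarked image_iff)+
  qed
  then show "finite {N. helicity N \<noteq> 0}" by (rule finite_subset) simp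
  show "\<exists>N. helicity N = 1" using helicity_replicate[of k\<^sub>0 1 True] by auto
  have single: "partner {#(k, s)#} = replicate_mset 3 (k, s)" "energy {#(k, s)#} = eps"
    "helicity {#(k, s)#} = (if s then 1 else - 1)" if "k \<in> {k\<^sub>0, opposite \<kappa> k\<^sub>0}" for k s
    using partner_replicate(1)[OF that, of 1 s] energy_replicate[OF that, of 1 s]
      helicity_replicate[OF that, of 1 s] by simp_all
  note simps = partner_replicate(1) helicity_replicate energy_replicate level_shift_def single
  show "partner (partner N) = N" for N
    by (cases N rule: marked_exhaust) (auto simp: simps partner_unmarked)
  show "(- 1) ^ size (partner N) = ((- 1) ^ size N :: real)" for N
    by (cases N rule: marked_exhaust) (auto simp: simps partner_unmarked)
  show "helicity (partner N) = helicity N" for N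
    by (cases N rule: marked_exhaust) (auto simp: simps partner_unmarked)
  show "partner N \<noteq> N" if "helicity N \<noteq> 0" for N
  proof (cases N rule: marked_exhaust)
    case (marked k n s)
    then have "size (partner N) \<noteq> size N" by (auto simp: simps)
    then show ?thesis by auto
  qed (use that in \<open>simp add: helicity_unmarked\<close>)
  show "energy (partner N) + level_shift (partner N) = energy N + level_shift N" if "helicity N = 1" for N
    using that by (cases N rule: marked_exhaust) (auto simp: simps helicity_unmarked split: if_splits)
  show "\<bar>energy (partner N) + level_shift (partner N) - (energy N + level_shift N)\<bar> = 4 * eps"
    if "helicity N = - 1" for N
    using that eps_pos by (cases N rule: marked_exhaust) (auto simp: simps helicity_unmarked split: if_splits)
qed

lemma bath_eq: "photon_bath hbar c \<kappa> = bath"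
  unfolding bath_def photon_bath_def
  by (simp add: energy_def[abs_def] cp_mode_def t_mode_def mono_vec_def[abs_def]
      mono_cvec_def[abs_def])

end

theorem theorem1:
  fixes hbar kB temp c :: real
  assumes "hbar > 0" "kB > 0" "temp > 0" "c > 0"
  shows
    "(\<forall>(S :: 's sector) (B :: 'b sector) K \<rho>\<^sub>B.
        sector_ok S \<and> sector_ok B \<and> coupling_ok S B K \<and> gibbs_state kB temp (ham B) \<rho>\<^sub>B \<longrightarrow>
        apparently_cp_invariant (cp S) (redfield_bath hbar S B K \<rho>\<^sub>B)) \<and>
     (\<forall>\<kappa> :: 'k \<Rightarrow> real ^ 3. let B = photon_bath hbar c \<kappa> in
        wave_vectors \<kappa> \<and>
        (\<lambda>k. exp (- (hbar * c * norm (\<kappa> k)) / (kB * temp))) summable_on UNIV \<longrightarrow>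
        (\<exists>(S :: 3 sector) (G :: 2 sector) K h \<rho> \<rho>\<^sub>B.
           sector_ok S \<and> coupling_ok S B K \<and> environment_ok B G h \<rho> \<and>
           gibbs_state kB temp (ham B) \<rho>\<^sub>B \<and> ptrace2 \<rho> = \<rho>\<^sub>B \<and>
           \<not> cp_balanced (cp G) (ptrace1 \<rho>) \<and>
           moments_exist hbar B G h K \<rho> \<and>
           apparent_cp_bias (cp S) (redfield_env hbar S B G h K \<rho>))) \<and>
     (\<forall>(S :: 's sector) (B :: 'b sector) (G :: 'g sector) K h \<rho>.
        sector_ok S \<and> coupling_ok S B K \<and> environment_ok B G h \<rho> \<and> cp_diagonal_coupling B K \<longrightarrow>
        apparently_cp_invariant (cp S) (redfield_env hbar S B G h K \<rho>) \<and>
        (\<forall>t\<ge>0. \<forall>\<sigma>. density_op \<sigma> \<longrightarrow>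
           redfield_env hbar S B G h K (conj_op (tensor_unitary (cp B) (cp G)) \<rho>) t \<sigma> =
           redfield_env hbar S B G h K \<rho> t \<sigma>))"
  unfolding Let_def
proof (intro conjI allI impI)
  fix S :: "'s sector" and B :: "'b sector" and K \<rho>\<^sub>B
  assume "sector_ok S \<and> sector_ok B \<and> coupling_ok S B K \<and> gibbs_state kB temp (ham B) \<rho>\<^sub>B"
  then show "apparently_cp_invariant (cp S) (redfield_bath hbar S B K \<rho>\<^sub>B)"
    using equilibrated_bath_no_bias by blast
next
  fix \<kappa> :: "'k \<Rightarrow> real ^ 3"
  assume "wave_vectors \<kappa> \<and>
    (\<lambda>k. exp (- (hbar * c * norm (\<kappa> k)) / (kB * temp))) summable_on UNIV"
  then interpret radiation hbar kB temp c \<kappa> using assms by unfold_locales auto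
  show "\<exists>(S :: 3 sector) (G :: 2 sector) K h \<rho> \<rho>\<^sub>B.
     sector_ok S \<and> coupling_ok S (photon_bath hbar c \<kappa>) K \<and>
     environment_ok (photon_bath hbar c \<kappa>) G h \<rho> \<and>
     gibbs_state kB temp (ham (photon_bath hbar c \<kappa>)) \<rho>\<^sub>B \<and> ptrace2 \<rho> = \<rho>\<^sub>B \<and>
     \<not> cp_balanced (cp G) (ptrace1 \<rho>) \<and> moments_exist hbar (photon_bath hbar c \<kappa>) G h K \<rho> \<and>
     apparent_cp_bias (cp S) (redfield_env hbar S (photon_bath hbar c \<kappa>) G h K \<rho>)"
    unfolding bath_eq
    by (rule exI[of _ system], rule exI[of _ surroundings], rule exI[of _ coup], rule exI[of _ shift],
        rule exI[of _ \<rho>], rule exI[of _ \<rho>\<^sub>B])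
       (intro conjI sectors_ok(2) coupling_ok_coup environment_ok gibbs_state_\<rho>\<^sub>B ptrace2_\<rho>
         unbalanced moments_exist bias)
next
  fix S :: "'s sector" and B :: "'b sector" and G :: "'g sector" and K h \<rho>
  assume a: "sector_ok S \<and> coupling_ok S B K \<and> environment_ok B G h \<rho> \<and> cp_diagonal_coupling B K"
  then show "apparently_cp_invariant (cp S) (redfield_env hbar S B G h K \<rho>)"
    using cp_diagonal_coupling_screens(1) by blast
  fix t \<sigma>
  show "redfield_env hbar S B G h K (conj_op (tensor_unitary (cp B) (cp G)) \<rho>) t \<sigma> =
      redfield_env hbar S B G h K \<rho> t \<sigma>"
    using a cp_diagonal_coupling_screens(2) by blast
qed

end
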